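(* Let $\Phi,\Psi\in\overline{\varPhi}_Y$ and $\rho:(0,\infty)\to(0,\infty)$. Assume that $\int_0^1\frac{\rho(t)}t\,dt<\infty$ and that there exist positive constants $C,K_1,K_2$ with $K_1<K_2$ such that $\sup_{r\le t\le2r}\rho(t)\le C\int_{K_1r}^{K_2r}\frac{\rho(t)}t\,dt$ for all $r>0$. (i) Assume that there exists a positive constant $A$ such that, for all $r\in(0,\infty)$, $$\int_0^r\frac{\rho(t)}t\,dt\;\Phi^{-1}(1/r^n)+\int_r^\infty\frac{\rho(t)\,\Phi^{-1}(1/t^n)}t\,dt\le A\,\Psi^{-1}(1/r^n).\qquad( * )$$ Then, for any positive constant $C_0$, there exists a positive constant $C_1$ such that, for all $f\in L^\Phi(\mathbb{R}^n)$ with $f\not\equiv0$, $$\Psi\left(\frac{|I_\rho f(x)|}{C_1\|f\|_{L^\Phi}}\right)\le\Phi\left(\frac{Mf(x)}{C_0\|f\|_{L^\Phi}}\right),\quad x\in\mathbb{R}^n.$$ Consequently, $I_\rho$ is bounded from $L^\Phi(\mathbb{R}^n)$ to $\mathrm{w}L^\Psi(\mathbb{R}^n)$. Moreover, if $\Phi\in\overline\nabla_2$, then, for all $f\in\mathrm{w}L^\Phi(\mathbb{R}^n)$ with $f\not\equiv0$, $$\Psi\left(\frac{|I_\rho f(x)|}{C_1\|f\|_{\mathrm{w}L^\Phi}}\right)\le\Phi\left(\frac{Mf(x)}{C_0\|f\|_{\mathrm{w}L^\Phi}}\right),\quad x\in\mathbb{R}^n.$$ Consequently, if $\Phi\in\overline\nabla_2$,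 then $I_\rho$ is bounded from $L^\Phi(\mathbb{R}^n)$ to $L^\Psi(\mathbb{R}^n)$ and from $\mathrm{w}L^\Phi(\mathbb{R}^n)$ to $\mathrm{w}L^\Psi(\mathbb{R}^n)$. (ii) If $I_\rho$ is bounded from $L^\Phi(\mathbb{R}^n)$ to $\mathrm{w}L^\Psi(\mathbb{R}^n)$, then there exists a positive constant $A'$ such that, for all $r\in(0,\infty)$, $$\int_0^r\frac{\rho(t)}t\,dt\;\Phi^{-1}(1/r^n)\le A'\,\Psi^{-1}(1/r^n).\qquad( ** )$$ Moreover, under the assumption that there exists a positive constant $A''$ such that, for all $r\in(0,\infty)$, $$\int_r^\infty\frac{\rho(t)\,\Phi^{-1}(1/t^n)}t\,dt\le A''\,\Psi^{-1}(1/r^n),\qquad( *** )$$ if $I_\rho$ is bounded from $L^\Phi(\mathbb{R}^n)$ to $\mathrm{w}L^\Psi(\mathbb{R}^n)$, then $( * )$ holds for some $A\in(0,\infty)$ and for all $r\in(0,\infty)$. (iii) In part (ii), the boundedness from $L^\Phi(\mathbb{R}^n)$ to $\mathrm{w}L^\Psi(\mathbb{R}^n)$ can be replaced by the boundedness from $L^\Phi(\mathbb{R}^n)$ to $L^{(1,\psi)}(\mathbb{R}^n)$ with $\psi(r)=\Psi^{-1}(1/r^n)$; that is, if $I_\rho$ is bounded from $L^\Phi(\mathbb{R}^n)$ to $L^{(1,\psi)}(\mathbb{R}^n)$, then $( ** )$ holds for some $A'\in(0,\infty)$ and all $r\in(0,\infty)$, and if in addition $( *** )$ holds for some $A''\in(0,\infty)$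 and all $r\in(0,\infty)$, then $( * )$ holds for some $A\in(0,\infty)$ and all $r\in(0,\infty)$.
   Context: $|G|$ is the Lebesgue measure of $G\subset\mathbb{R}^n$; $B(a,r)$ is the open ball with center $a$ and radius $r$; $m(f,t)=|\{x\in\mathbb{R}^n:|f(x)|>t\}|$. Functions appearing under integral signs are understood to be measurable. The generalized fractional integral operator is $I_\rho f(x)=\int_{\mathbb{R}^n}\frac{\rho(|x-y|)}{|x-y|^n}f(y)\,dy$. $M$ is the Hardy-Littlewood maximal operator, $Mf(x)=\sup_{B\ni x}\frac1{|B|}\int_B|f(y)|\,dy$, supremum over all balls $B$ containing $x$. An operator $T$ is bounded from $X$ to $Y$ if there is a constant $C>0$ with $\|Tf\|_Y\le C\|f\|_X$ for all $f\in X$. "Increasing" means nondecreasing. For an increasing $\Phi:[0,\infty]\to[0,\infty]$ let $a(\Phi)=\sup\{t\ge0:\Phi(t)=0\}$ and $b(\Phi)=\inf\{t\ge0:\Phi(t)=\infty\}$, with $\sup\emptyset=0$, $\inf\emptyset=\infty$. $\overline{\varPhi}$ is the set of all increasing $\Phi:[0,\infty]\to[0,\infty]$ such that: $0\le a(\Phi)<\infty$ and $0<b(\Phi)\le\infty$; $\lim_{t\to+0}\Phi(t)=\Phi(0)=0$; $\Phi$ is left continuous on $[0,b(\Phi))$; if $b(\Phi)=\infty$ then $\lim_{t\to\infty}\Phi(t)=\Phi(\infty)=\infty$; if $b(\Phi)<\infty$ then $\lim_{t\to b(\Phi)-0}\Phi(t)=\Phi(b(\Phi))$ $(\le\infty)$.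 For $\Phi\in\overline{\varPhi}$ the generalized inverse is $\Phi^{-1}(u)=\inf\{t\ge0:\Phi(t)>u\}$ for $u\in[0,\infty)$ and $\Phi^{-1}(\infty)=\infty$. $\Phi\in\overline{\varPhi}$ is a Young function if it is convex on $[0,b(\Phi))$; $\varPhi_Y$ is the set of Young functions. $\Phi\approx\Psi$ means there is $C>0$ with $\Phi(C^{-1}t)\le\Psi(t)\le\Phi(Ct)$ for all $t\in[0,\infty]$. $\overline{\varPhi}_Y$ is the set of all $\Phi\in\overline{\varPhi}$ such that $\Phi\approx\Psi$ for some $\Psi\in\varPhi_Y$. $\overline\nabla_2$ is the set of all $\Phi\in\overline{\varPhi}$ for which there is $k>1$ with $\Phi(t)\le\frac1{2k}\Phi(kt)$ for all $t>0$. For $\Phi\in\overline{\varPhi}_Y$, the Orlicz space $L^\Phi(\mathbb{R}^n)$ and weak Orlicz space $\mathrm{w}L^\Phi(\mathbb{R}^n)$ are the sets of measurable $f$ on $\mathbb{R}^n$ for which, respectively, $$\|f\|_{L^\Phi}=\inf\Big\{\lambda>0:\int_{\mathbb{R}^n}\Phi\Big(\frac{|f(x)|}\lambda\Big)dx\le1\Big\},\quad \|f\|_{\mathrm{w}L^\Phi}=\inf\Big\{\lambda>0:\sup_{t\in(0,\infty)}\Phi(t)\,m(f/\lambda,t)\le1\Big\}$$ is finite (with $0\cdot\infty=0$). For $\psi:(0,\infty)\to(0,\infty)$, $L^{(1,\psi)}(\mathbb{R}^n)$ is the set of measurable $f$ with $\|f\|_{L^{(1,\psi)}}=\sup_{B=B(a,r)}\frac1{\psi(r)|B|}\int_B|f(x)|\,dx<\infty$,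 supremum over all balls. *)

theory Defs
  imports "HOL-Analysis.Analysis"
begin

(* In ennreal, Sup {} = 0 and Inf {} = \<infinity>, which are the conventions wanted here. *)

definition a_of :: "(ennreal \<Rightarrow> ennreal) \<Rightarrow> ennreal" where
  "a_of \<Phi> = Sup {t. \<Phi> t = 0}"

definition b_of :: "(ennreal \<Rightarrow> ennreal) \<Rightarrow> ennreal" where
  "b_of \<Phi> = Inf {t. \<Phi> t = \<infinity>}"

definition Phi_bar :: "(ennreal \<Rightarrow> ennreal) set" where
  "Phi_bar = {\<Phi>. mono \<Phi> \<and>
     a_of \<Phi> < \<infinity> \<and> 0 < b_of \<Phi> \<and>
     (\<Phi> \<longlongrightarrow> 0) (at_right 0) \<and> \<Phi> 0 = 0 \<and>
     (\<forall>t < b_of \<Phi>. continuous (at_left t) \<Phi>) \<and>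
     (b_of \<Phi> = \<infinity> \<longrightarrow> (\<Phi> \<longlongrightarrow> \<infinity>) (at_left \<infinity>) \<and> \<Phi> \<infinity> = \<infinity>) \<and>
     (b_of \<Phi> < \<infinity> \<longrightarrow> (\<Phi> \<longlongrightarrow> \<Phi> (b_of \<Phi>)) (at_left (b_of \<Phi>)))}"

definition gen_inverse :: "(ennreal \<Rightarrow> ennreal) \<Rightarrow> ennreal \<Rightarrow> ennreal" where
  "gen_inverse \<Phi> u = (if u = \<infinity> then \<infinity> else Inf {t. \<Phi> t > u})"

(* \<Phi> is finite on [0, b(\<Phi>)), so the passage to real values loses nothing there. *)
definition Phi_Y :: "(ennreal \<Rightarrow> ennreal) set" where
  "Phi_Y = {\<Phi> \<in> Phi_bar.
     convex_on {t::real. 0 \<le> t \<and> ennreal t < b_of \<Phi>} (\<lambda>t. enn2real (\<Phi> (ennreal t)))}"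

definition Phi_equiv :: "(ennreal \<Rightarrow> ennreal) \<Rightarrow> (ennreal \<Rightarrow> ennreal) \<Rightarrow> bool" where
  "Phi_equiv \<Phi> \<Psi> \<longleftrightarrow> (\<exists>C::real. C > 0 \<and>
     (\<forall>t. \<Phi> (ennreal (inverse C) * t) \<le> \<Psi> t \<and> \<Psi> t \<le> \<Phi> (ennreal C * t)))"

definition Phi_bar_Y :: "(ennreal \<Rightarrow> ennreal) set" where
  "Phi_bar_Y = {\<Phi> \<in> Phi_bar. \<exists>\<Psi> \<in> Phi_Y. Phi_equiv \<Phi> \<Psi>}"

definition nabla2_bar :: "(ennreal \<Rightarrow> ennreal) set" where
  "nabla2_bar = {\<Phi> \<in> Phi_bar. \<exists>k::real. k > 1 \<and>
     (\<forall>t > 0. \<Phi> t \<le> \<Phi> (ennreal k * t) / ennreal (2 * k))}"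

definition orlicz_norm :: "(ennreal \<Rightarrow> ennreal) \<Rightarrow> (real ^ 'n \<Rightarrow> real) \<Rightarrow> ennreal" where
  "orlicz_norm \<Phi> f = Inf (ennreal ` {l. l > 0 \<and>
     (\<integral>\<^sup>+x. \<Phi> (ennreal (\<bar>f x\<bar> / l)) \<partial>lebesgue) \<le> 1})"

definition orlicz_space :: "(ennreal \<Rightarrow> ennreal) \<Rightarrow> (real ^ 'n \<Rightarrow> real) set" where
  "orlicz_space \<Phi> = {f \<in> borel_measurable lebesgue. orlicz_norm \<Phi> f < \<infinity>}"

definition distr_fun :: "(real ^ 'n \<Rightarrow> real) \<Rightarrow> real \<Rightarrow> ennreal" where
  "distr_fun f t = emeasure lebesgue {x. \<bar>f x\<bar> > t}"

definition weak_orlicz_norm :: "(ennreal \<Rightarrow> ennreal) \<Rightarrow> (real ^ 'n \<Rightarrow> real) \<Rightarrow> ennreal" where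
  "weak_orlicz_norm \<Phi> f = Inf (ennreal ` {l. l > 0 \<and>
     (SUP t\<in>{0<..}. \<Phi> (ennreal t) * distr_fun (\<lambda>x. f x / l) t) \<le> 1})"

definition weak_orlicz_space :: "(ennreal \<Rightarrow> ennreal) \<Rightarrow> (real ^ 'n \<Rightarrow> real) set" where
  "weak_orlicz_space \<Phi> = {f \<in> borel_measurable lebesgue. weak_orlicz_norm \<Phi> f < \<infinity>}"

definition morrey_norm :: "(real \<Rightarrow> ennreal) \<Rightarrow> (real ^ 'n \<Rightarrow> real) \<Rightarrow> ennreal" where
  "morrey_norm \<psi> f = (SUP (a, r) \<in> UNIV \<times> {0<..}.
     (\<integral>\<^sup>+x\<in>ball a r. ennreal \<bar>f x\<bar> \<partial>lebesgue) / (\<psi> r * emeasure lebesgue (ball a r)))"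

definition morrey_space :: "(real \<Rightarrow> ennreal) \<Rightarrow> (real ^ 'n \<Rightarrow> real) set" where
  "morrey_space \<psi> = {f \<in> borel_measurable lebesgue. morrey_norm \<psi> f < \<infinity>}"

definition maximal :: "(real ^ 'n \<Rightarrow> real) \<Rightarrow> real ^ 'n \<Rightarrow> ennreal" where
  "maximal f x = (SUP (a, r) \<in> {(a, r). r > 0 \<and> x \<in> ball a r}.
     (\<integral>\<^sup>+y\<in>ball a r. ennreal \<bar>f y\<bar> \<partial>lebesgue) / emeasure lebesgue (ball a r))"

definition frac_integrand ::
    "(real \<Rightarrow> real) \<Rightarrow> (real ^ 'n \<Rightarrow> real) \<Rightarrow> real ^ 'n \<Rightarrow> real ^ 'n \<Rightarrow> real" where
  "frac_integrand \<rho> f x y = \<rho> (norm (x - y)) / norm (x - y) ^ CARD('n) * f y"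

definition frac_int :: "(real \<Rightarrow> real) \<Rightarrow> (real ^ 'n \<Rightarrow> real) \<Rightarrow> real ^ 'n \<Rightarrow> real" where
  "frac_int \<rho> f x = integral\<^sup>L lebesgue (frac_integrand \<rho> f x)"

(* integral\<^sup>L is 0 for non-integrable functions. To keep this convention from making
   statements about frac_int vacuous, the absolute value is taken to be \<infinity> at points where
   the integral does not converge absolutely, and boundedness requires absolute convergence
   almost everywhere. *)

definition abs_frac_int :: "(real \<Rightarrow> real) \<Rightarrow> (real ^ 'n \<Rightarrow> real) \<Rightarrow> real ^ 'n \<Rightarrow> ennreal" where
  "abs_frac_int \<rho> f x =
     (if integrable lebesgue (frac_integrand \<rho> f x) then ennreal \<bar>frac_int \<rho> f x\<bar> else \<infinity>)"

definition frac_int_bounded :: "(real \<Rightarrow> real) \<Rightarrow>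
    (real ^ 'n \<Rightarrow> real) set \<Rightarrow> ((real ^ 'n \<Rightarrow> real) \<Rightarrow> ennreal) \<Rightarrow>
    (real ^ 'n \<Rightarrow> real) set \<Rightarrow> ((real ^ 'n \<Rightarrow> real) \<Rightarrow> ennreal) \<Rightarrow> bool" where
  "frac_int_bounded \<rho> X norm_X Y norm_Y \<longleftrightarrow> (\<exists>C::real. C > 0 \<and> (\<forall>f\<in>X.
     (AE x in lebesgue. integrable lebesgue (frac_integrand \<rho> f x)) \<and>
     frac_int \<rho> f \<in> Y \<and> norm_Y (frac_int \<rho> f) \<le> ennreal C * norm_X f))"

definition rho_int :: "(real \<Rightarrow> real) \<Rightarrow> real \<Rightarrow> real \<Rightarrow> ennreal" where
  "rho_int \<rho> a b = (\<integral>\<^sup>+t\<in>{a<..<b}. ennreal (\<rho> t / t) \<partial>lebesgue)"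

definition rho_tail :: "nat \<Rightarrow> (ennreal \<Rightarrow> ennreal) \<Rightarrow> (real \<Rightarrow> real) \<Rightarrow> real \<Rightarrow> ennreal" where
  "rho_tail n \<Phi> \<rho> r =
     (\<integral>\<^sup>+t\<in>{r<..}. ennreal (\<rho> t) * gen_inverse \<Phi> (ennreal (1 / t ^ n)) / ennreal t \<partial>lebesgue)"

end

theory Submission
  imports Defs
begin

text \<open>
  Sufficiency. By the growth condition,
  \<open>\<rho>(|x - y|)\<close> is at most \<open>C\<close> times the integral of \<open>\<rho>(t)/t\<close> over \<open>K1 |x - y| < t < K2 |x - y|\<close>, so Tonelli's theorem
  bounds \<open>I\<^sub>\<rho> |f| (x)\<close> by an integral over \<open>t\<close> of \<open>\<rho>(t)/t\<close> times the mean of \<open>|f|\<close> over \<open>B(x, t/K1)\<close>;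
  no dyadic decomposition is needed. For \<open>t < r\<close> the mean is at most \<open>Mf(x)\<close>; for \<open>t > r\<close> it is at most
  a multiple of \<open>\<Phi>\<^sup>-\<^sup>1(1/t\<^sup>n)\<close>. Taking \<open>u = 1/r\<^sup>n\<close> with \<open>Mf(x) \<le> C\<^sub>0 \<Phi>\<^sup>-\<^sup>1(u)\<close> then gives
  \<open>I\<^sub>\<rho> |f| (x) \<le> C\<^sub>1 \<Psi>\<^sup>-\<^sup>1(u)\<close>, which is the pointwise inequality, and the mapping properties follow from
  those of the maximal operator.

  Necessity. For the indicator \<open>f\<close> of \<open>B(0, 2r)\<close>, polar coordinates bound \<open>I\<^sub>\<rho> f\<close> on \<open>B(0, r)\<close> from below
  by a multiple of the integral of \<open>\<rho>(t)/t\<close> over \<open>(0, r)\<close>, while the norm of \<open>f\<close> is at most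
  \<open>1/\<Phi>\<^sup>-\<^sup>1(1/|B(0, 2r)|)\<close>.
\<close>

subsection \<open>Orlicz functions and their generalized inverses\<close>

text \<open>The obstacle is that \<Phi> and \<Psi> need not be invertible: they may vanish near 0,
  be constant on intervals and jump, even to \<infinity>. Two halves of an inverse relation survive,
  \<open>gen_inverse_ge\<close> and \<open>Phi_gen_inverse_le\<close>, and they suffice because a
  modular inequality can be tested against every \<open>u\<close> above its right side. Convexity
  holds only up to equivalence, so a multiplicative constant in front of \<Phi> is moved into the
  argument by \<open>scaling\<close>, at the price of a factor \<open>D\<close>.

  The strong and the weak hypothesis on f meet in one truncated estimate, \<open>tail_bound\<close>:
  splitting |f| at a level controls both its mean over a ball and the level sets of M f.
  Quasi-convexity yields it from the strong modular; from the weak modular it comes from the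
  geometric gain in \<open>nabla2_bar\<close>.

  The norms are infima that need not be attained. Boundedness is therefore transferred through
  admissible constants, while the pointwise inequality uses an admissible constant within a factor 2
  of the norm.\<close>

declare emeasure_completion [simp del]

lemma ennreal_mult_divide_cancel: "c > 0 \<Longrightarrow> ennreal c * (x / ennreal c) = x"
  by (simp add: ennreal_times_divide mult.commute[of "ennreal c"] ennreal_mult_divide_eq)

lemma ennreal_le_mult_iff:
  fixes x y :: ennreal and c :: real
  assumes "c > 0"
  shows "x \<le> ennreal c * y \<longleftrightarrow> x / ennreal c \<le> y"
proof
  assume "x \<le> ennreal c * y"
  then have "x / ennreal c \<le> ennreal c * y / ennreal c"
    by (rule divide_right_mono_ennreal)
  also have "\<dots> = y"
    using assms by (subst mult.commute, subst ennreal_mult_divide_eq) auto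
  finally show "x / ennreal c \<le> y" .
next
  assume "x / ennreal c \<le> y"
  then have "ennreal c * (x / ennreal c) \<le> ennreal c * y"
    by (rule mult_left_mono) simp
  also have "ennreal c * (x / ennreal c) = x"
    using assms by (rule ennreal_mult_divide_cancel)
  finally show "x \<le> ennreal c * y" .
qed

lemma le_mult_Inf_ennreal:
  fixes x :: ennreal and c :: real
  assumes "c > 0" "\<And>y. y \<in> S \<Longrightarrow> x \<le> ennreal c * y"
  shows "x \<le> ennreal c * Inf S"
  using assms by (simp add: ennreal_le_mult_iff Inf_greatest)

lemma at_left_ennreal_neq_bot:
  fixes s :: ennreal
  assumes "0 < s"
  shows "at_left s \<noteq> bot"
  using assms dense by (force simp: trivial_limit_def eventually_at_left)

section \<open>Elementary properties of the class \<open>Phi_bar\<close>\<close>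

lemma Phi_bar_mono: "\<Phi> \<in> Phi_bar \<Longrightarrow> mono \<Phi>"
  by (simp add: Phi_bar_def)

lemma Phi_bar_monoD: "\<Phi> \<in> Phi_bar \<Longrightarrow> s \<le> t \<Longrightarrow> \<Phi> s \<le> \<Phi> t"
  by (simp add: Phi_bar_mono monoD)

lemma Phi_bar_zero: "\<Phi> \<in> Phi_bar \<Longrightarrow> \<Phi> 0 = 0"
  by (simp add: Phi_bar_def)

lemma Phi_bar_eq_top:
  assumes "\<Phi> \<in> Phi_bar" "b_of \<Phi> < t"
  shows "\<Phi> t = \<infinity>"
proof -
  obtain s where "s < t" "\<Phi> s = \<infinity>"
    using assms(2) unfolding b_of_def Inf_less_iff by auto
  then show ?thesis
    using Phi_bar_monoD[OF assms(1), of s t] by (simp add: top_unique)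
qed

lemma neq_top_below_b_of: "t < b_of \<Phi> \<Longrightarrow> \<Phi> t \<noteq> \<infinity>"
  unfolding b_of_def by (meson Inf_lower mem_Collect_eq not_le)

lemma Phi_bar_at_top:
  assumes "\<Phi> \<in> Phi_bar"
  shows "\<Phi> \<infinity> = \<infinity>"
  using assms Phi_bar_eq_top[of \<Phi> \<infinity>] by (cases "b_of \<Phi> = \<infinity>") (auto simp: Phi_bar_def top.not_eq_extremum)

text \<open>The argument found is finite: if \<open>b_of \<Phi>\<close> is finite, it lies just
  beyond it. This is what makes generalized inverses finite and M f finite almost
  everywhere.\<close>

lemma Phi_bar_unbounded:
  assumes "\<Phi> \<in> Phi_bar"
  obtains t :: real where "t > 0" "ennreal M < \<Phi> (ennreal t)"
proof (cases "b_of \<Phi> = \<infinity>")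
  case True
  then have "(\<Phi> \<longlongrightarrow> \<infinity>) (at_left \<infinity>)"
    using assms by (simp add: Phi_bar_def)
  then have "\<forall>\<^sub>F t in at_left \<infinity>. ennreal M < \<Phi> t"
    by (rule order_tendstoD) simp
  then obtain b :: ennreal where b: "b < \<infinity>" "\<And>t. b < t \<Longrightarrow> t < \<infinity> \<Longrightarrow> ennreal M < \<Phi> t"
    by (subst (asm) eventually_at_left[of 0]) auto
  define t where "t = enn2real b + 1"
  have "b < ennreal t"
    using b(1) unfolding t_def
    by (cases b) (auto simp: ennreal_less_iff)
  moreover have "t > 0"
    by (simp add: t_def add_nonneg_pos)
  ultimately show ?thesis
    using b(2)[of "ennreal t"] that by simp
next
  case False
  define t where "t = enn2real (b_of \<Phi>) + 1"
  have "b_of \<Phi> < ennreal t"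
    using False unfolding t_def
    by (cases "b_of \<Phi>") (auto simp: ennreal_less_iff)
  moreover have "t > 0"
    by (simp add: t_def add_nonneg_pos)
  ultimately show ?thesis
    using Phi_bar_eq_top[OF assms, of "ennreal t"] that[of t] by simp
qed

lemma Phi_bar_small:
  assumes "\<Phi> \<in> Phi_bar" "0 < u"
  obtains t :: real where "t > 0" "\<Phi> (ennreal t) < u"
proof -
  have "(\<Phi> \<longlongrightarrow> 0) (at_right 0)"
    using assms by (simp add: Phi_bar_def)
  then have "\<forall>\<^sub>F t in at_right 0. \<Phi> t < u"
    using assms(2) by (rule order_tendstoD)
  then obtain b :: ennreal where b: "0 < b" "\<And>t. 0 < t \<Longrightarrow> t < b \<Longrightarrow> \<Phi> t < u"
    by (subst (asm) eventually_at_right[of _ \<infinity>]) auto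
  obtain t where t: "0 < t" "t < b"
    using b(1) dense by blast
  then have "ennreal (enn2real t) = t" "enn2real t > 0"
    by (auto simp: enn2real_positive_iff order_less_le_trans[OF _ top_greatest])
  then show ?thesis
    using b(2)[OF t] that[of "enn2real t"] by simp
qed

text \<open>Convexity and \<Psi>(0) = 0 give c \<Psi>(t) \<le> \<Psi>(c t), but only while c t <
  b(\<Psi>). The additional factor 2 covers the remaining finite t: if c t \<ge> b(\<Psi>), then 2 c
  t lies strictly beyond b(\<Psi>), where \<Psi> is infinite, whereas \<Psi> may still be finite at
  b(\<Psi>) itself.\<close>

lemma Phi_Y_scale:
  assumes "\<Psi> \<in> Phi_Y" "c \<ge> 1"
  shows "ennreal c * \<Psi> t \<le> \<Psi> (ennreal (2 * c) * t)"
proof -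
  have bar: "\<Psi> \<in> Phi_bar"
    and conv: "convex_on {t::real. 0 \<le> t \<and> ennreal t < b_of \<Psi>} (\<lambda>t. enn2real (\<Psi> (ennreal t)))"
    using assms(1) by (auto simp: Phi_Y_def)
  show ?thesis
  proof (cases t)
    case (real s)
    show ?thesis
    proof (cases "ennreal (c * s) < b_of \<Psi>")
      case True
      have "s \<le> c * s"
        using assms(2) real mult_right_mono[of 1 c s] by simp
      then have s: "ennreal s < b_of \<Psi>"
        using True order_le_less_trans[OF ennreal_leI] by blast
      have "enn2real (\<Psi> (ennreal ((1 - 1/c) *\<^sub>R 0 + (1/c) *\<^sub>R (c * s))))
          \<le> (1 - 1/c) * enn2real (\<Psi> (ennreal 0)) + (1/c) * enn2real (\<Psi> (ennreal (c * s)))"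
        using assms(2) True real s
        by (intro convex_onD[OF conv]) (auto simp: order_le_less_trans[OF _ s])
      then have "c * enn2real (\<Psi> (ennreal s)) \<le> enn2real (\<Psi> (ennreal (c * s)))"
        using assms(2) by (simp add: Phi_bar_zero[OF bar] field_simps)
      then have "ennreal (c * enn2real (\<Psi> (ennreal s))) \<le> ennreal (enn2real (\<Psi> (ennreal (c * s))))"
        by (rule ennreal_leI)
      then have "ennreal c * \<Psi> (ennreal s) \<le> \<Psi> (ennreal (c * s))"
        using neq_top_below_b_of[OF True] neq_top_below_b_of[OF s] assms(2)
        by (simp add: ennreal_mult ennreal_enn2real_if)
      also have "\<dots> \<le> \<Psi> (ennreal (2 * c) * ennreal s)"
        using assms(2) real by (intro Phi_bar_monoD[OF bar]) (simp add: ennreal_mult[symmetric])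
      finally show ?thesis
        using real by simp
    next
      case False
      have "0 < b_of \<Psi>"
        using bar by (simp add: Phi_bar_def)
      also have b: "b_of \<Psi> \<le> ennreal (c * s)"
        using False by (rule leI)
      finally have "0 < c * s"
        by (simp only: ennreal_less_zero_iff)
      then have "ennreal (c * s) < ennreal (2 * c * s)"
        by (intro ennreal_lessI) auto
      with b have "b_of \<Psi> < ennreal (2 * c * s)"
        by (rule order_le_less_trans)
      then have "\<Psi> (ennreal (2 * c * s)) = \<infinity>"
        by (rule Phi_bar_eq_top[OF bar])
      then show ?thesis
        using real assms(2) by (simp add: ennreal_mult[symmetric])
    qed
  next
    case top
    then show ?thesis
      using Phi_bar_at_top[OF bar] assms(2) by (simp add: ennreal_mult_top)
  qed
qed

text \<open>This quasi-convexity is the only consequence of membership in \<^const>\<open>Phi_bar_Y\<close>, beyond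
  membership in \<^const>\<open>Phi_bar\<close>, that the proof uses.\<close>

definition scaling :: "(ennreal \<Rightarrow> ennreal) \<Rightarrow> real \<Rightarrow> bool" where
  "scaling \<Phi> D \<longleftrightarrow> D \<ge> 1 \<and> (\<forall>c\<ge>1. \<forall>t. ennreal c * \<Phi> t \<le> \<Phi> (ennreal (D * c) * t))"

lemma scalingD: "scaling \<Phi> D \<Longrightarrow> c \<ge> 1 \<Longrightarrow> ennreal c * \<Phi> t \<le> \<Phi> (ennreal (D * c) * t)"
  by (simp add: scaling_def)

lemma Phi_bar_Y_scaling:
  assumes "\<Phi> \<in> Phi_bar_Y"
  obtains D where "scaling \<Phi> D"
proof -
  obtain \<Psi> C where \<Psi>: "\<Psi> \<in> Phi_Y" "C > 0"
    and eq: "\<And>t. \<Phi> (ennreal (inverse C) * t) \<le> \<Psi> t" "\<And>t. \<Psi> t \<le> \<Phi> (ennreal C * t)"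
    using assms by (auto simp: Phi_bar_Y_def Phi_equiv_def)
  have bar: "\<Phi> \<in> Phi_bar"
    using assms by (simp add: Phi_bar_Y_def)
  \<comment> \<open>One factor \<open>C\<close> is paid for passing from \<Phi> to the Young
    function, one for returning, and 2 comes from \<open>Phi_Y_scale\<close>.\<close>
  define D where "D = max 1 (2 * C\<^sup>2)"
  have "ennreal c * \<Phi> t \<le> \<Phi> (ennreal (D * c) * t)" if c: "c \<ge> 1" for c t
  proof -
    have 1: "\<Phi> t \<le> \<Psi> (ennreal C * t)"
      using eq(1)[of "ennreal C * t"] \<Psi>(2) by (simp add: mult.assoc[symmetric] ennreal_mult[symmetric])
    have "ennreal c * \<Phi> t \<le> ennreal c * \<Psi> (ennreal C * t)"
      using 1 by (rule mult_left_mono) simp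
    also have "\<dots> \<le> \<Psi> (ennreal (2 * c) * (ennreal C * t))"
      by (rule Phi_Y_scale[OF \<Psi>(1) c])
    also have "\<dots> \<le> \<Phi> (ennreal C * (ennreal (2 * c) * (ennreal C * t)))"
      by (rule eq(2))
    also have "ennreal C * (ennreal (2 * c) * (ennreal C * t)) = ennreal (2 * C\<^sup>2 * c) * t"
    proof -
      have e: "C * 2 * c * C = 2 * C\<^sup>2 * c"
        by (simp add: power2_eq_square)
      show ?thesis
        using \<Psi>(2) c by (simp add: e mult.assoc[symmetric] ennreal_mult[symmetric])
    qed
    also have "\<Phi> \<dots> \<le> \<Phi> (ennreal (D * c) * t)"
      using c by (intro Phi_bar_monoD[OF bar] mult_right_mono ennreal_leI) (auto simp: D_def)
    finally show ?thesis .
  qed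
  then show ?thesis
    by (intro that[of D]) (auto simp: scaling_def D_def)
qed

section \<open>Generalized inverses\<close>

lemma gen_inverse_ge:
  assumes "\<Phi> \<in> Phi_bar" "\<Phi> t \<le> u" "u < \<infinity>"
  shows "t \<le> gen_inverse \<Phi> u"
proof -
  have "t \<le> s" if "u < \<Phi> s" for s
    using that assms Phi_bar_monoD[OF assms(1), of s t] by (metis leD le_cases order_trans)
  then show ?thesis
    using assms(3) by (auto simp: gen_inverse_def intro!: Inf_greatest)
qed

text \<open>The premise is the negation of the one in \<open>gen_inverse_ge\<close>, so between them
  every \<open>t\<close> is compared with the inverse, even where \<Phi> jumps or is
  constant.\<close>

lemma gen_inverse_le: "u < \<Phi> t \<Longrightarrow> gen_inverse \<Phi> u \<le> t"
  by (auto simp: gen_inverse_def intro!: Inf_lower)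

lemma gen_inverse_mono: "mono (gen_inverse \<Phi>)"
proof
  fix u v :: ennreal
  assume "u \<le> v"
  then show "gen_inverse \<Phi> u \<le> gen_inverse \<Phi> v"
    by (auto simp: gen_inverse_def top_unique intro!: Inf_superset_mono)
qed

lemma gen_inverse_pos:
  assumes "\<Phi> \<in> Phi_bar" "0 < u"
  shows "0 < gen_inverse \<Phi> u"
proof (cases "u = \<infinity>")
  case False
  obtain t :: real where t: "t > 0" "\<Phi> (ennreal t) < u"
    using Phi_bar_small[OF assms] .
  then have "ennreal t \<le> gen_inverse \<Phi> u"
    using False assms by (intro gen_inverse_ge) (auto simp: top.not_eq_extremum)
  with t show ?thesis
    by (metis ennreal_less_zero_iff order_less_le_trans)
qed (simp add: gen_inverse_def)

lemma gen_inverse_finite: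
  assumes "\<Phi> \<in> Phi_bar"
  shows "gen_inverse \<Phi> (ennreal u) < \<infinity>"
  by (metis Phi_bar_unbounded[OF assms] ennreal_less_top gen_inverse_le infinity_ennreal_def order_le_less_trans)

text \<open>Every t strictly below s = \<Phi>^-1(u) has \<Phi>(t) \<le> u, and the bound passes to s
  because \<Phi>(s) is the left limit there. This is where left continuity enters; s \<le> b(\<Phi>)
  must be known for it to apply.\<close>

lemma Phi_gen_inverse_le:
  assumes "\<Phi> \<in> Phi_bar" "u < \<infinity>"
  shows "\<Phi> (gen_inverse \<Phi> u) \<le> u"
proof -
  define s where "s = gen_inverse \<Phi> u"
  have below: "\<Phi> t \<le> u" if "t < s" for t
    using that gen_inverse_le[of u \<Phi> t] by (force simp: s_def)
  show ?thesis
  proof (cases "s = 0")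
    case True
    then show ?thesis
      by (simp add: s_def[symmetric] Phi_bar_zero[OF assms(1)])
  next
    case False
    then have nb: "at_left s \<noteq> bot"
      by (intro at_left_ennreal_neq_bot) (simp add: zero_less_iff_neq_zero)
    have "s \<le> b_of \<Phi>"
    proof (rule ccontr)
      assume "\<not> s \<le> b_of \<Phi>"
      then have "b_of \<Phi> < s"
        by simp
      then obtain t where "b_of \<Phi> < t" "t < s"
        using dense by blast
      then show False
        using below[of t] Phi_bar_eq_top[OF assms(1), of t] assms(2) by simp
    qed
    \<comment> \<open>Below b(\<Phi>) left continuity applies; at b(\<Phi>) the left limit is
      supplied by the clause of \<open>Phi_bar\<close> for finite or for infinite b(\<Phi>).\<close>
    then consider "s < b_of \<Phi>" | "s = b_of \<Phi>" "s < \<infinity>" | "s = b_of \<Phi>" "s = \<infinity>"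
      using top.not_eq_extremum by fastforce
    then have "(\<Phi> \<longlongrightarrow> \<Phi> s) (at_left s)"
      using assms(1) by cases (auto simp: Phi_bar_def continuous_within)
    moreover have "\<forall>\<^sub>F t in at_left s. \<Phi> t \<le> u"
      using below by (auto simp: eventually_at_filter)
    ultimately show ?thesis
      using nb tendsto_upperbound by (auto simp: s_def[symmetric])
  qed
qed

text \<open>If u < \<Phi>(t), then c u < c \<Phi>(t) \<le> \<Phi>(D c t) for c \<ge> 1; for smaller
  c monotonicity suffices, hence \<open>max 1 c\<close>. It serves to exchange 1/r^n for the
  reciprocal of a ball volume.\<close>

lemma gen_inverse_scale:
  assumes "scaling \<Phi> D" "c > 0" "0 \<le> u"
  shows "gen_inverse \<Phi> (ennreal (c * u)) \<le> ennreal (max 1 c * D) * gen_inverse \<Phi> (ennreal u)"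
proof -
  have D: "D \<ge> 1"
    using assms(1) by (simp add: scaling_def)
  have "gen_inverse \<Phi> (ennreal (max 1 c * u)) \<le> ennreal (max 1 c * D) * t" if "ennreal u < \<Phi> t" for t
  proof (rule gen_inverse_le)
    have "ennreal (max 1 c * u) = ennreal (max 1 c) * ennreal u"
      by (intro ennreal_mult) (use assms in auto)
    also have "\<dots> < ennreal (max 1 c) * \<Phi> t"
      using that ennreal_mult_strict_right_mono[OF that, of "ennreal (max 1 c)"]
      by (simp add: mult.commute)
    also have "\<dots> \<le> \<Phi> (ennreal (D * max 1 c) * t)"
      using assms(1) by (rule scalingD) simp
    finally show "ennreal (max 1 c * u) < \<Phi> (ennreal (max 1 c * D) * t)"
      by (simp add: mult.commute)
  qed
  then have "gen_inverse \<Phi> (ennreal (max 1 c * u)) \<le> ennreal (max 1 c * D) * gen_inverse \<Phi> (ennreal u)"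
    unfolding gen_inverse_def[of \<Phi> "ennreal u"] using D
    by (auto intro!: le_mult_Inf_ennreal)
  moreover have "gen_inverse \<Phi> (ennreal (c * u)) \<le> gen_inverse \<Phi> (ennreal (max 1 c * u))"
    using assms by (intro monoD[OF gen_inverse_mono] ennreal_leI mult_right_mono) auto
  ultimately show ?thesis
    by simp
qed

text \<open>Sublevel sets are downward closed in a complete linear order, hence initial segments
  ending at their supremum.\<close>

lemma borel_measurable_mono_ennreal:
  fixes f :: "ennreal \<Rightarrow> ennreal"
  assumes "mono f"
  shows "f \<in> borel_measurable borel"
proof (rule borel_measurableI_le)
  fix y
  define S where "S = {x. f x \<le> y}"
  have down: "x \<in> S" if "x \<le> z" "z \<in> S" for x z
    using that monoD[OF assms] order_trans unfolding S_def by blast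
  have "S = {..< Sup S} \<or> S = {.. Sup S}"
  proof (cases "Sup S \<in> S")
    case True
    then show ?thesis
      using down by (auto intro: Sup_upper)
  next
    case False
    then have "S = {..< Sup S}"
      using down less_Sup_iff[of _ S] Sup_upper[of _ S]
      by (auto simp: order_less_le dest: less_imp_le)
    then show ?thesis ..
  qed
  then have "S \<in> sets borel"
    by (metis borel_open borel_closed closed_atMost open_lessThan)
  then show "{x \<in> space borel. f x \<le> y} \<in> sets borel"
    by (simp add: S_def)
qed

subsection \<open>Integration in polar coordinates and measurability\<close>

lemma emeasure_lebesgue_ball:
  fixes a :: "real ^ 'n"
  assumes "r \<ge> 0"
  shows "emeasure lebesgue (ball a r) = ennreal (unit_ball_vol CARD('n) * r ^ CARD('n))"
  using assms by (simp add: emeasure_completion emeasure_ball)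

text \<open>Needed for Tonelli's theorem on a product of two completed measures.\<close>

lemma sigma_finite_lebesgue: "sigma_finite_measure (lebesgue :: 'a::euclidean_space measure)"
proof -
  obtain A :: "'a set set" where "countable A" "A \<subseteq> sets lborel" "\<Union>A = space lborel"
    "\<forall>a\<in>A. emeasure lborel a \<noteq> \<infinity>"
    using lborel.sigma_finite_countable by blast
  then show ?thesis
    by (intro sigma_finite_measure.intro exI[of _ A]) (auto simp: subset_eq emeasure_completion)
qed

text \<open>With w the volume of the unit ball, the density is the surface area of the sphere of
  radius t, and w r^n is the volume of the ball of radius r.\<close>

lemma emeasure_norm_density:
  assumes "n > 0" "0 \<le> w"
  shows "emeasure (density lborel (\<lambda>t::real. ennreal (w * (real n * t ^ (n - 1))) * indicator {0<..} t)) {..r}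
    = (if r < 0 then 0 else ennreal (w * r ^ n))"
proof -
  have "emeasure (density lborel (\<lambda>t::real. ennreal (w * (real n * t ^ (n - 1))) * indicator {0<..} t)) {..r}
    = (\<integral>\<^sup>+t. ennreal (w * (real n * t ^ (n - 1))) * indicator {0<..} t * indicator {..r} t \<partial>lborel)"
    by (subst emeasure_density) auto
  \<comment> \<open>Adding the null set {0} gives the closed interval on which the fundamental
    theorem of calculus is applied.\<close>
  also have "\<dots> = (\<integral>\<^sup>+t. ennreal (w * (real n * t ^ (n - 1))) * indicator {0..r} t \<partial>lborel)"
    by (intro nn_integral_cong_AE eventually_mono[OF AE_lborel_singleton[of 0]])
       (auto split: split_indicator)
  also have "\<dots> = (if r < 0 then 0 else ennreal (w * r ^ n))"
  proof (cases "r < 0")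
    case False
    have "(\<integral>\<^sup>+t. ennreal (w * (real n * t ^ (n - 1))) * indicator {0..r} t \<partial>lborel)
        = ennreal (w * r ^ n - w * 0 ^ n)"
      using assms False
      by (intro nn_integral_FTC_Icc[where F = "\<lambda>t. w * t ^ n"]) (auto intro!: derivative_eq_intros)
    then show ?thesis
      using False assms by (simp add: power_0_left)
  qed simp
  finally show ?thesis .
qed

text \<open>Half-lines form an intersection-stable generator on which both sides are finite and
  equal to the volume of a ball.\<close>

lemma distr_norm_lborel:
  fixes x :: "real ^ 'n"
  shows "distr lborel borel (\<lambda>y. norm (x - y)) = density lborel
    (\<lambda>t. ennreal (unit_ball_vol CARD('n) * (CARD('n) * t ^ (CARD('n) - 1))) * indicator {0<..} t)"
    (is "?M = ?N")
proof (rule measure_eqI_generator_eq[where E = "range atMost" and \<Omega> = UNIV and A = "\<lambda>i::nat. {..real i}"])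
  have eq: "emeasure ?M {..r} = (if r < 0 then 0 else ennreal (unit_ball_vol CARD('n) * r ^ CARD('n)))" for r
  proof -
    have "emeasure ?M {..r} = emeasure lborel {y. norm (x - y) \<le> r}"
      by (subst emeasure_distr) (auto simp: vimage_def)
    also have "{y. norm (x - y) \<le> r} = cball x r"
      by (auto simp: dist_norm)
    finally show ?thesis
      using emeasure_cball[of r x] by auto
  qed
  have eq': "emeasure ?N {..r} = (if r < 0 then 0 else ennreal (unit_ball_vol CARD('n) * r ^ CARD('n)))" for r
    by (rule emeasure_norm_density) auto
  show "emeasure ?M X = emeasure ?N X" if "X \<in> range atMost" for X
    using that by (elim rangeE) (simp only: eq eq')
  show "Int_stable (range (atMost :: real \<Rightarrow> _))"
    by (intro Int_stableI) (auto simp del: atMost_iff)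
  have "sets borel = sigma_sets UNIV (range (atMost :: real \<Rightarrow> _))"
    by (subst borel_eq_atMost) simp
  then show "sets ?M = sigma_sets UNIV (range atMost)" "sets ?N = sigma_sets UNIV (range atMost)"
    by simp_all
  show "(\<Union>i::nat. {..real i}) = UNIV"
    by (auto intro: real_arch_simple)
  show "emeasure ?M {..real i} \<noteq> \<infinity>" for i
    unfolding eq by simp
qed auto

lemma nn_integral_norm_borel:
  fixes x :: "real ^ 'n" and g :: "real \<Rightarrow> ennreal"
  assumes [measurable]: "g \<in> borel_measurable borel"
  shows "(\<integral>\<^sup>+y. g (norm (x - y)) \<partial>lborel) = (\<integral>\<^sup>+t\<in>{0<..}. g t *
    ennreal (unit_ball_vol CARD('n) * (CARD('n) * t ^ (CARD('n) - 1))) \<partial>lborel)"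
proof -
  have "(\<integral>\<^sup>+y. g (norm (x - y)) \<partial>lborel) = (\<integral>\<^sup>+t. g t \<partial>distr lborel borel (\<lambda>y. norm (x - y)))"
    by (subst nn_integral_distr) auto
  also have "\<dots> = (\<integral>\<^sup>+t\<in>{0<..}. g t *
    ennreal (unit_ball_vol CARD('n) * (CARD('n) * t ^ (CARD('n) - 1))) \<partial>lborel)"
    unfolding distr_norm_lborel by (subst nn_integral_density) (auto simp: mult_ac)
  finally show ?thesis .
qed

text \<open>The image of Lebesgue measure under the distance to x is absolutely continuous, so
  radial null sets pull back to null sets, for every single x.\<close>

lemma AE_norm_diff:
  fixes x :: "real ^ 'n"
  assumes "AE t in lborel. P t"
  shows "AE y in lborel. P (norm (x - y))"
proof -
  have "AE t in distr lborel borel (\<lambda>y. norm (x - y)). P t"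
    unfolding distr_norm_lborel using assms by (subst AE_density) auto
  then show ?thesis
    by (rule AE_distrD[rotated]) simp
qed

lemma nn_integral_norm:
  fixes x :: "real ^ 'n" and g :: "real \<Rightarrow> ennreal"
  assumes "g \<in> borel_measurable lebesgue"
  shows "(\<integral>\<^sup>+y. g (norm (x - y)) \<partial>lebesgue) = (\<integral>\<^sup>+t\<in>{0<..}. g t *
    ennreal (unit_ball_vol CARD('n) * (CARD('n) * t ^ (CARD('n) - 1))) \<partial>lebesgue)"
proof -
  obtain g' where [measurable]: "g' \<in> borel_measurable borel" and eq: "AE t in lborel. g t = g' t"
    using completion_ex_borel_measurable[OF assms] by auto
  have "(\<integral>\<^sup>+y. g (norm (x - y)) \<partial>lborel) = (\<integral>\<^sup>+y. g' (norm (x - y)) \<partial>lborel)"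
    by (intro nn_integral_cong_AE AE_norm_diff eq)
  also have "\<dots> = (\<integral>\<^sup>+t\<in>{0<..}. g' t *
      ennreal (unit_ball_vol CARD('n) * (CARD('n) * t ^ (CARD('n) - 1))) \<partial>lborel)"
    by (rule nn_integral_norm_borel) simp
  also have "\<dots> = (\<integral>\<^sup>+t\<in>{0<..}. g t *
      ennreal (unit_ball_vol CARD('n) * (CARD('n) * t ^ (CARD('n) - 1))) \<partial>lborel)"
    using eq by (intro nn_integral_cong_AE) auto
  finally show ?thesis
    by (simp only: nn_integral_completion)
qed

text \<open>A Borel map need not be measurable between completions; this one is, because preimages
  of null sets are null by polar coordinates.\<close>

lemma measurable_norm_diff_lebesgue:
  fixes x :: "real ^ 'n"
  shows "(\<lambda>y. norm (x - y)) \<in> lebesgue \<rightarrow>\<^sub>M lebesgue"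
proof (rule completion.measurable_completion2)
  show "(\<lambda>y. norm (x - y)) \<in> lebesgue \<rightarrow>\<^sub>M lborel"
    by (rule measurable_completion) simp
  show "null_sets lborel \<subseteq> null_sets (distr lebesgue lborel (\<lambda>y. norm (x - y)))"
  proof
    fix N :: "real set"
    assume N: "N \<in> null_sets lborel"
    have "AE y in lborel. norm (x - y) \<notin> N"
      using N by (intro AE_norm_diff AE_not_in)
    moreover have "(\<lambda>y. norm (x - y)) -` N \<in> sets lborel"
      using N measurable_sets[of "\<lambda>y. norm (x - y)" lborel lborel N] by auto
    ultimately have "(\<lambda>y. norm (x - y)) -` N \<in> null_sets lborel"
      by (subst (asm) AE_iff_null) (auto simp: vimage_def)
    then show "N \<in> null_sets (distr lebesgue lborel (\<lambda>y. norm (x - y)))"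
      using N by (subst null_sets_distr_iff)
        (auto intro: null_sets_completionI measurable_completion)
  qed
qed

text \<open>Measurability of \<rho> is given only on (0, \<infinity>); extending by 0 makes
  integrands measurable on the whole line without changing the operator.\<close>

lemma rho_ext_measurable:
  fixes \<rho> :: "real \<Rightarrow> real"
  assumes "\<rho> \<in> borel_measurable (lebesgue_on {0<..})"
  shows "(\<lambda>t. if t \<in> {0<..} then \<rho> t else 0) \<in> borel_measurable lebesgue"
  using assms by (intro measurable_If_restrict_space_iff[THEN iffD2]) (auto simp: greaterThan_def)

text \<open>At the diagonal \<^term>\<open>y = x\<close> the integrand is \<^term>\<open>0::real\<close> because the dimension is positive
  and division by zero yields zero, so the value \<^term>\<open>\<rho> 0\<close> never matters.\<close>

lemma frac_integrand_cong:
  fixes x y :: "real ^ 'n"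
  assumes "norm (x - y) > 0 \<Longrightarrow> \<rho> (norm (x - y)) = \<rho>' (norm (x - y))" "f y = f' y"
  shows "frac_integrand \<rho> f x y = frac_integrand \<rho>' f' x y"
  using assms by (cases "x = y") (auto simp: frac_integrand_def)

lemma frac_integrand_measurable:
  fixes f :: "real ^ 'n \<Rightarrow> real"
  assumes "\<rho> \<in> borel_measurable (lebesgue_on {0<..})" "f \<in> borel_measurable lebesgue"
  shows "frac_integrand \<rho> f x \<in> borel_measurable lebesgue"
proof -
  define \<rho>' where "\<rho>' t = (if t \<in> {0<..} then \<rho> t else 0)" for t
  have "\<rho>' \<in> borel_measurable lebesgue"
    unfolding \<rho>'_def by (rule rho_ext_measurable[OF assms(1)])
  from measurable_compose[OF measurable_norm_diff_lebesgue this]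
  have [measurable]: "(\<lambda>y. \<rho>' (norm (x - y))) \<in> borel_measurable lebesgue" .
  have [measurable]: "(\<lambda>y. norm (x - y)) \<in> borel_measurable lebesgue"
    by (rule measurable_completion) simp
  note assms(2)[measurable]
  have "frac_integrand \<rho>' f x \<in> borel_measurable lebesgue"
    unfolding frac_integrand_def by measurable
  also have "frac_integrand \<rho>' f x = frac_integrand \<rho> f x"
    by (intro ext frac_integrand_cong) (auto simp: \<rho>'_def)
  finally show ?thesis .
qed

text \<open>Joint measurability in x and y is available only for Borel functions. Replacing \<rho>
  and f by Borel versions leaves the integral unchanged at every x, not merely at almost every x,
  because \<open>AE_norm_diff\<close> holds for each x.\<close>

lemma frac_int_measurable:
  fixes f :: "real ^ 'n \<Rightarrow> real"
  assumes "\<rho> \<in> borel_measurable (lebesgue_on {0<..})" "f \<in> borel_measurable lebesgue"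
  shows "frac_int \<rho> f \<in> borel_measurable lebesgue"
proof -
  obtain \<rho>' where [measurable]: "\<rho>' \<in> borel_measurable borel"
    and eq1: "AE t in lborel. (if t \<in> {0<..} then \<rho> t else 0) = \<rho>' t"
    using completion_ex_borel_measurable_real[OF rho_ext_measurable[OF assms(1)]] by auto
  obtain f' where [measurable]: "f' \<in> borel_measurable borel" and eq2: "AE t in lborel. f t = f' t"
    using completion_ex_borel_measurable_real[OF assms(2)] by auto
  have "frac_int \<rho> f = (\<lambda>x. integral\<^sup>L lborel (frac_integrand \<rho>' f' x))"
  proof
    fix x
    have [measurable]: "frac_integrand \<rho>' f' x \<in> borel_measurable borel"
      unfolding frac_integrand_def by measurable
    have "AE y in lborel. frac_integrand \<rho> f x y = frac_integrand \<rho>' f' x y"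
      using AE_norm_diff[OF eq1, of x] eq2
      by eventually_elim (auto intro!: frac_integrand_cong split: if_splits)
    then have "integral\<^sup>L lebesgue (frac_integrand \<rho> f x) = integral\<^sup>L lebesgue (frac_integrand \<rho>' f' x)"
      by (intro integral_cong_AE frac_integrand_measurable assms measurable_completion AE_completion) auto
    then show "frac_int \<rho> f x = integral\<^sup>L lborel (frac_integrand \<rho>' f' x)"
      by (simp add: frac_int_def integral_completion)
  qed
  moreover have "(\<lambda>x. integral\<^sup>L lborel (frac_integrand \<rho>' f' x)) \<in> borel_measurable borel"
    unfolding frac_integrand_def by measurable
  ultimately show ?thesis
    by (simp add: measurable_completion)
qed

subsection \<open>The Hardy--Littlewood maximal operator\<close>

text \<open>Subadditivity is phrased with a counting measure so that the countable index set
  delivered by the covering lemma needs no enumeration.\<close>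

lemma emeasure_UN_le_count_space:
  assumes "countable C" "\<And>i. i \<in> C \<Longrightarrow> X i \<in> sets M"
  shows "emeasure M (\<Union>i\<in>C. X i) \<le> (\<integral>\<^sup>+i. emeasure M (X i) \<partial>count_space C)"
proof -
  have "emeasure M (\<Union>i\<in>C. X i) = (\<integral>\<^sup>+x. indicator (\<Union>i\<in>C. X i) x \<partial>M)"
    using assms by (intro nn_integral_indicator[symmetric] sets.countable_UN') auto
  also have "\<dots> \<le> (\<integral>\<^sup>+x. (\<integral>\<^sup>+i. indicator (X i) x \<partial>count_space C) \<partial>M)"
  proof (rule nn_integral_mono)
    fix x
    show "indicator (\<Union>i\<in>C. X i) x \<le> (\<integral>\<^sup>+i. indicator (X i) x \<partial>count_space C)"
    proof (cases "x \<in> (\<Union>i\<in>C. X i)")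
      case True
      then obtain i where "i \<in> C" "x \<in> X i"
        by auto
      then show ?thesis
        using nn_integral_ge_point[of i C "\<lambda>i. indicator (X i) x"] by (auto split: split_indicator)
    qed simp
  qed
  also have "\<dots> = (\<integral>\<^sup>+i. (\<integral>\<^sup>+x. indicator (X i) x \<partial>M) \<partial>count_space C)"
    using assms by (intro nn_integral_count_space_nn_integral) auto
  also have "\<dots> = (\<integral>\<^sup>+i. emeasure M (X i) \<partial>count_space C)"
    using assms by (intro nn_integral_cong) auto
  finally show ?thesis .
qed

text \<open>If g has finite integral, the radii are bounded and Vitali's covering lemma applies: the
  fivefold dilations of a countable disjoint subfamily cover everything, which costs 5^n in measure,
  while disjointness lets the integrals over the chosen balls add up to at most the full
  integral.\<close>

lemma Vitali_weak_bound:
  fixes F :: "((real ^ 'n) \<times> real) set" and g :: "real ^ 'n \<Rightarrow> ennreal"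
  assumes [measurable]: "g \<in> borel_measurable lebesgue" and "t > 0"
    and F: "\<And>i. i \<in> F \<Longrightarrow> snd i > 0"
    and le: "\<And>i. i \<in> F \<Longrightarrow>
      ennreal t * emeasure lebesgue (ball (fst i) (snd i)) \<le> (\<integral>\<^sup>+y\<in>ball (fst i) (snd i). g y \<partial>lebesgue)"
  shows "ennreal t * emeasure lebesgue (\<Union>i\<in>F. ball (fst i) (snd i)) \<le> 5 ^ CARD('n) * (\<integral>\<^sup>+y. g y \<partial>lebesgue)"
proof (cases "(\<integral>\<^sup>+y. g y \<partial>lebesgue) = \<infinity>")
  case True
  then show ?thesis
    by (simp add: ennreal_mult_top)
next
  case False
  define n where "n = CARD('n)"
  define w where "w = unit_ball_vol n"
  have w: "w > 0"
    by (simp add: w_def)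
  have n: "n > 0"
    by (simp add: n_def)
  obtain I where I: "I \<ge> 0" "(\<integral>\<^sup>+y. g y \<partial>lebesgue) = ennreal I"
    using False by (cases "\<integral>\<^sup>+y. g y \<partial>lebesgue") auto
  have ball: "emeasure lebesgue (ball a r) = ennreal (w * r ^ n)" if "r \<ge> 0" for a :: "real ^ 'n" and r
    using emeasure_lebesgue_ball[OF that, of a] by (simp add: w_def n_def)
  \<comment> \<open>The hypothesis bounds r^n by I / (t w); since r \<le> r^n for r \<ge> 1, the
    maximum with 1 bounds r itself.\<close>
  have bound: "0 < snd i \<and> snd i \<le> max 1 (I / (t * w))" if i: "i \<in> F" for i
  proof -
    have "ennreal (t * (w * snd i ^ n)) = ennreal t * emeasure lebesgue (ball (fst i) (snd i))"
      using F[OF i] \<open>t > 0\<close> w by (simp add: ball ennreal_mult)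
    also have "\<dots> \<le> (\<integral>\<^sup>+y\<in>ball (fst i) (snd i). g y \<partial>lebesgue)"
      by (rule le[OF i])
    also have "\<dots> \<le> ennreal I"
      unfolding I(2)[symmetric] by (intro nn_integral_mono) (auto split: split_indicator)
    finally have "t * w * snd i ^ n \<le> I"
      using I(1) by (simp add: mult.assoc)
    then have "snd i ^ n \<le> I / (t * w)"
      using \<open>t > 0\<close> w by (simp add: field_simps)
    moreover have "snd i \<le> snd i ^ n" if "snd i \<ge> 1"
      using that n self_le_power by blast
    ultimately show ?thesis
      using F[OF i] by (cases "snd i \<ge> 1") auto
  qed
  obtain C where C: "countable C" "C \<subseteq> F"
    "pairwise (\<lambda>i j. disjnt (ball (fst i) (snd i)) (ball (fst j) (snd j))) C"
    "(\<Union>i\<in>F. ball (fst i) (snd i)) \<subseteq> (\<Union>i\<in>C. ball (fst i) (5 * snd i))"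
    by (rule Vitali_covering_lemma_balls[OF order_refl bound])
  have "emeasure lebesgue (\<Union>i\<in>F. ball (fst i) (snd i)) \<le> emeasure lebesgue (\<Union>i\<in>C. ball (fst i) (5 * snd i))"
    by (rule emeasure_mono[OF C(4)]) (simp add: open_UN borel_open)
  also have "\<dots> \<le> (\<integral>\<^sup>+i. emeasure lebesgue (ball (fst i) (5 * snd i)) \<partial>count_space C)"
    by (rule emeasure_UN_le_count_space[OF C(1)]) simp
  also have "\<dots> = (\<integral>\<^sup>+i. 5 ^ n * emeasure lebesgue (ball (fst i) (snd i)) \<partial>count_space C)"
  proof (intro nn_integral_cong)
    fix i assume "i \<in> space (count_space C)"
    then have "i \<in> F"
      using C(2) by auto
    then have "snd i > 0"
      by (rule F)
    then show "emeasure lebesgue (ball (fst i) (5 * snd i)) = 5 ^ n * emeasure lebesgue (ball (fst i) (snd i))"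
      using w ennreal_power[of 5 n]
      by (simp add: ball power_mult_distrib ennreal_mult mult_ac)
  qed
  finally have "ennreal t * emeasure lebesgue (\<Union>i\<in>F. ball (fst i) (snd i)) \<le>
      ennreal t * (\<integral>\<^sup>+i. 5 ^ n * emeasure lebesgue (ball (fst i) (snd i)) \<partial>count_space C)"
    by (rule mult_left_mono) simp
  also have "\<dots> = 5 ^ n * (\<integral>\<^sup>+i. ennreal t * emeasure lebesgue (ball (fst i) (snd i)) \<partial>count_space C)"
    by (simp add: nn_integral_cmult mult_ac)
  also have "\<dots> \<le> 5 ^ n * (\<integral>\<^sup>+i. emeasure (density lebesgue g) (ball (fst i) (snd i)) \<partial>count_space C)"
    using C(2) by (intro mult_left_mono nn_integral_mono)
      (auto simp: emeasure_density intro!: order_trans[OF le])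
  also have "(\<integral>\<^sup>+i. emeasure (density lebesgue g) (ball (fst i) (snd i)) \<partial>count_space C)
      = emeasure (density lebesgue g) (\<Union>i\<in>C. ball (fst i) (snd i))"
    using C(1,3) by (intro emeasure_UN_countable[symmetric])
      (auto simp: disjoint_family_on_def pairwise_def disjnt_def)
  also have "\<dots> \<le> emeasure (density lebesgue g) (space (density lebesgue g))"
    by (rule emeasure_space)
  also have "\<dots> = (\<integral>\<^sup>+y. g y \<partial>lebesgue)"
    by (simp add: emeasure_density)
  finally show ?thesis
    by (simp add: n_def mult_left_mono)
qed

text \<open>Balls need only contain x, so a ball with a large mean lies entirely in the superlevel
  set, which is therefore open.\<close>

lemma maximal_gt_eq:
  fixes f :: "real ^ 'n \<Rightarrow> real"
  shows "{x. t < maximal f x} = (\<Union>i\<in>{(a, r). r > 0 \<and>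
    t < (\<integral>\<^sup>+y\<in>ball a r. ennreal \<bar>f y\<bar> \<partial>lebesgue) / emeasure lebesgue (ball a r)}. ball (fst i) (snd i))"
  by (auto simp: maximal_def less_SUP_iff) blast

lemma open_maximal_gt:
  fixes f :: "real ^ 'n \<Rightarrow> real"
  shows "open {x. t < maximal f x}"
  unfolding maximal_gt_eq by auto

lemma maximal_measurable [measurable]:
  fixes f :: "real ^ 'n \<Rightarrow> real"
  shows "maximal f \<in> borel_measurable borel"
  by (rule borel_measurableI_greater) (simp add: borel_open open_maximal_gt)

lemma nn_integral_le_level:
  fixes f :: "'a \<Rightarrow> real"
  assumes [measurable]: "f \<in> borel_measurable M" "B \<in> sets M" and "t \<ge> 0"
  shows "(\<integral>\<^sup>+y\<in>B. ennreal \<bar>f y\<bar> \<partial>M) \<le>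
    ennreal t * emeasure M B + (\<integral>\<^sup>+y\<in>B. ennreal \<bar>f y\<bar> * indicator {y. \<bar>f y\<bar> > t} y \<partial>M)"
proof -
  have "(\<integral>\<^sup>+y\<in>B. ennreal \<bar>f y\<bar> \<partial>M) \<le>
      (\<integral>\<^sup>+y. ennreal t * indicator B y + ennreal \<bar>f y\<bar> * indicator {y. \<bar>f y\<bar> > t} y * indicator B y \<partial>M)"
    by (intro nn_integral_mono) (auto split: split_indicator intro!: ennreal_leI)
  also have "\<dots> = ennreal t * emeasure M B +
      (\<integral>\<^sup>+y\<in>B. ennreal \<bar>f y\<bar> * indicator {y. \<bar>f y\<bar> > t} y \<partial>M)"
    by (subst nn_integral_add) (auto simp: nn_integral_cmult_indicator)
  finally show ?thesis .
qed

text \<open>On a ball where |f| has mean above 2 t, the part with |f| \<le> t contributes at most t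
  to the mean, so the part with |f| > t has mean at least t. Applying the covering bound to that
  part puts the truncated integral on the right.\<close>

lemma maximal_weak_type:
  fixes f :: "real ^ 'n \<Rightarrow> real"
  assumes [measurable]: "f \<in> borel_measurable lebesgue" and t: "t > 0"
  shows "ennreal t * emeasure lebesgue {x. ennreal (2 * t) < maximal f x} \<le>
    5 ^ CARD('n) * (\<integral>\<^sup>+y\<in>{y. \<bar>f y\<bar> > t}. ennreal \<bar>f y\<bar> \<partial>lebesgue)"
  unfolding maximal_gt_eq
proof (rule Vitali_weak_bound[OF _ t])
  show "(\<lambda>y. ennreal \<bar>f y\<bar> * indicator {y. \<bar>f y\<bar> > t} y) \<in> borel_measurable lebesgue"
    by measurable
  fix i :: "(real ^ 'n) \<times> real"
  assume i: "i \<in> {(a, r). r > 0 \<and>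
    ennreal (2 * t) < (\<integral>\<^sup>+y\<in>ball a r. ennreal \<bar>f y\<bar> \<partial>lebesgue) / emeasure lebesgue (ball a r)}"
  then show r: "snd i > 0"
    by auto
  let ?B = "ball (fst i) (snd i)"
  define b where "b = unit_ball_vol CARD('n) * snd i ^ CARD('n)"
  have b: "b > 0" "emeasure lebesgue ?B = ennreal b"
    using r emeasure_lebesgue_ball[of "snd i" "fst i"] by (auto simp: b_def)
  have "ennreal t * ennreal b + ennreal t * ennreal b = ennreal b * ennreal (2 * t)"
    using t b by (simp add: ennreal_mult[symmetric] ennreal_plus[symmetric] del: ennreal_plus)
  also have "\<dots> \<le> ennreal b * ((\<integral>\<^sup>+y\<in>?B. ennreal \<bar>f y\<bar> \<partial>lebesgue) / ennreal b)"
    using i unfolding b(2)[symmetric]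
    by (intro mult_left_mono) auto
  also have "\<dots> = (\<integral>\<^sup>+y\<in>?B. ennreal \<bar>f y\<bar> \<partial>lebesgue)"
    using b(1) by (rule ennreal_mult_divide_cancel)
  also have "\<dots> \<le> ennreal t * ennreal b +
      (\<integral>\<^sup>+y\<in>?B. ennreal \<bar>f y\<bar> * indicator {y. \<bar>f y\<bar> > t} y \<partial>lebesgue)"
    unfolding b(2)[symmetric] using t by (intro nn_integral_le_level) auto
  finally show "ennreal t * emeasure lebesgue ?B \<le>
      (\<integral>\<^sup>+y\<in>?B. ennreal \<bar>f y\<bar> * indicator {y. \<bar>f y\<bar> > t} y \<partial>lebesgue)"
    unfolding b(2) using t b(1)
    by (subst (asm) ennreal_add_left_cancel_le) (auto simp: ennreal_mult[symmetric])
qed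

lemma integral_ball_le_maximal:
  fixes f :: "real ^ 'n \<Rightarrow> real"
  assumes "r > 0"
  shows "(\<integral>\<^sup>+y\<in>ball x r. ennreal \<bar>f y\<bar> \<partial>lebesgue) \<le>
    ennreal (unit_ball_vol CARD('n) * r ^ CARD('n)) * maximal f x"
proof -
  define b where "b = unit_ball_vol CARD('n) * r ^ CARD('n)"
  have b: "b > 0" "emeasure lebesgue (ball x r) = ennreal b"
    using assms emeasure_lebesgue_ball[of r x] by (auto simp: b_def)
  have "(\<integral>\<^sup>+y\<in>ball x r. ennreal \<bar>f y\<bar> \<partial>lebesgue) / ennreal b \<le> maximal f x"
    unfolding maximal_def b(2)[symmetric] using assms
    by (intro SUP_upper2[of "(x, r)"]) auto
  then show ?thesis
    using b(1) by (simp add: ennreal_le_mult_iff b_def)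
qed

lemma maximal_scale:
  fixes f :: "real ^ 'n \<Rightarrow> real"
  assumes [measurable]: "f \<in> borel_measurable lebesgue" and c: "c > 0"
  shows "maximal (\<lambda>y. f y / c) x = maximal f x / ennreal c"
proof -
  have [measurable]: "ball a r \<in> sets lebesgue" for a :: "real ^ 'n" and r
    by simp
  have "(\<integral>\<^sup>+y\<in>ball a r. ennreal \<bar>f y / c\<bar> \<partial>lebesgue) / emeasure lebesgue (ball a r)
    = inverse (ennreal c) * ((\<integral>\<^sup>+y\<in>ball a r. ennreal \<bar>f y\<bar> \<partial>lebesgue) / emeasure lebesgue (ball a r))" for a r
  proof -
    have "(\<integral>\<^sup>+y\<in>ball a r. ennreal \<bar>f y / c\<bar> \<partial>lebesgue) = (\<integral>\<^sup>+y. inverse (ennreal c) * (ennreal \<bar>f y\<bar> * indicator (ball a r) y) \<partial>lebesgue)"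
      using c by (intro nn_integral_cong)
        (auto simp: inverse_ennreal ennreal_mult[symmetric] abs_mult divide_inverse mult.commute split: split_indicator)
    also have "\<dots> = inverse (ennreal c) * (\<integral>\<^sup>+y\<in>ball a r. ennreal \<bar>f y\<bar> \<partial>lebesgue)"
      by (rule nn_integral_cmult) simp
    finally show ?thesis
      by (simp add: ennreal_times_divide)
  qed
  then show ?thesis
    by (simp add: maximal_def SUP_mult_left_ennreal[symmetric] divide_ennreal_def mult.commute case_prod_beta
       )
qed

subsection \<open>Tail bounds\<close>

text \<open>The estimate through which both the strong and the weak Orlicz integrability of \<^term>\<open>f\<close>
  enter the argument.\<close>

definition tail_bound :: "(ennreal \<Rightarrow> ennreal) \<Rightarrow> real \<Rightarrow> (real ^ 'n \<Rightarrow> real) \<Rightarrow> bool" where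
  "tail_bound \<Phi> H f \<longleftrightarrow> (\<forall>s>0. \<Phi> (ennreal s) * (\<integral>\<^sup>+y\<in>{y. \<bar>f y\<bar> > H * s}. ennreal \<bar>f y\<bar> \<partial>lebesgue)
     \<le> ennreal (H * s))"

lemma tail_boundD:
  "tail_bound \<Phi> H f \<Longrightarrow> s > 0 \<Longrightarrow>
    \<Phi> (ennreal s) * (\<integral>\<^sup>+y\<in>{y. \<bar>f y\<bar> > H * s}. ennreal \<bar>f y\<bar> \<partial>lebesgue) \<le> ennreal (H * s)"
  by (simp add: tail_bound_def)

text \<open>Allows one constant to serve the strong and the weak norm together.\<close>

lemma tail_bound_mono:
  assumes "tail_bound \<Phi> H f" "H \<le> H'"
  shows "tail_bound \<Phi> H' f"
  unfolding tail_bound_def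
proof (intro allI impI)
  fix s :: real
  assume s: "s > 0"
  have le: "H * s \<le> H' * s"
    using assms(2) s by simp
  have "(\<integral>\<^sup>+y\<in>{y. \<bar>f y\<bar> > H' * s}. ennreal \<bar>f y\<bar> \<partial>lebesgue)
      \<le> (\<integral>\<^sup>+y\<in>{y. \<bar>f y\<bar> > H * s}. ennreal \<bar>f y\<bar> \<partial>lebesgue)"
    using le by (intro nn_integral_mono) (auto split: split_indicator)
  then have "\<Phi> (ennreal s) * (\<integral>\<^sup>+y\<in>{y. \<bar>f y\<bar> > H' * s}. ennreal \<bar>f y\<bar> \<partial>lebesgue)
      \<le> \<Phi> (ennreal s) * (\<integral>\<^sup>+y\<in>{y. \<bar>f y\<bar> > H * s}. ennreal \<bar>f y\<bar> \<partial>lebesgue)"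
    by (rule mult_left_mono) simp
  also have "\<dots> \<le> ennreal (H * s)"
    using assms(1) s by (rule tail_boundD)
  also have "\<dots> \<le> ennreal (H' * s)"
    using le by (rule ennreal_leI)
  finally show "\<Phi> (ennreal s) * (\<integral>\<^sup>+y\<in>{y. \<bar>f y\<bar> > H' * s}. ennreal \<bar>f y\<bar> \<partial>lebesgue) \<le> ennreal (H' * s)" .
qed

text \<open>Where |f| > D s, the factor c = |f| / (D s) exceeds 1, and quasi-convexity at s gives c
  \<Phi>(s) \<le> \<Phi>(|f|), that is \<Phi>(s) |f| \<le> D s \<Phi>(|f|). Integrating gives the
  claim.\<close>

lemma tail_bound_of_modular:
  fixes f :: "real ^ 'n \<Rightarrow> real"
  assumes "\<Phi> \<in> Phi_bar" and D: "scaling \<Phi> D" and [measurable]: "f \<in> borel_measurable lebesgue"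
    and modular: "(\<integral>\<^sup>+x. \<Phi> (ennreal \<bar>f x\<bar>) \<partial>lebesgue) \<le> 1"
  shows "tail_bound \<Phi> D f"
  unfolding tail_bound_def
proof (intro allI impI)
  fix s :: real
  assume s: "s > 0"
  have D1: "D \<ge> 1"
    using D by (simp add: scaling_def)
  have [measurable]: "\<Phi> \<in> borel_measurable borel"
    using assms(1) by (intro borel_measurable_mono_ennreal Phi_bar_mono)
  have pt: "\<Phi> (ennreal s) * ennreal \<bar>f y\<bar> \<le> ennreal (D * s) * \<Phi> (ennreal \<bar>f y\<bar>)" if y: "\<bar>f y\<bar> > D * s" for y
  proof -
    define c where "c = \<bar>f y\<bar> / (D * s)"
    have c: "c \<ge> 1" "D * c * s = \<bar>f y\<bar>" "D * s * c = \<bar>f y\<bar>"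
      using y D1 s by (auto simp: c_def field_simps)
    have "\<Phi> (ennreal s) * ennreal \<bar>f y\<bar> = ennreal (D * s) * (ennreal c * \<Phi> (ennreal s))"
    proof -
      have "ennreal \<bar>f y\<bar> = ennreal (D * s) * ennreal c"
        using c D1 s by (simp add: ennreal_mult[symmetric])
      then show ?thesis
        by (simp only: mult_ac)
    qed
    also have "\<dots> \<le> ennreal (D * s) * \<Phi> (ennreal (D * c) * ennreal s)"
      by (intro mult_left_mono scalingD[OF D c(1)]) simp
    also have "ennreal (D * c) * ennreal s = ennreal \<bar>f y\<bar>"
      using c s D1 by (simp add: ennreal_mult[symmetric])
    finally show ?thesis .
  qed
  have "\<Phi> (ennreal s) * (\<integral>\<^sup>+y\<in>{y. \<bar>f y\<bar> > D * s}. ennreal \<bar>f y\<bar> \<partial>lebesgue)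
      = (\<integral>\<^sup>+y. \<Phi> (ennreal s) * (ennreal \<bar>f y\<bar> * indicator {y. \<bar>f y\<bar> > D * s} y) \<partial>lebesgue)"
    by (rule nn_integral_cmult[symmetric]) measurable
  also have "\<dots> \<le> (\<integral>\<^sup>+y. ennreal (D * s) * \<Phi> (ennreal \<bar>f y\<bar>) \<partial>lebesgue)"
    using pt by (intro nn_integral_mono) (auto split: split_indicator)
  also have "\<dots> = ennreal (D * s) * (\<integral>\<^sup>+y. \<Phi> (ennreal \<bar>f y\<bar>) \<partial>lebesgue)"
    by (rule nn_integral_cmult) measurable
  also have "\<dots> \<le> ennreal (D * s) * 1"
    using modular by (rule mult_left_mono) simp
  finally show "\<Phi> (ennreal s) * (\<integral>\<^sup>+y\<in>{y. \<bar>f y\<bar> > D * s}. ennreal \<bar>f y\<bar> \<partial>lebesgue) \<le> ennreal (D * s)"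
    by simp
qed

definition nabla2_const :: "(ennreal \<Rightarrow> ennreal) \<Rightarrow> real \<Rightarrow> bool" where
  "nabla2_const \<Phi> k \<longleftrightarrow> k > 1 \<and> (\<forall>t>0. \<Phi> t \<le> \<Phi> (ennreal k * t) / ennreal (2 * k))"

text \<open>Compared with linear growth k^j there is a surplus 2^j; it makes the level sums below
  geometric.\<close>

lemma nabla2_iterate:
  assumes "nabla2_const \<Phi> k" "s > 0"
  shows "ennreal ((2 * k) ^ j) * \<Phi> (ennreal s) \<le> \<Phi> (ennreal (k ^ j * s))"
proof (induction j)
  case (Suc j)
  have k: "k > 1"
    using assms by (simp add: nabla2_const_def)
  have "\<Phi> (ennreal (k ^ j * s)) \<le> \<Phi> (ennreal k * ennreal (k ^ j * s)) / ennreal (2 * k)"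
    using assms k by (auto simp: nabla2_const_def)
  then have "ennreal (2 * k) * \<Phi> (ennreal (k ^ j * s)) \<le>
      ennreal (2 * k) * (\<Phi> (ennreal k * ennreal (k ^ j * s)) / ennreal (2 * k))"
    by (rule mult_left_mono) simp
  also have "\<dots> = \<Phi> (ennreal (k ^ Suc j * s))"
    using k assms(2) by (simp add: ennreal_mult_divide_cancel ennreal_mult[symmetric] mult.assoc)
  finally have step: "ennreal (2 * k) * \<Phi> (ennreal (k ^ j * s)) \<le> \<Phi> (ennreal (k ^ Suc j * s))" .
  have "ennreal ((2 * k) ^ Suc j) * \<Phi> (ennreal s) = ennreal (2 * k) * (ennreal ((2 * k) ^ j) * \<Phi> (ennreal s))"
    using k by (simp add: mult.assoc[symmetric] ennreal_mult[symmetric])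
  also have "\<dots> \<le> ennreal (2 * k) * \<Phi> (ennreal (k ^ j * s))"
    using Suc by (rule mult_left_mono) simp
  also note step
  finally show ?case .
qed simp

lemma geometric_level:
  fixes k v :: real
  assumes "k > 1" "v > 1"
  obtains j where "k ^ j < v" "v \<le> k ^ Suc j"
proof -
  have ex: "\<exists>i. v \<le> k ^ i"
    using real_arch_pow[OF assms(1), of v] less_imp_le by blast
  define i where "i = (LEAST i. v \<le> k ^ i)"
  have i: "v \<le> k ^ i"
    unfolding i_def using ex by (rule LeastI_ex)
  then obtain j where j: "i = Suc j"
    using assms(2) by (cases i) auto
  then have "\<not> v \<le> k ^ j"
    unfolding i_def using not_less_Least lessI by metis
  then show ?thesis
    using i j by (intro that[of j]) auto
qed

lemma level_sets:
  fixes f :: "'a::euclidean_space \<Rightarrow> real"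
  assumes [measurable]: "f \<in> borel_measurable lebesgue"
  shows "{y. t < \<bar>f y\<bar>} \<in> sets lebesgue"
proof -
  have "{y \<in> space lebesgue. t < \<bar>f y\<bar>} \<in> sets lebesgue"
    by measurable
  then show ?thesis
    by simp
qed

lemma le_suminf_ennreal:
  fixes f :: "nat \<Rightarrow> ennreal"
  shows "f j \<le> suminf f"
  using sum_le_suminf[of f "{j}"] by simp

lemma suminf_half_powers:
  assumes "0 \<le> a"
  shows "(\<Sum>j. ennreal (a * (1 / 2) ^ j)) = ennreal (2 * a)"
proof -
  have "(\<lambda>j. a * (1 / 2) ^ j) sums (a * 2)"
    using sums_mult[OF geometric_sums[of "1 / 2 :: real"], of a] by simp
  then show ?thesis
    using assms by (subst suminf_ennreal_eq) (auto simp: mult.commute)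
qed

text \<open>Cut |f| into layers k^j s < |f| \<le> k^(j+1) s. Writing k^j = 2^-j (2 k)^j and
  absorbing (2 k)^j into \<Phi>, the weak hypothesis at k^j s bounds the j-th contribution by k s
  2^-j. The sum is 2 k s, whence the constant 2 k.\<close>

lemma tail_bound_of_weak_modular:
  fixes f :: "real ^ 'n \<Rightarrow> real"
  assumes k: "nabla2_const \<Phi> k" and [measurable]: "f \<in> borel_measurable lebesgue"
    and weak: "\<And>t. t > 0 \<Longrightarrow> \<Phi> (ennreal t) * emeasure lebesgue {x. \<bar>f x\<bar> > t} \<le> 1"
  shows "tail_bound \<Phi> (2 * k) f"
  unfolding tail_bound_def
proof (intro allI impI)
  fix s :: real
  assume s: "s > 0"
  have k1: "k > 1"
    using k by (simp add: nabla2_const_def)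
  have "ennreal \<bar>f y\<bar> * indicator {y. \<bar>f y\<bar> > 2 * k * s} y
      \<le> (\<Sum>j. ennreal (k ^ Suc j * s) * indicator {y. \<bar>f y\<bar> > k ^ j * s} y)" for y
  proof (cases "\<bar>f y\<bar> > 2 * k * s")
    case True
    \<comment> \<open>Ensures |f y| / s > 1, so that the layer index is a natural number.\<close>
    have "1 * s < 2 * k * s"
      using k1 s by (intro mult_strict_right_mono) auto
    then have "1 * s < \<bar>f y\<bar>"
      using True by (rule less_trans)
    then have "\<bar>f y\<bar> / s > 1"
      using s by (simp add: less_divide_eq)
    then obtain j where j: "k ^ j < \<bar>f y\<bar> / s" "\<bar>f y\<bar> / s \<le> k ^ Suc j"
      using geometric_level[OF k1] by blast
    then have j': "k ^ j * s < \<bar>f y\<bar>" "\<bar>f y\<bar> \<le> k ^ Suc j * s"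
      using s by (simp_all add: field_simps)
    have "ennreal \<bar>f y\<bar> \<le> ennreal (k ^ Suc j * s) * indicator {y. \<bar>f y\<bar> > k ^ j * s} y"
      using j' by (simp add: ennreal_leI)
    also have "\<dots> \<le> (\<Sum>j. ennreal (k ^ Suc j * s) * indicator {y. \<bar>f y\<bar> > k ^ j * s} y)"
      by (rule le_suminf_ennreal)
    finally show ?thesis
      using True by simp
  qed simp
  then have "\<Phi> (ennreal s) * (\<integral>\<^sup>+y\<in>{y. \<bar>f y\<bar> > 2 * k * s}. ennreal \<bar>f y\<bar> \<partial>lebesgue)
      \<le> \<Phi> (ennreal s) * (\<integral>\<^sup>+y. (\<Sum>j. ennreal (k ^ Suc j * s) * indicator {y. \<bar>f y\<bar> > k ^ j * s} y) \<partial>lebesgue)"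
    by (intro mult_left_mono nn_integral_mono) auto
  also have "\<dots> = \<Phi> (ennreal s) * (\<Sum>j. ennreal (k ^ Suc j * s) * emeasure lebesgue {y. \<bar>f y\<bar> > k ^ j * s})"
    by (subst nn_integral_suminf) (simp_all add: nn_integral_cmult_indicator level_sets assms)
  also have "\<dots> = (\<Sum>j. \<Phi> (ennreal s) * (ennreal (k ^ Suc j * s) * emeasure lebesgue {y. \<bar>f y\<bar> > k ^ j * s}))"
    by (rule ennreal_suminf_cmult[symmetric])
  also have "\<dots> \<le> (\<Sum>j. ennreal (k * s * (1 / 2) ^ j))"
  proof (rule suminf_le)
    fix j
    let ?m = "emeasure lebesgue {y. \<bar>f y\<bar> > k ^ j * s}"
    have eq: "k ^ Suc j * s = k * s * (1 / 2) ^ j * (2 * k) ^ j"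
      using k1 by (simp add: power_mult_distrib power_divide)
    have "ennreal (k ^ Suc j * s) = ennreal (k * s * (1 / 2) ^ j) * ennreal ((2 * k) ^ j)"
      unfolding eq using k1 s by (intro ennreal_mult) auto
    then have "\<Phi> (ennreal s) * (ennreal (k ^ Suc j * s) * ?m) =
        ennreal (k * s * (1 / 2) ^ j) * (ennreal ((2 * k) ^ j) * \<Phi> (ennreal s) * ?m)"
      by (simp only: mult_ac)
    also have "\<dots> \<le> ennreal (k * s * (1 / 2) ^ j) * (\<Phi> (ennreal (k ^ j * s)) * ?m)"
      by (intro mult_left_mono mult_right_mono nabla2_iterate[OF k s]) auto
    also have "\<dots> \<le> ennreal (k * s * (1 / 2) ^ j) * 1"
      using k1 s by (intro mult_left_mono weak) auto
    finally show "\<Phi> (ennreal s) * (ennreal (k ^ Suc j * s) * ?m) \<le> ennreal (k * s * (1 / 2) ^ j)"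
      by simp
  qed auto
  also have "\<dots> = ennreal (2 * k * s)"
    using k1 s by (subst suminf_half_powers) (auto simp: mult.assoc)
  finally show "\<Phi> (ennreal s) * (\<integral>\<^sup>+y\<in>{y. \<bar>f y\<bar> > 2 * k * s}. ennreal \<bar>f y\<bar> \<partial>lebesgue) \<le> ennreal (2 * k * s)" .
qed

text \<open>For t with \<Phi>(t) > 1/b split |f| at H t: the lower part contributes at most H t b,
  and the tail bound gives the same for the upper part. Taking the infimum over such t produces
  \<Phi>^-1(1/b).\<close>

lemma tail_bound_integral_ball:
  fixes f :: "real ^ 'n \<Rightarrow> real"
  assumes bar: "\<Phi> \<in> Phi_bar" and f: "f \<in> borel_measurable lebesgue" and tb: "tail_bound \<Phi> H f"
    and H: "H > 0" and r: "r > 0" and b_def: "b = unit_ball_vol CARD('n) * r ^ CARD('n)"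
  shows "(\<integral>\<^sup>+y\<in>ball a r. ennreal \<bar>f y\<bar> \<partial>lebesgue) \<le> ennreal (2 * H * b) * gen_inverse \<Phi> (ennreal (1 / b))"
proof -
  have b: "b > 0" "emeasure lebesgue (ball a r) = ennreal b"
    using r emeasure_lebesgue_ball[of r a] by (auto simp: b_def)
  have "(\<integral>\<^sup>+y\<in>ball a r. ennreal \<bar>f y\<bar> \<partial>lebesgue) \<le> ennreal (2 * H * b) * t"
    if t: "ennreal (1 / b) < \<Phi> t" for t
  proof (cases t)
    case (real s)
    have s: "s > 0"
      using t real Phi_bar_zero[OF bar] by (cases "s = 0") auto
    let ?X = "\<integral>\<^sup>+y\<in>{y. \<bar>f y\<bar> > H * s}. ennreal \<bar>f y\<bar> \<partial>lebesgue"
    have "ennreal (1 / b) * ?X \<le> \<Phi> t * ?X"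
      using t by (intro mult_right_mono) auto
    also have "\<dots> \<le> ennreal (H * s)"
      using tail_boundD[OF tb s] real by simp
    finally have "ennreal b * (ennreal (1 / b) * ?X) \<le> ennreal b * ennreal (H * s)"
      by (rule mult_left_mono) simp
    then have X: "?X \<le> ennreal b * ennreal (H * s)"
      using b(1) by (simp add: mult.assoc[symmetric] ennreal_mult[symmetric])
    have "(\<integral>\<^sup>+y\<in>ball a r. ennreal \<bar>f y\<bar> \<partial>lebesgue) \<le> ennreal (H * s) * ennreal b +
       (\<integral>\<^sup>+y\<in>ball a r. ennreal \<bar>f y\<bar> * indicator {y. \<bar>f y\<bar> > H * s} y \<partial>lebesgue)"
      unfolding b(2)[symmetric] using f s H by (intro nn_integral_le_level) auto
    also have "\<dots> \<le> ennreal (H * s) * ennreal b + ?X"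
      by (intro add_left_mono nn_integral_mono) (auto split: split_indicator)
    also have "\<dots> \<le> ennreal (H * s) * ennreal b + ennreal b * ennreal (H * s)"
      using X by (rule add_left_mono)
    also have "\<dots> = ennreal (2 * H * b) * t"
      using real s H b(1) by (simp add: ennreal_mult[symmetric] ennreal_plus[symmetric] mult_ac del: ennreal_plus)
    finally show ?thesis .
  next
    case top
    then show ?thesis
      using H b(1) by (simp add: ennreal_mult_top)
  qed
  then show ?thesis
    using H b(1) by (auto simp: gen_inverse_def intro!: le_mult_Inf_ennreal)
qed

text \<open>The truncation in \<open>tail_bound\<close> is the one in
  \<open>maximal_weak_type\<close> at level H s, so the factor H s cancels.\<close>

lemma tail_bound_maximal:
  fixes f :: "real ^ 'n \<Rightarrow> real"
  assumes f: "f \<in> borel_measurable lebesgue" and tb: "tail_bound \<Phi> H f" and H: "H > 0" and s: "s > 0"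
  shows "\<Phi> (ennreal s) * emeasure lebesgue {x. ennreal (2 * H * s) < maximal f x} \<le> 5 ^ CARD('n)"
proof -
  let ?m = "emeasure lebesgue {x. ennreal (2 * (H * s)) < maximal f x}"
  have Hs: "H * s > 0"
    using H s by simp
  have "ennreal (H * s) * (\<Phi> (ennreal s) * ?m) = \<Phi> (ennreal s) * (ennreal (H * s) * ?m)"
    by (simp add: mult_ac)
  also have "\<dots> \<le> \<Phi> (ennreal s) * (5 ^ CARD('n) * (\<integral>\<^sup>+y\<in>{y. \<bar>f y\<bar> > H * s}. ennreal \<bar>f y\<bar> \<partial>lebesgue))"
    using f Hs by (intro mult_left_mono maximal_weak_type) auto
  also have "\<dots> = 5 ^ CARD('n) * (\<Phi> (ennreal s) * (\<integral>\<^sup>+y\<in>{y. \<bar>f y\<bar> > H * s}. ennreal \<bar>f y\<bar> \<partial>lebesgue))"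
    by (simp add: mult_ac)
  also have "\<dots> \<le> 5 ^ CARD('n) * ennreal (H * s)"
    by (intro mult_left_mono tail_boundD[OF tb s]) auto
  finally have "ennreal (H * s) * (\<Phi> (ennreal s) * ?m) \<le> ennreal (H * s) * 5 ^ CARD('n)"
    by (simp add: mult.commute)
  then have "\<Phi> (ennreal s) * ?m \<le> 5 ^ CARD('n)"
    using Hs by (subst (asm) ennreal_mult_le_mult_iff) auto
  then show ?thesis
    by (simp add: mult.assoc)
qed

text \<open>As \<Phi> is unbounded, \<open>tail_bound_maximal\<close> bounds the measure of {M f =
  \<infinity>} by 5^n / M for every M > 0.\<close>

lemma tail_bound_maximal_finite:
  fixes f :: "real ^ 'n \<Rightarrow> real"
  assumes bar: "\<Phi> \<in> Phi_bar" and f: "f \<in> borel_measurable lebesgue" and tb: "tail_bound \<Phi> H f" and H: "H > 0"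
  shows "AE x in lebesgue. maximal f x < \<infinity>"
proof -
  define m where "m = emeasure lebesgue {x. maximal f x = \<infinity>}"
  have "maximal f -` {\<infinity>} \<in> sets lebesgue"
    using measurable_sets[OF maximal_measurable, of "{\<infinity>}" f] by simp
  then have meas: "{x. maximal f x = \<infinity>} \<in> sets lebesgue"
    by (simp add: vimage_def)
  have meas_gt: "{x. t < maximal f x} \<in> sets lebesgue" for t
    by (simp add: borel_open open_maximal_gt)
  have bound: "ennreal M * m \<le> 5 ^ CARD('n)" for M
  proof -
    obtain s :: real where s: "s > 0" "ennreal M < \<Phi> (ennreal s)"
      using Phi_bar_unbounded[OF bar] .
    have "ennreal M * m \<le> \<Phi> (ennreal s) * emeasure lebesgue {x. ennreal (2 * H * s) < maximal f x}"
      unfolding m_def using s(2) meas_gt by (intro mult_mono emeasure_mono) auto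
    also have "\<dots> \<le> 5 ^ CARD('n)"
      by (rule tail_bound_maximal[OF f tb H s(1)])
    finally show ?thesis .
  qed
  have "m = 0"
  proof (rule ccontr)
    assume "m \<noteq> 0"
    have "m < \<infinity>"
      using bound[of 1] by (simp add: order_le_less_trans[of _ "5 ^ CARD('n)"] power_less_top_ennreal)
    then obtain m' where m': "m = ennreal m'" "m' > 0"
      using \<open>m \<noteq> 0\<close> by (cases m) auto
    have "ennreal (2 * 5 ^ CARD('n)) = ennreal (2 * 5 ^ CARD('n) / m') * m"
      using m' by (simp add: ennreal_mult[symmetric])
    also have "\<dots> \<le> 5 ^ CARD('n)"
      by (rule bound)
    also have "(5::ennreal) ^ CARD('n) = ennreal (5 ^ CARD('n))"
      using ennreal_power[of 5 "CARD('n)"] by simp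
    finally show False
      by simp
  qed
  then have "{x. maximal f x = \<infinity>} \<in> null_sets lebesgue"
    using meas unfolding m_def by blast
  from AE_not_in[OF this] show ?thesis
    by eventually_elim (simp add: top.not_eq_extremum)
qed

subsection \<open>The strong maximal inequality\<close>

text \<open>Integer exponents, unlike in \<open>geometric_level\<close>, because positive values of
  a maximal function may be arbitrarily small.\<close>

lemma geometric_level_int:
  fixes k v :: real
  assumes "k > 1" "v > 0"
  obtains j :: int where "k powr j < v" "v \<le> k powr (j + 1)"
proof (rule that[of "\<lceil>log k v\<rceil> - 1"])
  have "real_of_int (\<lceil>log k v\<rceil> - 1) < log k v"
    by linarith
  then show "k powr (real_of_int (\<lceil>log k v\<rceil> - 1)) < v"
    using assms by (simp add: less_log_iff)
  have "v = k powr log k v"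
    using assms by simp
  also have "\<dots> \<le> k powr real_of_int (\<lceil>log k v\<rceil> - 1 + 1)"
    using assms by (intro powr_mono) auto
  finally show "v \<le> k powr real_of_int (\<lceil>log k v\<rceil> - 1 + 1)" .
qed

text \<open>Going down from the largest level k^J below v, each step raises v / k^j by a factor k,
  but \<Phi>(k^j) falls by at least 2 k. The term at J - i is thus at most k 2^-i \<Phi>(v), where k
  bounds v / k^J.\<close>

lemma nabla2_geometric_sum:
  assumes bar: "\<Phi> \<in> Phi_bar" and k: "nabla2_const \<Phi> k" and v: "v \<ge> 0"
  shows "(\<integral>\<^sup>+j. \<Phi> (ennreal (k powr real_of_int j)) * ennreal (v / k powr real_of_int j) * indicator {j. k powr real_of_int j < v} j
    \<partial>count_space UNIV) \<le> ennreal (2 * k) * \<Phi> (ennreal v)"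
proof (cases "v = 0")
  case True
  then show ?thesis
    by (simp add: not_less[symmetric])
next
  case False
  have k1: "k > 1"
    using k by (simp add: nabla2_const_def)
  obtain J :: int where J: "k powr J < v" "v \<le> k powr (J + 1)"
    using geometric_level_int[OF k1, of v] v False by auto
  let ?h = "\<lambda>j::int. \<Phi> (ennreal (k powr j)) * ennreal (v / k powr j)"
  have "(\<integral>\<^sup>+j. ?h j * indicator {j. k powr real_of_int j < v} j \<partial>count_space UNIV)
      \<le> (\<integral>\<^sup>+j. ?h j * indicator {..J} j \<partial>count_space UNIV)"
  proof (intro nn_integral_mono mult_left_mono)
    fix j :: int
    have "j \<le> J" if "k powr real_of_int j < v"
    proof (rule ccontr)
      assume "\<not> j \<le> J"
      then have "k powr (J + 1) \<le> k powr j"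
        using k1 by (intro powr_mono) auto
      then show False
        using J(2) that by linarith
    qed
    then show "(indicator {j. k powr real_of_int j < v} j :: ennreal) \<le> indicator {..J} j"
      by (auto split: split_indicator)
  qed auto
  also have "\<dots> = (\<integral>\<^sup>+j. ?h j \<partial>count_space {..J})"
    by (rule nn_integral_count_space_indicator[symmetric]) auto
  \<comment> \<open>Reversing the order, j = J - i, makes the sum a series over the natural
    numbers.\<close>
  also have "\<dots> = (\<integral>\<^sup>+i. ?h (J - int i) \<partial>count_space UNIV)"
  proof (rule nn_integral_bij_count_space[symmetric])
    show "bij_betw (\<lambda>i. J - int i) UNIV {..J}"
      by (rule bij_betw_byWitness[where f' = "\<lambda>j. nat (J - j)"]) auto
  qed
  also have "\<dots> = (\<Sum>i. ?h (J - int i))"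
    by (rule nn_integral_count_space_nat)
  also have "\<dots> \<le> (\<Sum>i. ennreal (k * (1 / 2) ^ i) * \<Phi> (ennreal v))"
  proof (rule suminf_le)
    fix i
    define a where "a = k powr real_of_int (J - int i)"
    have a: "a > 0"
      using k1 by (simp add: a_def)
    have ka: "k ^ i * a = k powr J"
      using k1 unfolding a_def by (simp add: powr_diff powr_realpow)
    have kJ: "k powr real_of_int J > 0"
      using k1 by simp
    have eq: "v / a = (v / k powr J) * (1 / 2) ^ i * (2 * k) ^ i"
      using a k1 ka[symmetric] by (simp add: power_mult_distrib power_divide field_simps)
    have vk: "v / k powr J \<le> k"
      using J(2) kJ k1 by (simp add: powr_add field_simps)
    have "?h (J - int i) = ennreal (v / k powr J * (1 / 2) ^ i) * (ennreal ((2 * k) ^ i) * \<Phi> (ennreal a))"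
    proof -
      have "ennreal (v / a) = ennreal (v / k powr J * (1 / 2) ^ i) * ennreal ((2 * k) ^ i)"
        using v k1 unfolding eq by (intro ennreal_mult) auto
      then show ?thesis
        unfolding a_def[symmetric] by (simp only: mult_ac)
    qed
    also have "\<dots> \<le> ennreal (k * (1 / 2) ^ i) * \<Phi> (ennreal (k ^ i * a))"
      using vk by (intro mult_mono nabla2_iterate[OF k a] ennreal_leI mult_right_mono) auto
    also have "\<dots> \<le> ennreal (k * (1 / 2) ^ i) * \<Phi> (ennreal v)"
      unfolding ka using J(1) by (intro mult_left_mono Phi_bar_monoD[OF bar] ennreal_leI) auto
    finally show "?h (J - int i) \<le> ennreal (k * (1 / 2) ^ i) * \<Phi> (ennreal v)" .
  qed auto
  also have "\<dots> = ennreal (2 * k) * \<Phi> (ennreal v)"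
    unfolding ennreal_suminf_multc using k1 by (subst suminf_half_powers) auto
  finally show ?thesis .
qed

text \<open>A layer-cake argument with levels a_j = k^j. If a_j < M g / 2 \<le> k a_j, then \<Phi>(M
  g / (2 k)) \<le> \<Phi>(a_j), and this one term is bounded by the sum over all levels with M g > 2
  a_j. The weak-type bound at each level and an interchange of sum and integral leave the series of
  \<open>nabla2_geometric_sum\<close> at v = |g x|. Finiteness of M g is what places a value in a
  level.\<close>

lemma maximal_modular_le:
  fixes g :: "real ^ 'n \<Rightarrow> real"
  assumes bar: "\<Phi> \<in> Phi_bar" and k: "nabla2_const \<Phi> k" and g[measurable]: "g \<in> borel_measurable lebesgue"
    and fin: "AE x in lebesgue. maximal g x < \<infinity>"
  shows "(\<integral>\<^sup>+x. \<Phi> (maximal g x / ennreal (2 * k)) \<partial>lebesgue) \<le>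
    (\<integral>\<^sup>+x. ennreal (2 * k * 5 ^ CARD('n)) * \<Phi> (ennreal \<bar>g x\<bar>) \<partial>lebesgue)"
proof -
  have k1: "k > 1"
    using k by (simp add: nabla2_const_def)
  define a where "a j = k powr real_of_int j" for j :: int
  have a: "a j > 0" for j
    using k1 by (simp add: a_def)
  let ?S = "\<lambda>j. {x. ennreal (2 * a j) < maximal g x}"
  have S: "?S j \<in> sets lebesgue" for j
    by (simp add: borel_open open_maximal_gt)
  have pt: "\<Phi> (maximal g x / ennreal (2 * k)) \<le>
      (\<integral>\<^sup>+j. \<Phi> (ennreal (a j)) * indicator (?S j) x \<partial>count_space UNIV)" if x: "maximal g x < \<infinity>" for x
  proof (cases "maximal g x = 0")
    case True
    then show ?thesis
      by (simp add: Phi_bar_zero[OF bar])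
  next
    case False
    then obtain v where v: "maximal g x = ennreal v" "v > 0"
      using x by (cases "maximal g x") auto
    obtain j :: int where j: "k powr j < v / 2" "v / 2 \<le> k powr (j + 1)"
      using geometric_level_int[OF k1, of "v / 2"] v(2) by auto
    have "v / (2 * k) \<le> a j"
      using j(2) k1 by (simp add: a_def powr_add field_simps)
    then have "\<Phi> (maximal g x / ennreal (2 * k)) \<le> \<Phi> (ennreal (a j))"
      using v k1 by (intro Phi_bar_monoD[OF bar]) (simp add: divide_ennreal ennreal_leI)
    also have "\<dots> = \<Phi> (ennreal (a j)) * indicator (?S j) x"
      using j(1) v by (simp add: a_def ennreal_less_iff)
    also have "\<dots> \<le> (\<integral>\<^sup>+j. \<Phi> (ennreal (a j)) * indicator (?S j) x \<partial>count_space UNIV)"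
      by (rule nn_integral_ge_point) simp
    finally show ?thesis .
  qed
  have "(\<integral>\<^sup>+x. \<Phi> (maximal g x / ennreal (2 * k)) \<partial>lebesgue) \<le>
      (\<integral>\<^sup>+x. (\<integral>\<^sup>+j. \<Phi> (ennreal (a j)) * indicator (?S j) x \<partial>count_space UNIV) \<partial>lebesgue)"
    by (intro nn_integral_mono_AE eventually_mono[OF fin pt])
  also have "\<dots> = (\<integral>\<^sup>+j. \<Phi> (ennreal (a j)) * emeasure lebesgue (?S j) \<partial>count_space UNIV)"
    by (subst nn_integral_count_space_nn_integral)
      (auto simp: nn_integral_cmult_indicator S intro!: borel_measurable_times_ennreal borel_measurable_indicator S)
  also have "\<dots> \<le> (\<integral>\<^sup>+j. (\<integral>\<^sup>+x. 5 ^ CARD('n) * (\<Phi> (ennreal (a j)) * ennreal (\<bar>g x\<bar> / a j) *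
      indicator {x. a j < \<bar>g x\<bar>} x) \<partial>lebesgue) \<partial>count_space UNIV)"
  proof (rule nn_integral_mono)
    fix j
    let ?c = "5 ^ CARD('n) * \<Phi> (ennreal (a j)) * ennreal (1 / a j)"
    have "\<Phi> (ennreal (a j)) * emeasure lebesgue (?S j)
        = \<Phi> (ennreal (a j)) * ennreal (1 / a j) * (ennreal (a j) * emeasure lebesgue (?S j))"
    proof -
      have "ennreal (1 / a j) * ennreal (a j) = 1"
        using a[of j] by (simp add: ennreal_mult[symmetric])
      then show ?thesis
        by (metis mult.assoc mult.right_neutral)
    qed
    also have "\<dots> \<le> \<Phi> (ennreal (a j)) * ennreal (1 / a j) *
        (5 ^ CARD('n) * (\<integral>\<^sup>+x\<in>{x. a j < \<bar>g x\<bar>}. ennreal \<bar>g x\<bar> \<partial>lebesgue))"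
      by (intro mult_left_mono maximal_weak_type g a) simp
    also have "\<dots> = ?c * (\<integral>\<^sup>+x\<in>{x. a j < \<bar>g x\<bar>}. ennreal \<bar>g x\<bar> \<partial>lebesgue)"
      by (simp only: mult_ac)
    also have "\<dots> = (\<integral>\<^sup>+x. ?c * (ennreal \<bar>g x\<bar> * indicator {x. a j < \<bar>g x\<bar>} x) \<partial>lebesgue)"
      by (rule nn_integral_cmult[symmetric]) measurable
    also have "\<dots> = (\<integral>\<^sup>+x. 5 ^ CARD('n) * (\<Phi> (ennreal (a j)) * ennreal (\<bar>g x\<bar> / a j) *
      indicator {x. a j < \<bar>g x\<bar>} x) \<partial>lebesgue)"
    proof (intro nn_integral_cong)
      fix x
      have "ennreal (\<bar>g x\<bar> / a j) = ennreal (1 / a j) * ennreal \<bar>g x\<bar>"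
        using a[of j] by (simp add: ennreal_mult[symmetric])
      then show "?c * (ennreal \<bar>g x\<bar> * indicator {x. a j < \<bar>g x\<bar>} x) =
          5 ^ CARD('n) * (\<Phi> (ennreal (a j)) * ennreal (\<bar>g x\<bar> / a j) * indicator {x. a j < \<bar>g x\<bar>} x)"
        by (simp only: mult_ac)
    qed
    finally show "\<Phi> (ennreal (a j)) * emeasure lebesgue (?S j) \<le>
      (\<integral>\<^sup>+x. 5 ^ CARD('n) * (\<Phi> (ennreal (a j)) * ennreal (\<bar>g x\<bar> / a j) *
      indicator {x. a j < \<bar>g x\<bar>} x) \<partial>lebesgue)" .
  qed
  also have "\<dots> = (\<integral>\<^sup>+x. (\<integral>\<^sup>+j. 5 ^ CARD('n) * (\<Phi> (ennreal (a j)) * ennreal (\<bar>g x\<bar> / a j) *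
      indicator {x. a j < \<bar>g x\<bar>} x) \<partial>count_space UNIV) \<partial>lebesgue)"
    by (rule nn_integral_count_space_nn_integral[symmetric]) (simp, measurable)
  also have "\<dots> \<le> (\<integral>\<^sup>+x. ennreal (2 * k * 5 ^ CARD('n)) * \<Phi> (ennreal \<bar>g x\<bar>) \<partial>lebesgue)"
  proof (rule nn_integral_mono)
    fix x
    have "(\<integral>\<^sup>+j. 5 ^ CARD('n) * (\<Phi> (ennreal (a j)) * ennreal (\<bar>g x\<bar> / a j) *
        indicator {x. a j < \<bar>g x\<bar>} x) \<partial>count_space UNIV) = 5 ^ CARD('n) *
        (\<integral>\<^sup>+j. \<Phi> (ennreal (a j)) * ennreal (\<bar>g x\<bar> / a j) * indicator {j. a j < \<bar>g x\<bar>} j \<partial>count_space UNIV)"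
      by (subst nn_integral_cmult[symmetric]) (auto simp: indicator_def)
    also have "\<dots> \<le> 5 ^ CARD('n) * (ennreal (2 * k) * \<Phi> (ennreal \<bar>g x\<bar>))"
      unfolding a_def by (intro mult_left_mono nabla2_geometric_sum[OF bar k]) auto
    also have "\<dots> = ennreal (2 * k * 5 ^ CARD('n)) * \<Phi> (ennreal \<bar>g x\<bar>)"
    proof -
      have "ennreal (2 * k * 5 ^ CARD('n)) = 5 ^ CARD('n) * ennreal (2 * k)"
        using k1 ennreal_power[of 5 "CARD('n)"] by (simp add: ennreal_mult mult.commute)
      then show ?thesis
        by (simp only: mult.assoc)
    qed
    finally show "(\<integral>\<^sup>+j. 5 ^ CARD('n) * (\<Phi> (ennreal (a j)) * ennreal (\<bar>g x\<bar> / a j) *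
        indicator {x. a j < \<bar>g x\<bar>} x) \<partial>count_space UNIV) \<le> ennreal (2 * k * 5 ^ CARD('n)) * \<Phi> (ennreal \<bar>g x\<bar>)" .
  qed
  finally show ?thesis .
qed

text \<open>Removes the constant c of \<open>maximal_modular_le\<close>: for g = f / (D c),
  quasi-convexity gives c \<Phi>(|g|) \<le> \<Phi>(|f|). Hence E = D c.\<close>

lemma maximal_strong_modular:
  fixes f :: "real ^ 'n \<Rightarrow> real"
  assumes bar: "\<Phi> \<in> Phi_bar" and D: "scaling \<Phi> D" and k: "nabla2_const \<Phi> k"
    and f: "f \<in> borel_measurable lebesgue" and modular: "(\<integral>\<^sup>+x. \<Phi> (ennreal \<bar>f x\<bar>) \<partial>lebesgue) \<le> 1"
    and E_def: "E = 2 * k * 5 ^ CARD('n) * D"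
  shows "(\<integral>\<^sup>+x. \<Phi> (maximal f x / ennreal (2 * k * E)) \<partial>lebesgue) \<le> 1"
proof -
  have k1: "k > 1" and D1: "D \<ge> 1"
    using k D by (auto simp: nabla2_const_def scaling_def)
  define c where "c = 2 * k * 5 ^ CARD('n)"
  have c: "c \<ge> 1"
  proof -
    have "1 * 1 \<le> 2 * k * 5 ^ CARD('n)"
      using k1 by (intro mult_mono) auto
    then show ?thesis
      by (simp add: c_def)
  qed
  have E: "E = D * c" "E > 0"
    using c D1 by (auto simp: E_def c_def)
  define g where "g x = f x / E" for x
  have g: "g \<in> borel_measurable lebesgue"
    using f unfolding g_def by measurable
  have Mg: "maximal g x = maximal f x / ennreal E" for x
    unfolding g_def by (rule maximal_scale[OF f E(2)])
  have fin_f: "AE x in lebesgue. maximal f x < \<infinity>"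
    using D1 by (intro tail_bound_maximal_finite[OF bar f tail_bound_of_modular[OF bar D f modular]]) simp
  have fin: "AE x in lebesgue. maximal g x < \<infinity>"
    using E(2) by (intro eventually_mono[OF fin_f]) (auto simp: Mg top.not_eq_extremum[symmetric] ennreal_divide_eq_top_iff)
  have "(\<integral>\<^sup>+x. \<Phi> (maximal f x / ennreal (2 * k * E)) \<partial>lebesgue) = (\<integral>\<^sup>+x. \<Phi> (maximal g x / ennreal (2 * k)) \<partial>lebesgue)"
    using k1 E(2) by (simp add: Mg divide_ennreal_def inverse_ennreal ennreal_mult[symmetric] mult_ac)
  also have "\<dots> \<le> (\<integral>\<^sup>+x. ennreal c * \<Phi> (ennreal \<bar>g x\<bar>) \<partial>lebesgue)"
    unfolding c_def by (rule maximal_modular_le[OF bar k g fin])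
  also have "\<dots> \<le> (\<integral>\<^sup>+x. \<Phi> (ennreal \<bar>f x\<bar>) \<partial>lebesgue)"
  proof (rule nn_integral_mono)
    fix x
    have "ennreal c * \<Phi> (ennreal \<bar>g x\<bar>) \<le> \<Phi> (ennreal (D * c) * ennreal \<bar>g x\<bar>)"
      by (rule scalingD[OF D c])
    also have "ennreal (D * c) * ennreal \<bar>g x\<bar> = ennreal \<bar>f x\<bar>"
      using E(2) unfolding E(1)[symmetric] by (simp add: g_def ennreal_mult[symmetric])
    finally show "ennreal c * \<Phi> (ennreal \<bar>g x\<bar>) \<le> \<Phi> (ennreal \<bar>f x\<bar>)" .
  qed
  also note modular
  finally show ?thesis .
qed

subsection \<open>Pointwise estimates of the fractional integral\<close>

lemma abs_frac_int_le:
  fixes f :: "real ^ 'n \<Rightarrow> real"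
  assumes "\<rho> \<in> borel_measurable (lebesgue_on {0<..})" "f \<in> borel_measurable lebesgue"
  shows "abs_frac_int \<rho> f x \<le> (\<integral>\<^sup>+y. ennreal \<bar>frac_integrand \<rho> f x y\<bar> \<partial>lebesgue)"
proof (cases "integrable lebesgue (frac_integrand \<rho> f x)")
  case True
  then show ?thesis
    using integral_norm_bound_ennreal[OF True] by (simp add: abs_frac_int_def frac_int_def)
next
  case False
  then have "\<not> (\<integral>\<^sup>+y. ennreal \<bar>frac_integrand \<rho> f x y\<bar> \<partial>lebesgue) < \<infinity>"
    using frac_integrand_measurable[OF assms, of x] by (auto simp: integrable_iff_bounded)
  then show ?thesis
    by (simp add: top.not_eq_extremum[symmetric])
qed

text \<open>With u = |x - y|, the upper limit t < K2 u turns 1/u^n into at most (K2/t)^n, and the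
  lower limit K1 u < t says that y lies in the ball of radius t/K1 about x. Integrating first in y
  therefore yields integrals of |f| over balls.\<close>

lemma frac_integral_le_averages:
  fixes f :: "real ^ 'n \<Rightarrow> real"
  assumes \<rho>[measurable]: "\<rho> \<in> borel_measurable lebesgue" and \<rho>_pos: "\<And>t. t > 0 \<Longrightarrow> \<rho> t > 0"
    and f[measurable]: "f \<in> borel_measurable lebesgue" and K: "0 < K1" "0 < C"
    and sup: "\<And>u. u > 0 \<Longrightarrow> ennreal (\<rho> u) \<le> ennreal C * rho_int \<rho> (K1 * u) (K2 * u)"
  shows "(\<integral>\<^sup>+y. ennreal \<bar>frac_integrand \<rho> f x y\<bar> \<partial>lebesgue) \<le>
    ennreal C * (\<integral>\<^sup>+t\<in>{0<..}. ennreal (\<rho> t / t * (K2 / t) ^ CARD('n)) *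
      (\<integral>\<^sup>+y\<in>ball x (t / K1). ennreal \<bar>f y\<bar> \<partial>lebesgue) \<partial>lebesgue)"
proof -
  interpret L: pair_sigma_finite "lebesgue :: (real ^ 'n) measure" "lebesgue :: real measure"
    by (simp add: pair_sigma_finite_def sigma_finite_lebesgue)
  define q where "q t = \<rho> t / t * (K2 / t) ^ CARD('n) * indicator {0<..} t" for t :: real
  have id[measurable]: "(\<lambda>t. t) \<in> borel_measurable (lebesgue :: real measure)"
      "(\<lambda>y. norm (x - y)) \<in> borel_measurable lebesgue"
    by (rule measurable_completion, simp)+
  have q[measurable]: "q \<in> borel_measurable lebesgue"
    unfolding q_def by measurable
  \<comment> \<open>The limit t < K2 u has been spent on the factor (K2/t)^n in \<open>q\<close>;
    the condition kept is the one that describes a ball in y.\<close>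
  define G where "G y t = ennreal (q t) * ennreal \<bar>f y\<bar> * indicator {p. norm (x - fst p) * K1 < snd p} (y, t)"
    for y and t :: real
  have "(\<lambda>p. norm (x - fst p)) \<in> borel_measurable (lebesgue \<Otimes>\<^sub>M (lebesgue :: real measure))"
    by (rule measurable_compose[OF measurable_fst id(2)])
  moreover have "(\<lambda>p. snd p) \<in> borel_measurable ((lebesgue :: (real ^ 'n) measure) \<Otimes>\<^sub>M (lebesgue :: real measure))"
    by (rule measurable_compose[OF measurable_snd id(1)])
  ultimately have "{p \<in> space (lebesgue \<Otimes>\<^sub>M (lebesgue :: real measure)). norm (x - fst p) * K1 < snd p}
      \<in> sets (lebesgue \<Otimes>\<^sub>M lebesgue)"
    by measurable
  then have ind[measurable]: "{p. norm (x - fst p) * K1 < snd p} \<in> sets (lebesgue \<Otimes>\<^sub>M (lebesgue :: real measure))"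
    by (simp add: space_pair_measure)
  have G: "(\<lambda>(y, t). G y t) \<in> borel_measurable (lebesgue \<Otimes>\<^sub>M lebesgue)"
    unfolding G_def case_prod_beta by (simp only: prod.collapse) measurable
  have pt: "ennreal \<bar>frac_integrand \<rho> f x y\<bar> \<le> ennreal C * (\<integral>\<^sup>+t. G y t \<partial>lebesgue)" for y
  proof (cases "y = x")
    case True
    then show ?thesis
      by (simp add: frac_integrand_def power_0_left)
  next
    case False
    define u where "u = norm (x - y)"
    have u: "u > 0"
      using False by (simp add: u_def)
    have "ennreal \<bar>frac_integrand \<rho> f x y\<bar> = ennreal (1 / u ^ CARD('n) * \<bar>f y\<bar>) * ennreal (\<rho> u)"
      using u \<rho>_pos[OF u] by (simp add: frac_integrand_def u_def[symmetric] abs_mult abs_divide ennreal_mult[symmetric] mult.commute)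
    also have "\<dots> \<le> ennreal (1 / u ^ CARD('n) * \<bar>f y\<bar>) * (ennreal C * rho_int \<rho> (K1 * u) (K2 * u))"
      by (intro mult_left_mono sup[OF u]) simp
    also have "\<dots> = ennreal C * (ennreal (1 / u ^ CARD('n) * \<bar>f y\<bar>) * rho_int \<rho> (K1 * u) (K2 * u))"
      by (simp only: mult_ac)
    also have "ennreal (1 / u ^ CARD('n) * \<bar>f y\<bar>) * rho_int \<rho> (K1 * u) (K2 * u) =
        (\<integral>\<^sup>+t. ennreal (1 / u ^ CARD('n) * \<bar>f y\<bar>) * (ennreal (\<rho> t / t) * indicator {K1 * u<..<K2 * u} t) \<partial>lebesgue)"
      unfolding rho_int_def by (rule nn_integral_cmult[symmetric]) measurable
    also have "\<dots> \<le> (\<integral>\<^sup>+t. G y t \<partial>lebesgue)"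
    proof (rule nn_integral_mono)
      fix t :: real
      show "ennreal (1 / u ^ CARD('n) * \<bar>f y\<bar>) * (ennreal (\<rho> t / t) * indicator {K1 * u<..<K2 * u} t) \<le> G y t"
      proof (cases "t \<in> {K1 * u<..<K2 * u}")
        case True
        moreover have "0 < K1 * u"
          using K u by simp
        ultimately have t: "t > 0" "K1 * u < t" "t < K2 * u"
          by auto
        have "1 / u \<le> K2 / t"
          using t u by (simp add: field_simps)
        then have le: "1 / u ^ CARD('n) \<le> (K2 / t) ^ CARD('n)"
          using u power_mono[of "1 / u" "K2 / t" "CARD('n)"] by (simp add: power_one_over)
        have "(1 / u ^ CARD('n) * \<bar>f y\<bar>) * (\<rho> t / t) \<le> ((K2 / t) ^ CARD('n) * \<bar>f y\<bar>) * (\<rho> t / t)"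
          using le \<rho>_pos[OF t(1)] t(1) by (intro mult_right_mono) auto
        also have "\<dots> = q t * \<bar>f y\<bar>"
          using t by (simp add: q_def)
        finally have "ennreal ((1 / u ^ CARD('n) * \<bar>f y\<bar>) * (\<rho> t / t)) \<le> ennreal (q t * \<bar>f y\<bar>)"
          by (rule ennreal_leI)
        moreover have "0 \<le> q t"
        proof -
          have "0 \<le> 1 / u ^ CARD('n)"
            using u by simp
          also note le
          finally have "0 \<le> \<rho> t / t * (K2 / t) ^ CARD('n)"
            using \<rho>_pos[OF t(1)] t(1) by (intro mult_nonneg_nonneg) auto
          then show ?thesis
            using t(1) by (simp add: q_def)
        qed
        ultimately show ?thesis
          using t u \<rho>_pos[OF t(1)] by (simp add: G_def u_def[symmetric] ennreal_mult[symmetric] mult.commute[of _ K1])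
      qed simp
    qed
    finally show ?thesis
      by (simp add: mult_left_mono)
  qed
  have "(\<integral>\<^sup>+y. ennreal \<bar>frac_integrand \<rho> f x y\<bar> \<partial>lebesgue) \<le> (\<integral>\<^sup>+y. ennreal C * (\<integral>\<^sup>+t. G y t \<partial>lebesgue) \<partial>lebesgue)"
    by (intro nn_integral_mono pt)
  also have "\<dots> = ennreal C * (\<integral>\<^sup>+y. (\<integral>\<^sup>+t. G y t \<partial>lebesgue) \<partial>lebesgue)"
    using G by (intro nn_integral_cmult L.M2.borel_measurable_nn_integral) auto
  also have "(\<integral>\<^sup>+y. (\<integral>\<^sup>+t. G y t \<partial>lebesgue) \<partial>lebesgue) = (\<integral>\<^sup>+t. (\<integral>\<^sup>+y. G y t \<partial>lebesgue) \<partial>lebesgue)"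
    using L.Fubini'[OF G] by simp
  also have "\<dots> = (\<integral>\<^sup>+t\<in>{0<..}. ennreal (\<rho> t / t * (K2 / t) ^ CARD('n)) *
      (\<integral>\<^sup>+y\<in>ball x (t / K1). ennreal \<bar>f y\<bar> \<partial>lebesgue) \<partial>lebesgue)"
  proof (rule nn_integral_cong)
    fix t :: real
    have "G y t = ennreal (q t) * (ennreal \<bar>f y\<bar> * indicator (ball x (t / K1)) y)" for y
      using K by (auto simp: G_def dist_norm field_simps split: split_indicator)
    moreover have [measurable]: "ball x (t / K1) \<in> sets lebesgue"
      by simp
    ultimately have "(\<integral>\<^sup>+y. G y t \<partial>lebesgue) = ennreal (q t) * (\<integral>\<^sup>+y\<in>ball x (t / K1). ennreal \<bar>f y\<bar> \<partial>lebesgue)"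
      by (simp add: nn_integral_cmult)
    then show "(\<integral>\<^sup>+y. G y t \<partial>lebesgue) = ennreal (\<rho> t / t * (K2 / t) ^ CARD('n)) *
      (\<integral>\<^sup>+y\<in>ball x (t / K1). ennreal \<bar>f y\<bar> \<partial>lebesgue) * indicator {0<..} t"
      by (auto simp: q_def split: split_indicator)
  qed
  finally show ?thesis .
qed

text \<open>\<open>B1\<close> is (K2/t)^n times the volume of the ball of radius t/K1, which does
  not depend on t; it pairs with M f for t < r. \<open>B2\<close> adds the factor 2 H of
  \<open>tail_bound_integral_ball\<close> and the cost of replacing the inverse at the reciprocal
  volume by the inverse at 1/t^n, for t > r.\<close>

lemma frac_integral_le_aux:
  fixes f :: "real ^ 'n \<Rightarrow> real"
  assumes bar: "\<Phi> \<in> Phi_bar" and D: "scaling \<Phi> D"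
    and \<rho>[measurable]: "\<rho> \<in> borel_measurable lebesgue" and \<rho>_pos: "\<And>t. t > 0 \<Longrightarrow> \<rho> t > 0"
    and K: "0 < K1" "K1 < K2" "0 < C"
    and sup: "\<And>u. u > 0 \<Longrightarrow> ennreal (\<rho> u) \<le> ennreal C * rho_int \<rho> (K1 * u) (K2 * u)"
    and f: "f \<in> borel_measurable lebesgue" and tb: "tail_bound \<Phi> H f" and H: "H > 0" and r: "r > 0"
    and w_def: "w = unit_ball_vol CARD('n)" and B1_def: "B1 = w * (K2 / K1) ^ CARD('n)"
    and B2_def: "B2 = 2 * H * B1 * (max 1 (K1 ^ CARD('n) / w) * D)"
  shows "(\<integral>\<^sup>+y. ennreal \<bar>frac_integrand \<rho> f x y\<bar> \<partial>lebesgue) \<le>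
    ennreal (C * max B1 B2) * (rho_int \<rho> 0 r * maximal f x + rho_tail CARD('n) \<Phi> \<rho> r)"
proof -
  define P where "P t = gen_inverse \<Phi> (ennreal (1 / t ^ CARD('n)))" for t :: real
  define B where "B = max B1 B2"
  have w: "w > 0"
    by (simp add: w_def)
  have D1: "D \<ge> 1"
    using D by (simp add: scaling_def)
  have B1: "B1 > 0"
    using w K by (simp add: B1_def)
  have B2: "B2 > 0"
    using B1 D1 H by (simp add: B2_def)
  have id[measurable]: "(\<lambda>t. t) \<in> borel_measurable (lebesgue :: real measure)"
    by (rule measurable_completion) simp
  have [measurable]: "gen_inverse \<Phi> \<in> borel_measurable borel"
    by (intro borel_measurable_mono_ennreal gen_inverse_mono)
  have P[measurable]: "P \<in> borel_measurable lebesgue"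
    unfolding P_def by measurable
  let ?avg = "\<lambda>t. ennreal ((K2 / t) ^ CARD('n)) * (\<integral>\<^sup>+y\<in>ball x (t / K1). ennreal \<bar>f y\<bar> \<partial>lebesgue)"
  have vol: "(K2 / t) ^ CARD('n) * (w * (t / K1) ^ CARD('n)) = B1" if "t > 0" for t
    using that K by (simp add: B1_def power_divide)
  have avg1: "?avg t \<le> ennreal B1 * maximal f x" if t: "t > 0" for t
  proof -
    have "?avg t \<le> ennreal ((K2 / t) ^ CARD('n)) * (ennreal (w * (t / K1) ^ CARD('n)) * maximal f x)"
      unfolding w_def using t K by (intro mult_left_mono integral_ball_le_maximal) auto
    also have "\<dots> = ennreal B1 * maximal f x"
      unfolding vol[OF t, symmetric] using t K w by (simp add: ennreal_mult mult.assoc)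
    finally show ?thesis .
  qed
  have avg2: "?avg t \<le> ennreal B2 * P t" if t: "t > 0" for t
  proof -
    define b where "b = w * (t / K1) ^ CARD('n)"
    have b: "b > 0"
      using w t K by (simp add: b_def)
    have eq: "1 / b = (K1 ^ CARD('n) / w) * (1 / t ^ CARD('n))"
      using w t K by (simp add: b_def power_divide)
    have "?avg t \<le> ennreal ((K2 / t) ^ CARD('n)) * (ennreal (2 * H * b) * gen_inverse \<Phi> (ennreal (1 / b)))"
      using t K by (intro mult_left_mono tail_bound_integral_ball[OF bar f tb H]) (auto simp: b_def w_def)
    also have "\<dots> = ennreal (2 * H * B1) * gen_inverse \<Phi> (ennreal (1 / b))"
    proof -
      have "(K2 / t) ^ CARD('n) * (2 * H * b) = 2 * H * B1"
        using vol[OF t] unfolding b_def by (metis mult.left_commute)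
      then have "ennreal ((K2 / t) ^ CARD('n)) * ennreal (2 * H * b) = ennreal (2 * H * B1)"
        using t K b H by (subst ennreal_mult[symmetric]) auto
      then show ?thesis
        by (simp only: mult.assoc[symmetric])
    qed
    also have "\<dots> \<le> ennreal (2 * H * B1) * (ennreal (max 1 (K1 ^ CARD('n) / w) * D) * P t)"
      unfolding eq P_def using w K t by (intro mult_left_mono gen_inverse_scale[OF D]) auto
    also have "\<dots> = ennreal B2 * P t"
      unfolding B2_def using H B1 D1 by (simp add: mult.assoc[symmetric] ennreal_mult[symmetric])
    finally show ?thesis .
  qed
  have "(\<integral>\<^sup>+t\<in>{0<..}. ennreal (\<rho> t / t * (K2 / t) ^ CARD('n)) *
      (\<integral>\<^sup>+y\<in>ball x (t / K1). ennreal \<bar>f y\<bar> \<partial>lebesgue) \<partial>lebesgue) \<le>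
    (\<integral>\<^sup>+t. ennreal B * maximal f x * (ennreal (\<rho> t / t) * indicator {0<..<r} t) +
      ennreal B * (ennreal (\<rho> t) * P t / ennreal t * indicator {r<..} t) \<partial>lebesgue)"
  proof (rule nn_integral_mono_AE)
    \<comment> \<open>Both ranges on the right are open at r, so this null point is
      discarded.\<close>
    have "AE t in lebesgue. t \<noteq> r"
      by (intro AE_completion AE_lborel_singleton)
    then show "AE t in lebesgue. ennreal (\<rho> t / t * (K2 / t) ^ CARD('n)) *
      (\<integral>\<^sup>+y\<in>ball x (t / K1). ennreal \<bar>f y\<bar> \<partial>lebesgue) * indicator {0<..} t \<le>
      ennreal B * maximal f x * (ennreal (\<rho> t / t) * indicator {0<..<r} t) +
      ennreal B * (ennreal (\<rho> t) * P t / ennreal t * indicator {r<..} t)"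
    proof eventually_elim
      case (elim t)
      consider "t \<le> 0" | "t > 0" "t < r" | "t > 0" "t > r"
        using elim by linarith
      then show ?case
      proof cases
        case 2
        have "ennreal (\<rho> t / t * (K2 / t) ^ CARD('n)) = ennreal (\<rho> t / t) * ennreal ((K2 / t) ^ CARD('n))"
          using 2 \<rho>_pos[of t] K by (intro ennreal_mult) auto
        then have "ennreal (\<rho> t / t * (K2 / t) ^ CARD('n)) * (\<integral>\<^sup>+y\<in>ball x (t / K1). ennreal \<bar>f y\<bar> \<partial>lebesgue)
            = ennreal (\<rho> t / t) * ?avg t"
          by (simp only: mult.assoc)
        also have "\<dots> \<le> ennreal (\<rho> t / t) * (ennreal B * maximal f x)"
          using avg1[OF 2(1)] by (intro mult_left_mono order_trans[OF avg1[OF 2(1)]] mult_right_mono ennreal_leI)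
            (auto simp: B_def)
        finally show ?thesis
          using 2 by (simp add: mult_ac)
      next
        case 3
        have "ennreal (\<rho> t / t * (K2 / t) ^ CARD('n)) = ennreal (\<rho> t / t) * ennreal ((K2 / t) ^ CARD('n))"
          using 3 \<rho>_pos[of t] K by (intro ennreal_mult) auto
        then have "ennreal (\<rho> t / t * (K2 / t) ^ CARD('n)) * (\<integral>\<^sup>+y\<in>ball x (t / K1). ennreal \<bar>f y\<bar> \<partial>lebesgue)
            = ennreal (\<rho> t / t) * ?avg t"
          by (simp only: mult.assoc)
        also have "\<dots> \<le> ennreal (\<rho> t / t) * (ennreal B * P t)"
          by (intro mult_left_mono order_trans[OF avg2[OF 3(1)]] mult_right_mono ennreal_leI)
            (auto simp: B_def)
        also have "ennreal (\<rho> t / t) = ennreal (\<rho> t) / ennreal t"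
          using 3 \<rho>_pos[of t] by (simp add: divide_ennreal)
        finally show ?thesis
          using 3 r by (simp add: divide_ennreal_def mult_ac)
      qed simp
    qed
  qed
  also have "\<dots> = ennreal B * maximal f x * rho_int \<rho> 0 r + ennreal B * rho_tail CARD('n) \<Phi> \<rho> r"
    unfolding rho_int_def rho_tail_def P_def[symmetric]
    by (subst nn_integral_add; (subst nn_integral_cmult)?; measurable?) (auto simp: nn_integral_cmult)
  finally have main: "(\<integral>\<^sup>+t\<in>{0<..}. ennreal (\<rho> t / t * (K2 / t) ^ CARD('n)) *
      (\<integral>\<^sup>+y\<in>ball x (t / K1). ennreal \<bar>f y\<bar> \<partial>lebesgue) \<partial>lebesgue) \<le>
      ennreal B * maximal f x * rho_int \<rho> 0 r + ennreal B * rho_tail CARD('n) \<Phi> \<rho> r" .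
  have "(\<integral>\<^sup>+y. ennreal \<bar>frac_integrand \<rho> f x y\<bar> \<partial>lebesgue) \<le>
      ennreal C * (ennreal B * maximal f x * rho_int \<rho> 0 r + ennreal B * rho_tail CARD('n) \<Phi> \<rho> r)"
    using frac_integral_le_averages[OF \<rho> \<rho>_pos f K(1,3) sup, of x] main
    by (meson order_trans mult_left_mono zero_le)
  also have "\<dots> = ennreal (C * B) * (rho_int \<rho> 0 r * maximal f x + rho_tail CARD('n) \<Phi> \<rho> r)"
    using K B1 by (simp add: B_def ennreal_mult distrib_left mult_ac)
  finally show ?thesis
    by (simp add: B_def)
qed

lemma rho_int_cong:
  assumes "0 \<le> a" "\<And>t. t > 0 \<Longrightarrow> \<rho> t = \<rho>' t"
  shows "rho_int \<rho> a b = rho_int \<rho>' a b"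
  unfolding rho_int_def using assms by (intro nn_integral_cong) (auto split: split_indicator)

lemma rho_tail_cong:
  assumes "0 \<le> r" "\<And>t. t > 0 \<Longrightarrow> \<rho> t = \<rho>' t"
  shows "rho_tail n \<Phi> \<rho> r = rho_tail n \<Phi> \<rho>' r"
  unfolding rho_tail_def using assms by (intro nn_integral_cong) (auto split: split_indicator)

text \<open>The constant is fixed before f, x and r, as the uniform bounds below require; \<rho> is
  replaced by its extension by 0.\<close>

lemma frac_integral_le:
  assumes bar: "\<Phi> \<in> Phi_bar" and D: "scaling \<Phi> D"
    and \<rho>: "\<rho> \<in> borel_measurable (lebesgue_on {0<..})" and \<rho>_pos: "\<And>t. t > 0 \<Longrightarrow> \<rho> t > 0"
    and K: "0 < K1" "K1 < K2" "0 < C"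
    and sup: "\<And>u. u > 0 \<Longrightarrow> ennreal (\<rho> u) \<le> ennreal C * rho_int \<rho> (K1 * u) (K2 * u)"
    and H: "H > 0"
  obtains B where "B > 0"
    "\<And>(f :: real ^ 'n \<Rightarrow> real) x r. f \<in> borel_measurable lebesgue \<Longrightarrow> tail_bound \<Phi> H f \<Longrightarrow> r > 0 \<Longrightarrow>
      (\<integral>\<^sup>+y. ennreal \<bar>frac_integrand \<rho> f x y\<bar> \<partial>lebesgue) \<le>
      ennreal B * (rho_int \<rho> 0 r * maximal f x + rho_tail CARD('n) \<Phi> \<rho> r)"
proof -
  define \<rho>' where "\<rho>' t = (if t \<in> {0<..} then \<rho> t else 0)" for t
  have \<rho>': "\<rho>' \<in> borel_measurable lebesgue"
    unfolding \<rho>'_def by (rule rho_ext_measurable[OF \<rho>])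
  have eq: "\<rho>' t = \<rho> t" if "t > 0" for t
    using that by (simp add: \<rho>'_def)
  have sup': "ennreal (\<rho>' u) \<le> ennreal C * rho_int \<rho>' (K1 * u) (K2 * u)" if "u > 0" for u
    using sup[OF that] rho_int_cong[of "K1 * u" \<rho>' \<rho> "K2 * u"] K that by (simp add: eq)
  define w where "w = unit_ball_vol CARD('n)"
  define B1 where "B1 = w * (K2 / K1) ^ CARD('n)"
  define B2 where "B2 = 2 * H * B1 * (max 1 (K1 ^ CARD('n) / w) * D)"
  show ?thesis
  proof (rule that)
    have "B1 > 0"
      using K by (simp add: B1_def w_def)
    then show "C * max B1 B2 > 0"
      using K by simp
    fix f :: "real ^ 'n \<Rightarrow> real" and x and r :: real
    assume f: "f \<in> borel_measurable lebesgue" and tb: "tail_bound \<Phi> H f" and r: "r > 0"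
    have "(\<integral>\<^sup>+y. ennreal \<bar>frac_integrand \<rho> f x y\<bar> \<partial>lebesgue) = (\<integral>\<^sup>+y. ennreal \<bar>frac_integrand \<rho>' f x y\<bar> \<partial>lebesgue)"
      using frac_integrand_cong[of x _ \<rho> \<rho>' f f] eq by (intro nn_integral_cong) auto
    also have "\<dots> \<le> ennreal (C * max B1 B2) * (rho_int \<rho>' 0 r * maximal f x + rho_tail CARD('n) \<Phi> \<rho>' r)"
      by (rule frac_integral_le_aux[OF bar D \<rho>' _ K sup' f tb H r w_def B1_def B2_def])
        (simp_all add: eq \<rho>_pos)
    also have "rho_int \<rho>' 0 r = rho_int \<rho> 0 r"
      by (rule rho_int_cong) (auto simp: eq)
    also have "rho_tail CARD('n) \<Phi> \<rho>' r = rho_tail CARD('n) \<Phi> \<rho> r"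
      using r by (intro rho_tail_cong) (auto simp: eq)
    finally show "(\<integral>\<^sup>+y. ennreal \<bar>frac_integrand \<rho> f x y\<bar> \<partial>lebesgue) \<le>
      ennreal (C * max B1 B2) * (rho_int \<rho> 0 r * maximal f x + rho_tail CARD('n) \<Phi> \<rho> r)" .
  qed
qed

lemma frac_integral_le_gen_inverse:
  fixes f :: "real ^ 'n \<Rightarrow> real"
  assumes B: "B > 0" "\<And>r. r > 0 \<Longrightarrow> (\<integral>\<^sup>+y. ennreal \<bar>frac_integrand \<rho> f x y\<bar> \<partial>lebesgue) \<le>
      ennreal B * (rho_int \<rho> 0 r * maximal f x + rho_tail CARD('n) \<Phi> \<rho> r)"
    and A: "A > 0" "\<And>r. r > 0 \<Longrightarrow> rho_int \<rho> 0 r * gen_inverse \<Phi> (ennreal (1 / r ^ CARD('n))) + rho_tail CARD('n) \<Phi> \<rho> r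
           \<le> ennreal A * gen_inverse \<Psi> (ennreal (1 / r ^ CARD('n)))"
    and C0: "C0 > 0" and u: "u > 0"
    and max: "maximal f x \<le> ennreal C0 * gen_inverse \<Phi> (ennreal u)"
  shows "(\<integral>\<^sup>+y. ennreal \<bar>frac_integrand \<rho> f x y\<bar> \<partial>lebesgue) \<le>
    ennreal (B * max 1 C0 * A) * gen_inverse \<Psi> (ennreal u)"
proof -
  define r where "r = root CARD('n) (1 / u)"
  have r: "r > 0" "1 / r ^ CARD('n) = u"
    using u by (auto simp: r_def)
  let ?P = "gen_inverse \<Phi> (ennreal u)"
  \<comment> \<open>The factor is at least 1 so that it also dominates the tail term, which carries
    no \<open>C0\<close>.\<close>
  have "maximal f x \<le> ennreal (max 1 C0) * ?P"
    using max by (rule order_trans) (intro mult_right_mono ennreal_leI, auto)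
  then have "rho_int \<rho> 0 r * maximal f x \<le> rho_int \<rho> 0 r * (ennreal (max 1 C0) * ?P)"
    by (rule mult_left_mono) simp
  moreover have "1 * rho_tail CARD('n) \<Phi> \<rho> r \<le> ennreal (max 1 C0) * rho_tail CARD('n) \<Phi> \<rho> r"
    by (intro mult_right_mono) auto
  ultimately have "rho_int \<rho> 0 r * maximal f x + rho_tail CARD('n) \<Phi> \<rho> r \<le>
      rho_int \<rho> 0 r * (ennreal (max 1 C0) * ?P) + ennreal (max 1 C0) * rho_tail CARD('n) \<Phi> \<rho> r"
    by (simp add: add_mono)
  also have "\<dots> = ennreal (max 1 C0) * (rho_int \<rho> 0 r * ?P + rho_tail CARD('n) \<Phi> \<rho> r)"
    by (simp only: distrib_left mult_ac)
  also have "\<dots> \<le> ennreal (max 1 C0) * (ennreal A * gen_inverse \<Psi> (ennreal u))"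
    using A(2)[OF r(1)] unfolding r(2) by (rule mult_left_mono) simp
  finally have "ennreal B * (rho_int \<rho> 0 r * maximal f x + rho_tail CARD('n) \<Phi> \<rho> r) \<le>
      ennreal B * (ennreal (max 1 C0) * (ennreal A * gen_inverse \<Psi> (ennreal u)))"
    by (rule mult_left_mono) simp
  also have "\<dots> = ennreal (B * max 1 C0 * A) * gen_inverse \<Psi> (ennreal u)"
    using B(1) A(1) by (simp add: ennreal_mult mult.assoc)
  finally show ?thesis
    using B(2)[OF r(1)] order_trans by blast
qed

text \<open>Any finite u above \<Phi>(m/C0) satisfies m/C0 \<le> \<Phi>^-1(u), so T/C1 \<le>
  \<Psi>^-1(u) and \<Psi>(T/C1) \<le> u. Letting u decrease avoids inverting \<Phi> at m/C0; if
  \<Phi>(m/C0) = \<infinity>, nothing has to be tested.\<close>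

lemma Orlicz_pointwise:
  assumes \<Phi>: "\<Phi> \<in> Phi_bar" and \<Psi>: "\<Psi> \<in> Phi_bar" and C: "C0 > 0" "C1 > 0"
    and key: "\<And>u. u > 0 \<Longrightarrow> m \<le> ennreal C0 * gen_inverse \<Phi> (ennreal u) \<Longrightarrow> T \<le> ennreal C1 * gen_inverse \<Psi> (ennreal u)"
  shows "\<Psi> (T / ennreal C1) \<le> \<Phi> (m / ennreal C0)"
proof (rule dense_ge)
  fix u assume u: "\<Phi> (m / ennreal C0) < u"
  show "\<Psi> (T / ennreal C1) \<le> u"
  proof (cases u)
    case (real v)
    then have v: "v > 0"
      using u by (cases "v = 0") auto
    have "m / ennreal C0 \<le> gen_inverse \<Phi> u"
      using u real by (intro gen_inverse_ge[OF \<Phi>]) auto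
    then have "T \<le> ennreal C1 * gen_inverse \<Psi> (ennreal v)"
      using C(1) real by (intro key[OF v]) (simp add: ennreal_le_mult_iff)
    then have "T / ennreal C1 \<le> gen_inverse \<Psi> u"
      using C(2) real by (simp add: ennreal_le_mult_iff)
    then have "\<Psi> (T / ennreal C1) \<le> \<Psi> (gen_inverse \<Psi> u)"
      by (rule Phi_bar_monoD[OF \<Psi>])
    also have "\<dots> \<le> u"
      using real by (intro Phi_gen_inverse_le[OF \<Psi>]) simp
    finally show ?thesis .
  qed simp
qed

text \<open>Replaces a possibly infinite value of \<Psi> by finite numbers strictly below it, at
  which the inverse estimates can be applied.\<close>

lemma mult_le_one_of_below:
  fixes a m :: ennreal
  assumes "\<And>u. u > 0 \<Longrightarrow> ennreal u < a \<Longrightarrow> ennreal u * m \<le> 1"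
  shows "a * m \<le> 1"
proof (cases "a = 0")
  case False
  have "a * m = (SUP u\<in>{..<a}. u) * m"
    by simp
  also have "\<dots> = (SUP u\<in>{..<a}. u * m)"
    by (rule SUP_mult_right_ennreal)
  also have "\<dots> \<le> 1"
  proof (rule SUP_least)
    fix u assume u: "u \<in> {..<a}"
    then obtain v where "u = ennreal v" "v \<ge> 0"
      by (cases u) auto
    then show "u * m \<le> 1"
      using u assms[of v] by (cases "v = 0") auto
  qed
  finally show ?thesis .
qed simp

text \<open>If u < \<Psi>(t), then \<Psi>^-1(u) \<le> t, so T x > C1 t forces M f(x) > 2 E p with p
  = \<Phi>^-1(u). The weak-type bound for M f then finishes the proof.\<close>

lemma frac_integral_weak_type:
  fixes f :: "real ^ 'n \<Rightarrow> real"
  assumes \<Phi>: "\<Phi> \<in> Phi_bar" and D: "scaling \<Phi> D" and \<Psi>: "\<Psi> \<in> Phi_bar" and H: "H > 0" and C1: "C1 > 0"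
    and f: "f \<in> borel_measurable lebesgue" and tb: "tail_bound \<Phi> H f"
    and E_def: "E = 2 * H * (D * 5 ^ CARD('n))"
    and key: "\<And>x u. u > 0 \<Longrightarrow> maximal f x \<le> ennreal (2 * E) * gen_inverse \<Phi> (ennreal u) \<Longrightarrow>
      T x \<le> ennreal C1 * gen_inverse \<Psi> (ennreal u)"
  shows "\<Psi> (ennreal t) * emeasure lebesgue {x. ennreal (C1 * t) < T x} \<le> 1"
proof (rule mult_le_one_of_below)
  fix u assume u: "u > 0" "ennreal u < \<Psi> (ennreal t)"
  have D1: "D \<ge> 1"
    using D by (simp add: scaling_def)
  have E: "E > 0"
    using H D1 by (simp add: E_def)
  obtain p where p: "gen_inverse \<Phi> (ennreal u) = ennreal p" "p > 0"
    using gen_inverse_pos[OF \<Phi>, of "ennreal u"] gen_inverse_finite[OF \<Phi>, of u] u(1)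
    by (cases "gen_inverse \<Phi> (ennreal u)") auto
  let ?M = "\<lambda>s. {x. ennreal s < maximal f x}"
  have sub: "{x. ennreal (C1 * t) < T x} \<subseteq> ?M (2 * E * p)"
  proof clarify
    fix x assume x: "ennreal (C1 * t) < T x"
    show "ennreal (2 * E * p) < maximal f x"
    proof (rule ccontr)
      assume "\<not> ennreal (2 * E * p) < maximal f x"
      then have "maximal f x \<le> ennreal (2 * E) * gen_inverse \<Phi> (ennreal u)"
        using E p by (simp add: ennreal_mult[symmetric] not_less)
      then have "T x \<le> ennreal C1 * gen_inverse \<Psi> (ennreal u)"
        by (rule key[OF u(1)])
      also have "\<dots> \<le> ennreal C1 * ennreal t"
        by (intro mult_left_mono gen_inverse_le u(2)) simp
      finally show False
        using x C1 by (simp add: ennreal_mult'[symmetric] not_le[symmetric])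
    qed
  qed
  \<comment> \<open>At p itself only \<Phi>(p) \<le> u is known; any argument strictly above p has
    \<Phi> at least u, and 2 p is one.\<close>
  have "ennreal u \<le> \<Phi> (ennreal (2 * p))"
  proof (rule ccontr)
    assume "\<not> ennreal u \<le> \<Phi> (ennreal (2 * p))"
    then have "ennreal (2 * p) \<le> gen_inverse \<Phi> (ennreal u)"
      by (intro gen_inverse_ge[OF \<Phi>]) auto
    then show False
      using p by simp
  qed
  moreover have "emeasure lebesgue {x. ennreal (C1 * t) < T x} \<le> emeasure lebesgue (?M (2 * E * p))"
    using sub by (intro emeasure_mono) (auto simp: borel_open open_maximal_gt)
  ultimately have "ennreal u * emeasure lebesgue {x. ennreal (C1 * t) < T x} \<le>
      \<Phi> (ennreal (2 * p)) * emeasure lebesgue (?M (2 * E * p))"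
    by (intro mult_mono) auto
  also have "\<dots> \<le> 1"
  proof -
    \<comment> \<open>The covering constant 5^n is cancelled by moving a copy of it into \<Phi>,
      which explains the factor D 5^n in \<open>E\<close>.\<close>
    let ?c = "5 ^ CARD('n) :: real"
    have "ennreal ?c * (\<Phi> (ennreal (2 * p)) * emeasure lebesgue (?M (2 * E * p)))
        \<le> \<Phi> (ennreal (D * ?c) * ennreal (2 * p)) * emeasure lebesgue (?M (2 * E * p))"
      unfolding mult.assoc[symmetric] by (intro mult_right_mono scalingD[OF D]) auto
    also have "\<dots> = \<Phi> (ennreal (D * ?c * (2 * p))) * emeasure lebesgue (?M (2 * H * (D * ?c * (2 * p))))"
      using D1 p(2) by (simp add: ennreal_mult[symmetric] E_def mult_ac)
    also have "\<dots> \<le> 5 ^ CARD('n)"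
      using D1 p(2) by (intro tail_bound_maximal[OF f tb H]) auto
    also have "\<dots> = ennreal ?c * 1"
      using ennreal_power[of 5 "CARD('n)"] by simp
    finally show ?thesis
      by (subst (asm) ennreal_mult_le_mult_iff) auto
  qed
  finally show "ennreal u * emeasure lebesgue {x. ennreal (C1 * t) < T x} \<le> 1" .
qed

section \<open>Homogeneity, and norms as infima of admissible constants\<close>

lemma nn_integral_frac_integrand_scale:
  fixes f :: "real ^ 'n \<Rightarrow> real"
  assumes "\<rho> \<in> borel_measurable (lebesgue_on {0<..})" "f \<in> borel_measurable lebesgue" "l > 0"
  shows "(\<integral>\<^sup>+y. ennreal \<bar>frac_integrand \<rho> f x y\<bar> \<partial>lebesgue) =
    ennreal l * (\<integral>\<^sup>+y. ennreal \<bar>frac_integrand \<rho> (\<lambda>y. f y / l) x y\<bar> \<partial>lebesgue)"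
proof -
  have "(\<lambda>y. f y / l) \<in> borel_measurable lebesgue"
    using assms(2) by measurable
  from frac_integrand_measurable[OF assms(1) this]
  have [measurable]: "frac_integrand \<rho> (\<lambda>y. f y / l) x \<in> borel_measurable lebesgue" .
  have "\<bar>frac_integrand \<rho> f x y\<bar> = l * \<bar>frac_integrand \<rho> (\<lambda>y. f y / l) x y\<bar>" for y
    using assms(3) by (simp add: frac_integrand_def abs_mult)
  then show ?thesis
    using assms(3) by (simp add: ennreal_mult nn_integral_cmult)
qed

lemma frac_int_scale:
  fixes f :: "real ^ 'n \<Rightarrow> real"
  shows "frac_int \<rho> (\<lambda>y. f y / l) x = frac_int \<rho> f x / l"
proof -
  have "frac_integrand \<rho> (\<lambda>y. f y / l) x = (\<lambda>y. frac_integrand \<rho> f x y / l)"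
    by (auto simp: frac_integrand_def)
  then show ?thesis
    by (simp add: frac_int_def)
qed

text \<open>Unlike \<open>abs_frac_int\<close>, the real-valued integral takes the default value 0
  where it diverges, so the bound is trivial there.\<close>

lemma abs_frac_int_real_le:
  fixes f :: "real ^ 'n \<Rightarrow> real"
  shows "ennreal \<bar>frac_int \<rho> f x\<bar> \<le> (\<integral>\<^sup>+y. ennreal \<bar>frac_integrand \<rho> f x y\<bar> \<partial>lebesgue)"
proof (cases "integrable lebesgue (frac_integrand \<rho> f x)")
  case True
  then show ?thesis
    using integral_norm_bound_ennreal[OF True] by (simp add: frac_int_def)
qed (simp add: frac_int_def not_integrable_integral_eq)

text \<open>If the infimum were 0, fix s with \<Phi>(s) > 1: the tail bound for f / l and
  Chebyshev's inequality give e |{|f| > e}| \<le> H s l once e \<ge> H s l, and letting l tend to 0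
  makes f vanish almost everywhere. A positive infimum leaves an admissible l below its double. Only
  tail bounds enter, so both norms are covered.\<close>

lemma Inf_admissible:
  fixes f :: "real ^ 'n \<Rightarrow> real"
  assumes \<Phi>: "\<Phi> \<in> Phi_bar" and H: "H > 0" and f[measurable]: "f \<in> borel_measurable lebesgue"
    and nz: "\<not> (AE x in lebesgue. f x = 0)"
    and S: "\<And>l. l \<in> S \<Longrightarrow> l > 0" "\<And>l. l \<in> S \<Longrightarrow> tail_bound \<Phi> H (\<lambda>x. f x / l)"
    and fin: "Inf (ennreal ` S) < \<infinity>"
  obtains \<nu> l where "Inf (ennreal ` S) = ennreal \<nu>" "\<nu> > 0" "l \<in> S" "\<nu> \<le> l" "l \<le> 2 * \<nu>"
proof -
  obtain s where s: "s > 0" "ennreal 1 < \<Phi> (ennreal s)"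
    using Phi_bar_unbounded[OF \<Phi>] .
  have Hs: "H * s > 0"
    using H s by simp
  have small: "ennreal e * emeasure lebesgue {x. e < \<bar>f x\<bar>} \<le> ennreal (H * s * l)"
    if l: "l \<in> S" and e: "H * s * l \<le> e" for l e
  proof -
    have l0: "l > 0"
      using l by (rule S(1))
    let ?X = "\<integral>\<^sup>+y\<in>{y. \<bar>f y / l\<bar> > H * s}. ennreal \<bar>f y / l\<bar> \<partial>lebesgue"
    have "1 * ?X \<le> \<Phi> (ennreal s) * ?X"
      using s by (intro mult_right_mono) auto
    also have "\<dots> \<le> ennreal (H * s)"
      by (rule tail_boundD[OF S(2)[OF l] s(1)])
    finally have X: "?X \<le> ennreal (H * s)"
      by simp
    have "ennreal e * emeasure lebesgue {x. e < \<bar>f x\<bar>} = (\<integral>\<^sup>+x. ennreal e * indicator {x. e < \<bar>f x\<bar>} x \<partial>lebesgue)"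
      by (simp add: nn_integral_cmult_indicator level_sets)
    also have "\<dots> \<le> (\<integral>\<^sup>+y. ennreal l * (ennreal \<bar>f y / l\<bar> * indicator {y. \<bar>f y / l\<bar> > H * s} y) \<partial>lebesgue)"
    proof (rule nn_integral_mono)
      fix y
      show "ennreal e * indicator {x. e < \<bar>f x\<bar>} y \<le>
          ennreal l * (ennreal \<bar>f y / l\<bar> * indicator {y. \<bar>f y / l\<bar> > H * s} y)"
      proof (cases "e < \<bar>f y\<bar>")
        case True
        then have "H * s * l < \<bar>f y\<bar>"
          using e by simp
        then have "H * s < \<bar>f y / l\<bar>"
          using l0 by (simp add: field_simps)
        moreover have "l * \<bar>f y / l\<bar> = \<bar>f y\<bar>"
          using l0 by simp
        ultimately show ?thesis
          using True l0 by (simp add: ennreal_mult[symmetric] ennreal_leI)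
      qed simp
    qed
    also have "\<dots> = ennreal l * ?X"
      by (rule nn_integral_cmult) measurable
    also have "\<dots> \<le> ennreal l * ennreal (H * s)"
      using X by (rule mult_left_mono) simp
    also have "\<dots> = ennreal (H * s * l)"
      using l0 Hs by (simp add: ennreal_mult[symmetric] mult.commute)
    finally show ?thesis .
  qed
  obtain \<nu> where \<nu>: "Inf (ennreal ` S) = ennreal \<nu>" "\<nu> \<ge> 0"
    using fin by (cases "Inf (ennreal ` S)") auto
  have pick: "\<exists>l\<in>S. l < d" if "\<nu> < d" for d
  proof -
    have "Inf (ennreal ` S) < ennreal d"
      using that \<nu> by (simp add: ennreal_lessI)
    then show ?thesis
      unfolding Inf_less_iff using that \<nu>(2) S(1) by (auto simp: ennreal_less_iff less_imp_le)
  qed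
  have "\<nu> > 0"
  proof (rule ccontr)
    assume "\<not> \<nu> > 0"
    then have \<nu>0: "\<nu> = 0"
      using \<nu>(2) by simp
    have null: "{x. e < \<bar>f x\<bar>} \<in> null_sets lebesgue" if e: "e > 0" for e
    proof -
      have eps: "ennreal e * emeasure lebesgue {x. e < \<bar>f x\<bar>} \<le> 0 + ennreal d" if d: "d > 0" for d
      proof -
        \<comment> \<open>Being below \<open>d\<close> gives the desired bound, being below
          \<open>e\<close> the premise of \<open>small\<close>.\<close>
        have "\<nu> < min d e / (H * s)"
          using d e Hs \<nu>0 by simp
        then obtain l where l: "l \<in> S" "l < min d e / (H * s)"
          using pick by blast
        have "l * (H * s) < min d e"
          using l(2) Hs by (simp only: pos_less_divide_eq)
        then have le: "H * s * l \<le> min d e"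
          by (simp only: mult.commute less_imp_le)
        have "ennreal e * emeasure lebesgue {x. e < \<bar>f x\<bar>} \<le> ennreal (H * s * l)"
          using le by (intro small[OF l(1)]) simp
        also have "\<dots> \<le> ennreal d"
          using le by (intro ennreal_leI) simp
        finally show ?thesis
          by simp
      qed
      have "ennreal e * emeasure lebesgue {x. e < \<bar>f x\<bar>} \<le> 0"
        by (rule ennreal_le_epsilon) (erule eps)
      then have "emeasure lebesgue {x. e < \<bar>f x\<bar>} = 0"
        using e by simp
      then show ?thesis
        using level_sets[OF f, of e] by blast
    qed
    have "(\<Union>i::nat. {x. inverse (real (Suc i)) < \<bar>f x\<bar>}) \<in> null_sets lebesgue"
      by (intro null_sets_UN null) simp
    from AE_not_in[OF this] have "AE x in lebesgue. f x = 0"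
    proof eventually_elim
      case (elim x)
      show ?case
      proof (rule ccontr)
        assume "f x \<noteq> 0"
        then obtain i where "inverse (real (Suc i)) < \<bar>f x\<bar>"
          using reals_Archimedean[of "\<bar>f x\<bar>"] by auto
        then show False
          using elim by auto
      qed
    qed
    then show False
      using nz by simp
  qed
  moreover obtain l where l: "l \<in> S" "l < 2 * \<nu>"
    using pick[of "2 * \<nu>"] \<open>\<nu> > 0\<close> by auto
  moreover have "\<nu> \<le> l"
    using Inf_lower[of "ennreal l" "ennreal ` S"] l(1) S(1)[OF l(1)] \<nu>(1) by simp
  ultimately show ?thesis
    using that[of \<nu> l] \<nu>(1) by simp
qed

text \<open>It suffices that l admissible for f makes C l admissible for the image; taking the
  infimum over l then needs no minimiser and includes functions of norm 0. The abstract
  \<open>pX\<close> and \<open>pY\<close> serve every pairing of strong and weak norms.\<close>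

lemma frac_int_boundedI:
  fixes pX pY :: "(real ^ 'n \<Rightarrow> real) \<Rightarrow> real \<Rightarrow> bool"
  assumes \<rho>: "\<rho> \<in> borel_measurable (lebesgue_on {0<..})" and C: "C > 0"
    and X: "X = {f \<in> borel_measurable lebesgue. normX f < \<infinity>}" "\<And>f. normX f = Inf (ennreal ` {l. l > 0 \<and> pX f l})"
    and Y: "Y = {f \<in> borel_measurable lebesgue. normY f < \<infinity>}" "\<And>f. normY f = Inf (ennreal ` {l. l > 0 \<and> pY f l})"
    and int: "\<And>f l. f \<in> borel_measurable lebesgue \<Longrightarrow> l > 0 \<Longrightarrow> pX f l \<Longrightarrow>
      AE x in lebesgue. integrable lebesgue (frac_integrand \<rho> f x)"
    and le: "\<And>f l. f \<in> borel_measurable lebesgue \<Longrightarrow> l > 0 \<Longrightarrow> pX f l \<Longrightarrow> pY (frac_int \<rho> f) (C * l)"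
  shows "frac_int_bounded \<rho> X normX Y normY"
  unfolding frac_int_bounded_def
proof (intro exI[of _ C] conjI ballI)
  show "C > 0"
    by (rule C)
  fix f assume "f \<in> X"
  then have f: "f \<in> borel_measurable lebesgue" "normX f < \<infinity>"
    by (auto simp: X(1))
  then obtain l where "l > 0" "pX f l"
    unfolding X(2) Inf_less_iff by auto
  then show "AE x in lebesgue. integrable lebesgue (frac_integrand \<rho> f x)"
    using f(1) int by blast
  show norm: "normY (frac_int \<rho> f) \<le> ennreal C * normX f"
    unfolding X(2)
  proof (rule le_mult_Inf_ennreal[OF C])
    fix y assume "y \<in> ennreal ` {l. l > 0 \<and> pX f l}"
    then obtain l where l: "y = ennreal l" "l > 0" "pX f l"
      by auto
    have "normY (frac_int \<rho> f) \<le> ennreal (C * l)"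
      unfolding Y(2) using le[OF f(1) l(2,3)] C l(2) by (intro Inf_lower) auto
    then show "normY (frac_int \<rho> f) \<le> ennreal C * y"
      using C l by (simp add: ennreal_mult)
  qed
  have "normY (frac_int \<rho> f) < \<infinity>"
    using f(2) by (intro order_le_less_trans[OF norm]) (simp add: ennreal_mult_less_top)
  then show "frac_int \<rho> f \<in> Y"
    using frac_int_measurable[OF \<rho> f(1)] by (simp add: Y(1))
qed

subsection \<open>Necessary conditions\<close>

text \<open>The radius is doubled because B(x, r) is contained in B(0, 2r) for x in B(0, r). On B(x,
  r) the kernel is radial, and the Jacobian t^(n-1) reduces 1/t^n to 1/t.\<close>

lemma frac_int_indicator_lower:
  fixes x :: "real ^ 'n"
  assumes \<rho>: "\<rho> \<in> borel_measurable (lebesgue_on {0<..})" and \<rho>_pos: "\<And>t. t > 0 \<Longrightarrow> \<rho> t > 0"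
    and x: "x \<in> ball 0 r"
    and int: "integrable lebesgue (frac_integrand \<rho> (indicator (ball 0 (2 * r))) x)"
  shows "ennreal (CARD('n) * unit_ball_vol CARD('n)) * rho_int \<rho> 0 r \<le>
    ennreal (frac_int \<rho> (indicator (ball 0 (2 * r))) x)"
proof -
  define \<rho>' where "\<rho>' t = (if t \<in> {0<..} then \<rho> t else 0)" for t
  have [measurable]: "\<rho>' \<in> borel_measurable lebesgue"
    unfolding \<rho>'_def by (rule rho_ext_measurable[OF \<rho>])
  have [measurable]: "(\<lambda>t. t) \<in> borel_measurable (lebesgue :: real measure)"
    by (rule measurable_completion) simp
  let ?f = "indicator (ball 0 (2 * r)) :: real ^ 'n \<Rightarrow> real"
  define g where "g t = ennreal (\<rho>' t / t ^ CARD('n)) * indicator {..<r} t" for t :: real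
  have g: "g \<in> borel_measurable lebesgue"
    unfolding g_def by measurable
  have nonneg: "0 \<le> frac_integrand \<rho> ?f x y" for y
    using \<rho>_pos[of "norm (x - y)"] by (cases "x = y") (auto simp: frac_integrand_def power_0_left)
  have "rho_int \<rho> 0 r = (\<integral>\<^sup>+t. ennreal (\<rho>' t / t) * indicator {0<..<r} t \<partial>lebesgue)"
    unfolding rho_int_def by (intro nn_integral_cong) (auto simp: \<rho>'_def split: split_indicator)
  then have "ennreal (CARD('n) * unit_ball_vol CARD('n)) * rho_int \<rho> 0 r =
      (\<integral>\<^sup>+t. ennreal (CARD('n) * unit_ball_vol CARD('n)) * (ennreal (\<rho>' t / t) * indicator {0<..<r} t) \<partial>lebesgue)"
    by (simp add: nn_integral_cmult)
  also have "\<dots> = (\<integral>\<^sup>+t\<in>{0<..}. g t * ennreal (unit_ball_vol CARD('n) * (CARD('n) * t ^ (CARD('n) - 1))) \<partial>lebesgue)"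
  proof (rule nn_integral_cong)
    fix t :: real
    show "ennreal (CARD('n) * unit_ball_vol CARD('n)) * (ennreal (\<rho>' t / t) * indicator {0<..<r} t) =
        g t * ennreal (unit_ball_vol CARD('n) * (CARD('n) * t ^ (CARD('n) - 1))) * indicator {0<..} t"
    proof (cases "t > 0 \<and> t < r")
      case True
      have "t ^ CARD('n) = t * t ^ (CARD('n) - 1)"
        by (simp add: power_eq_if)
      then have "CARD('n) * unit_ball_vol CARD('n) * (\<rho>' t / t) =
          \<rho>' t / t ^ CARD('n) * (unit_ball_vol CARD('n) * (CARD('n) * t ^ (CARD('n) - 1)))"
        using True by simp
      moreover have "\<rho>' t > 0"
        using True \<rho>_pos by (simp add: \<rho>'_def)
      ultimately show ?thesis
        using True by (simp add: g_def ennreal_mult[symmetric])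
    qed (auto simp: g_def)
  qed
  also have "\<dots> = (\<integral>\<^sup>+y. g (norm (x - y)) \<partial>lebesgue)"
    by (rule nn_integral_norm[OF g, symmetric])
  also have "\<dots> \<le> (\<integral>\<^sup>+y. ennreal (frac_integrand \<rho> ?f x y) \<partial>lebesgue)"
  proof (rule nn_integral_mono)
    fix y
    show "g (norm (x - y)) \<le> ennreal (frac_integrand \<rho> ?f x y)"
    proof (cases "x \<noteq> y \<and> norm (x - y) < r")
      case True
      have "norm y \<le> norm x + norm (x - y)"
        using norm_triangle_ineq4[of x "x - y"] by simp
      then have "y \<in> ball 0 (2 * r)"
        using True x by simp
      then show ?thesis
        using True by (simp add: g_def frac_integrand_def \<rho>'_def)
    next
      case False
      then show ?thesis
        by (auto simp: g_def \<rho>'_def)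
    qed
  qed
  also have "\<dots> = ennreal (frac_int \<rho> ?f x)"
    unfolding frac_int_def using nonneg by (intro nn_integral_eq_integral[OF int]) simp
  finally show ?thesis .
qed

text \<open>1/q is admissible because \<open>Phi_gen_inverse_le\<close> gives \<Phi>(q) b \<le>
  1.\<close>

lemma orlicz_norm_indicator_ball:
  assumes \<Phi>: "\<Phi> \<in> Phi_bar" and r: "r > 0" and b_def: "b = unit_ball_vol CARD('n) * r ^ CARD('n)"
    and q: "gen_inverse \<Phi> (ennreal (1 / b)) = ennreal q" "q > 0"
  shows "orlicz_norm \<Phi> (indicator (ball (0 :: real ^ 'n) r)) \<le> ennreal (1 / q)"
proof -
  have b: "b > 0" "emeasure lebesgue (ball (0 :: real ^ 'n) r) = ennreal b"
    using r emeasure_lebesgue_ball[of r "0 :: real ^ 'n"] by (auto simp: b_def)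
  have "(\<integral>\<^sup>+x. \<Phi> (ennreal (\<bar>indicator (ball (0 :: real ^ 'n) r) x\<bar> / (1 / q))) \<partial>lebesgue)
      = (\<integral>\<^sup>+x. \<Phi> (ennreal q) * indicator (ball (0 :: real ^ 'n) r) x \<partial>lebesgue)"
    by (intro nn_integral_cong) (auto simp: Phi_bar_zero[OF \<Phi>] split: split_indicator)
  also have "\<dots> = \<Phi> (ennreal q) * ennreal b"
    unfolding b(2)[symmetric] by (rule nn_integral_cmult_indicator) simp
  also have "\<dots> \<le> ennreal (1 / b) * ennreal b"
    unfolding q(1)[symmetric] by (intro mult_right_mono Phi_gen_inverse_le[OF \<Phi>]) auto
  also have "\<dots> = 1"
    using b(1) by (simp add: ennreal_mult[symmetric])
  finally show ?thesis
    unfolding orlicz_norm_def using q(2) by (intro Inf_lower) auto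
qed

lemma gen_inverse_real:
  assumes "\<Phi> \<in> Phi_bar" "u > 0"
  obtains q where "gen_inverse \<Phi> (ennreal u) = ennreal q" "q > 0"
  using gen_inverse_pos[OF assms(1), of "ennreal u"] gen_inverse_finite[OF assms(1), of u] assms(2)
  by (cases "gen_inverse \<Phi> (ennreal u)") auto

text \<open>Test functions produce inverses at reciprocal ball volumes, with radius 2r on the left
  and r on the right; \<open>gen_inverse_scale\<close> brings both to 1/r^n, at the cost of
  \<open>c\<close> and \<open>c'\<close>.\<close>

lemma necessity_rescale:
  fixes \<rho> :: "real \<Rightarrow> real"
  assumes D: "scaling \<Phi> D" "scaling \<Psi> D'" and C: "C > 0" and w: "w > 0" and n: "n > 0"
    and le: "\<And>r. r > 0 \<Longrightarrow> ennreal (real n * w) * rho_int \<rho> 0 r * gen_inverse \<Phi> (ennreal (1 / (w * (2 * r) ^ n)))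
      \<le> ennreal C * gen_inverse \<Psi> (ennreal (1 / (w * r ^ n)))"
  shows "\<exists>A'>0. \<forall>r>0. rho_int \<rho> 0 r * gen_inverse \<Phi> (ennreal (1 / r ^ n)) \<le> ennreal A' * gen_inverse \<Psi> (ennreal (1 / r ^ n))"
proof -
  define c where "c = max 1 (w * 2 ^ n) * D"
  define c' where "c' = max 1 (1 / w) * D'"
  have D1: "D \<ge> 1" "D' \<ge> 1"
    using D by (auto simp: scaling_def)
  have c: "c > 0" "c' > 0"
    using D1 by (auto simp: c_def c'_def)
  define A' where "A' = c * C * c' / (real n * w)"
  have A': "A' > 0"
    using c C n w by (simp add: A'_def)
  have "rho_int \<rho> 0 r * gen_inverse \<Phi> (ennreal (1 / r ^ n)) \<le> ennreal A' * gen_inverse \<Psi> (ennreal (1 / r ^ n))"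
    if r: "r > 0" for r
  proof -
    let ?I = "rho_int \<rho> 0 r"
    have eq: "1 / r ^ n = (w * 2 ^ n) * (1 / (w * (2 * r) ^ n))"
      using r w by (simp add: power_mult_distrib)
    have 1: "gen_inverse \<Phi> (ennreal (1 / r ^ n)) \<le> ennreal c * gen_inverse \<Phi> (ennreal (1 / (w * (2 * r) ^ n)))"
      unfolding c_def eq using r w by (intro gen_inverse_scale[OF D(1)]) auto
    have "1 / (w * r ^ n) = (1 / w) * (1 / r ^ n)"
      by simp
    then have 2: "gen_inverse \<Psi> (ennreal (1 / (w * r ^ n))) \<le> ennreal c' * gen_inverse \<Psi> (ennreal (1 / r ^ n))"
      unfolding c'_def using r w gen_inverse_scale[OF D(2), of "1 / w" "1 / r ^ n"] by simp
    have nw: "ennreal (1 / (real n * w)) * ennreal (real n * w) = 1"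
      using n w by (simp add: ennreal_mult[symmetric])
    have "?I * gen_inverse \<Phi> (ennreal (1 / r ^ n)) \<le> ?I * (ennreal c * gen_inverse \<Phi> (ennreal (1 / (w * (2 * r) ^ n))))"
      using 1 by (rule mult_left_mono) simp
    also have "\<dots> = (ennreal (1 / (real n * w)) * ennreal (real n * w)) * (?I * (ennreal c * gen_inverse \<Phi> (ennreal (1 / (w * (2 * r) ^ n)))))"
      unfolding nw by simp
    also have "\<dots> = ennreal (1 / (real n * w)) * (ennreal c *
        (ennreal (real n * w) * ?I * gen_inverse \<Phi> (ennreal (1 / (w * (2 * r) ^ n)))))"
      by (simp only: mult_ac)
    also have "\<dots> \<le> ennreal (1 / (real n * w)) * (ennreal c * (ennreal C * (ennreal c' * gen_inverse \<Psi> (ennreal (1 / r ^ n)))))"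
      by (intro mult_left_mono order_trans[OF le[OF r]] 2) auto
    also have "\<dots> = ennreal A' * gen_inverse \<Psi> (ennreal (1 / r ^ n))"
    proof -
      have eq: "A' = 1 / (real n * w) * (c * (C * c'))"
        by (simp add: A'_def)
      have "ennreal A' = ennreal (1 / (real n * w)) * ennreal (c * (C * c'))"
        unfolding eq using c C n w by (intro ennreal_mult) auto
      also have "ennreal (c * (C * c')) = ennreal c * (ennreal C * ennreal c')"
        using c C by (simp add: ennreal_mult)
      finally have "ennreal A' = ennreal (1 / (real n * w)) * (ennreal c * (ennreal C * ennreal c'))" .
      then show ?thesis
        by (simp only: mult.assoc)
    qed
    finally show ?thesis .
  qed
  then show ?thesis
    using A' by blast
qed

context
  fixes \<Psi> :: "ennreal \<Rightarrow> ennreal" and \<rho> :: "real \<Rightarrow> real" and r b :: real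
  assumes \<Psi>: "\<Psi> \<in> Phi_bar"
    and \<rho>: "\<rho> \<in> borel_measurable (lebesgue_on {0<..})" and \<rho>_pos: "\<And>t. t > 0 \<Longrightarrow> \<rho> t > 0"
    and r: "r > 0" and b_def: "b = unit_ball_vol CARD('n::finite) * r ^ CARD('n)"
begin

abbreviation (input) test_fun :: "real ^ 'n \<Rightarrow> real" where
  "test_fun \<equiv> indicator (ball 0 (2 * r))"

lemma ball_volume: "b > 0" "emeasure lebesgue (ball (0 :: real ^ 'n) r) = ennreal b"
  using r emeasure_lebesgue_ball[of r "0 :: real ^ 'n"] by (auto simp: b_def)

lemma frac_int_test_fun:
  assumes "AE x in lebesgue. integrable lebesgue (frac_integrand \<rho> test_fun x)"
  shows "AE x in lebesgue. x \<in> ball 0 r \<longrightarrow>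
    ennreal (CARD('n) * unit_ball_vol CARD('n)) * rho_int \<rho> 0 r \<le> ennreal \<bar>frac_int \<rho> test_fun x\<bar>"
  using assms
proof eventually_elim
  case (elim x)
  show ?case
    using frac_int_indicator_lower[OF \<rho> \<rho>_pos _ elim] by (auto intro: order_trans ennreal_leI)
qed

text \<open>Take l < L admissible. For every t below the lower bound of |F|/l, almost all of the
  ball lies in {|F|/l > t}, so \<Psi>(t) b \<le> 1 and t \<le> \<Psi>^-1(1/b). The strict premise on
  \<open>L\<close> is what provides l when the infimum is not attained.\<close>

lemma weak_norm_lower:
  assumes int: "AE x in lebesgue. integrable lebesgue (frac_integrand \<rho> test_fun x)"
    and le: "weak_orlicz_norm \<Psi> (frac_int \<rho> test_fun) < ennreal L"
  shows "ennreal (CARD('n) * unit_ball_vol CARD('n)) * rho_int \<rho> 0 r \<le> ennreal L * gen_inverse \<Psi> (ennreal (1 / b))"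
    (is "?v \<le> _")
proof -
  let ?F = "frac_int \<rho> test_fun"
  have F: "?F \<in> borel_measurable lebesgue"
    by (intro frac_int_measurable[OF \<rho>] borel_measurable_indicator) simp
  obtain l where l: "l > 0" "ennreal l < ennreal L"
    and adm: "(SUP t\<in>{0<..}. \<Psi> (ennreal t) * distr_fun (\<lambda>x. ?F x / l) t) \<le> 1"
    using le unfolding weak_orlicz_norm_def Inf_less_iff by auto
  have "?v / ennreal l \<le> gen_inverse \<Psi> (ennreal (1 / b))"
  proof (rule dense_le)
    fix t assume t: "t < ?v / ennreal l"
    show "t \<le> gen_inverse \<Psi> (ennreal (1 / b))"
    proof (cases "t = 0")
      case False
      then obtain s where s: "t = ennreal s" "s > 0"
        using t by (cases t) auto
      have "emeasure lebesgue (ball (0 :: real ^ 'n) r) \<le> emeasure lebesgue {x. s < \<bar>?F x / l\<bar>}"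
      proof (rule emeasure_mono_AE)
        show "AE x in lebesgue. x \<in> ball 0 r \<longrightarrow> x \<in> {x. s < \<bar>?F x / l\<bar>}"
          using frac_int_test_fun[OF int]
        proof eventually_elim
          case (elim x)
          show ?case
          proof
            assume "x \<in> ball 0 r"
            then have "t < ennreal \<bar>?F x\<bar> / ennreal l"
              using elim by (intro order_less_le_trans[OF t] divide_right_mono_ennreal) blast
            then show "x \<in> {x. s < \<bar>?F x / l\<bar>}"
              using s l(1) by (simp add: divide_ennreal ennreal_less_iff)
          qed
        qed
        show "{x. s < \<bar>?F x / l\<bar>} \<in> sets lebesgue"
          using F by (intro level_sets borel_measurable_divide) simp_all
      qed
      then have "\<Psi> t * ennreal b \<le> \<Psi> t * distr_fun (\<lambda>x. ?F x / l) s"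
        unfolding ball_volume(2) distr_fun_def by (rule mult_left_mono) simp
      also have "\<dots> \<le> 1"
        using adm s by (simp add: SUP_le_iff)
      finally have "ennreal b * \<Psi> t \<le> ennreal b * ennreal (1 / b)"
        using ball_volume(1) by (simp add: ennreal_mult[symmetric] mult.commute)
      then have "\<Psi> t \<le> ennreal (1 / b)"
        using ball_volume(1) by (subst (asm) ennreal_mult_le_mult_iff) auto
      then show ?thesis
        by (intro gen_inverse_ge[OF \<Psi>]) auto
    qed simp
  qed
  then have "?v \<le> ennreal l * gen_inverse \<Psi> (ennreal (1 / b))"
    using l(1) by (simp add: ennreal_le_mult_iff)
  also have "\<dots> \<le> ennreal L * gen_inverse \<Psi> (ennreal (1 / b))"
    using l(2) by (intro mult_right_mono) auto
  finally show ?thesis .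
qed

text \<open>The ball B(0, r) is itself one of the competitors in the Morrey supremum, and the
  integral of |F| over it is at least the pointwise lower bound times b.\<close>

lemma morrey_norm_lower:
  assumes int: "AE x in lebesgue. integrable lebesgue (frac_integrand \<rho> test_fun x)"
    and le: "morrey_norm \<psi> (frac_int \<rho> test_fun) \<le> ennreal L" and \<psi>: "\<psi> r = ennreal p" "p > 0" and L: "L > 0"
  shows "ennreal (CARD('n) * unit_ball_vol CARD('n)) * rho_int \<rho> 0 r \<le> ennreal L * \<psi> r"
    (is "?v \<le> _")
proof -
  let ?F = "frac_int \<rho> test_fun"
  have "?v * ennreal b = (\<integral>\<^sup>+x. ?v * indicator (ball (0 :: real ^ 'n) r) x \<partial>lebesgue)"
    unfolding ball_volume(2)[symmetric] by (rule nn_integral_cmult_indicator[symmetric]) simp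
  also have "\<dots> \<le> (\<integral>\<^sup>+x\<in>ball 0 r. ennreal \<bar>?F x\<bar> \<partial>lebesgue)"
    by (intro nn_integral_mono_AE eventually_mono[OF frac_int_test_fun[OF int]]) (auto split: split_indicator)
  finally have "?v * ennreal b / (\<psi> r * ennreal b) \<le> (\<integral>\<^sup>+x\<in>ball 0 r. ennreal \<bar>?F x\<bar> \<partial>lebesgue) / (\<psi> r * emeasure lebesgue (ball (0 :: real ^ 'n) r))"
    unfolding ball_volume(2) by (rule divide_right_mono_ennreal)
  also have "\<dots> \<le> morrey_norm \<psi> ?F"
    unfolding morrey_norm_def using r by (intro SUP_upper2[of "(0, r)"]) auto
  also note le
  finally have "?v / ennreal p \<le> ennreal L"
    using ball_volume(1) by (simp add: divide_mult_eq \<psi>(1))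
  then have "?v \<le> ennreal p * ennreal L"
    using \<psi>(2) by (simp add: ennreal_le_mult_iff)
  then show ?thesis
    by (simp add: \<psi>(1) mult.commute)
qed

end

subsection \<open>The main result\<close>

lemma nabla2_barE:
  assumes "\<Phi> \<in> nabla2_bar"
  obtains k where "nabla2_const \<Phi> k"
  using assms by (auto simp: nabla2_bar_def nabla2_const_def)

lemma tail_bound_of_orlicz:
  fixes f :: "real ^ 'n \<Rightarrow> real"
  assumes "\<Phi> \<in> Phi_bar" "scaling \<Phi> D" "f \<in> borel_measurable lebesgue" "l > 0"
    and "(\<integral>\<^sup>+x. \<Phi> (ennreal (\<bar>f x\<bar> / l)) \<partial>lebesgue) \<le> 1"
  shows "tail_bound \<Phi> D (\<lambda>x. f x / l)"
  using assms by (intro tail_bound_of_modular borel_measurable_divide) auto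

lemma tail_bound_of_weak_orlicz:
  fixes f :: "real ^ 'n \<Rightarrow> real"
  assumes "nabla2_const \<Phi> k" "f \<in> borel_measurable lebesgue"
    and "(SUP t\<in>{0<..}. \<Phi> (ennreal t) * distr_fun (\<lambda>x. f x / l) t) \<le> 1"
  shows "tail_bound \<Phi> (2 * k) (\<lambda>x. f x / l)"
  using assms by (intro tail_bound_of_weak_modular borel_measurable_divide) (auto simp: SUP_le_iff distr_fun_def)

section \<open>Sufficiency: the pointwise inequality and the mapping properties\<close>

context
  fixes \<Phi> \<Psi> :: "ennreal \<Rightarrow> ennreal" and \<rho> :: "real \<Rightarrow> real" and A C D K1 K2 :: real
  assumes \<Phi>: "\<Phi> \<in> Phi_bar" and D: "scaling \<Phi> D" and \<Psi>: "\<Psi> \<in> Phi_bar"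
    and \<rho>: "\<rho> \<in> borel_measurable (lebesgue_on {0<..})" and \<rho>_pos: "\<And>t. t > 0 \<Longrightarrow> \<rho> t > 0"
    and K: "0 < K1" "K1 < K2" "0 < C"
    and sup: "\<And>u. u > 0 \<Longrightarrow> ennreal (\<rho> u) \<le> ennreal C * rho_int \<rho> (K1 * u) (K2 * u)"
    and A: "A > 0" "\<And>r. r > 0 \<Longrightarrow> rho_int \<rho> 0 r * gen_inverse \<Phi> (ennreal (1 / r ^ CARD('n::finite))) + rho_tail CARD('n) \<Phi> \<rho> r
           \<le> ennreal A * gen_inverse \<Psi> (ennreal (1 / r ^ CARD('n)))"
begin

text \<open>\<open>C1\<close> depends only on \<open>H\<close> and \<open>C0\<close>, which each
  application below chooses to suit its maximal inequality.\<close>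

lemma frac_integral_key:
  assumes "H > 0" "C0 > 0"
  obtains C1 where "C1 > 0"
    "\<And>(f :: real ^ 'n \<Rightarrow> real) x u. f \<in> borel_measurable lebesgue \<Longrightarrow> tail_bound \<Phi> H f \<Longrightarrow> u > 0 \<Longrightarrow>
      maximal f x \<le> ennreal C0 * gen_inverse \<Phi> (ennreal u) \<Longrightarrow>
      (\<integral>\<^sup>+y. ennreal \<bar>frac_integrand \<rho> f x y\<bar> \<partial>lebesgue) \<le> ennreal C1 * gen_inverse \<Psi> (ennreal u)"
proof -
  obtain B where B: "B > 0"
    "\<And>(f :: real ^ 'n \<Rightarrow> real) x r. f \<in> borel_measurable lebesgue \<Longrightarrow> tail_bound \<Phi> H f \<Longrightarrow> r > 0 \<Longrightarrow>
      (\<integral>\<^sup>+y. ennreal \<bar>frac_integrand \<rho> f x y\<bar> \<partial>lebesgue) \<le>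
      ennreal B * (rho_int \<rho> 0 r * maximal f x + rho_tail CARD('n) \<Phi> \<rho> r)"
    using frac_integral_le[OF \<Phi> D \<rho> \<rho>_pos K sup assms(1)] by blast
  show ?thesis
  proof (rule that[of "B * max 1 C0 * A"])
    show "B * max 1 C0 * A > 0"
      using B(1) A(1) by simp
  qed (rule frac_integral_le_gen_inverse[OF B(1) B(2) A assms(2)])
qed

text \<open>At r = 1 the right side of the assumed inequality is finite, hence so are both terms on
  the left; since \<Phi>^-1(1) > 0, the integral of \<rho>(t)/t over (0, 1) is finite as
  well.\<close>

lemma frac_integral_finite:
  fixes f :: "real ^ 'n \<Rightarrow> real"
  assumes "H > 0" "f \<in> borel_measurable lebesgue" "tail_bound \<Phi> H f" "maximal f x < \<infinity>"
  shows "(\<integral>\<^sup>+y. ennreal \<bar>frac_integrand \<rho> f x y\<bar> \<partial>lebesgue) < \<infinity>"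
proof -
  obtain B where B: "B > 0"
    "\<And>(f :: real ^ 'n \<Rightarrow> real) x r. f \<in> borel_measurable lebesgue \<Longrightarrow> tail_bound \<Phi> H f \<Longrightarrow> r > 0 \<Longrightarrow>
      (\<integral>\<^sup>+y. ennreal \<bar>frac_integrand \<rho> f x y\<bar> \<partial>lebesgue) \<le>
      ennreal B * (rho_int \<rho> 0 r * maximal f x + rho_tail CARD('n) \<Phi> \<rho> r)"
    using frac_integral_le[OF \<Phi> D \<rho> \<rho>_pos K sup assms(1)] by blast
  have "rho_int \<rho> 0 1 * gen_inverse \<Phi> (ennreal 1) + rho_tail CARD('n) \<Phi> \<rho> 1 \<le> ennreal A * gen_inverse \<Psi> (ennreal 1)"
    using A(2)[of 1] by simp
  also have "\<dots> < \<infinity>"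
    using gen_inverse_finite[OF \<Psi>, of 1] by (simp add: ennreal_mult_less_top)
  finally have fin: "rho_int \<rho> 0 1 * gen_inverse \<Phi> (ennreal 1) < \<infinity>" "rho_tail CARD('n) \<Phi> \<rho> 1 < \<infinity>"
    by auto
  have "gen_inverse \<Phi> (ennreal 1) > 0"
    by (rule gen_inverse_pos[OF \<Phi>]) simp
  then have "rho_int \<rho> 0 1 < \<infinity>"
    using fin(1) by (auto simp: ennreal_mult_less_top)
  then have "ennreal B * (rho_int \<rho> 0 1 * maximal f x + rho_tail CARD('n) \<Phi> \<rho> 1) < \<infinity>"
    using fin(2) assms(4) by (simp add: ennreal_mult_less_top)
  then show ?thesis
    by (rule order_le_less_trans[OF B(2)[OF assms(2,3), of 1, simplified]])
qed

lemma frac_integrand_integrable_AE: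
  fixes f :: "real ^ 'n \<Rightarrow> real"
  assumes H: "H > 0" and f: "f \<in> borel_measurable lebesgue" and l: "l > 0" and tb: "tail_bound \<Phi> H (\<lambda>x. f x / l)"
  shows "AE x in lebesgue. integrable lebesgue (frac_integrand \<rho> f x)"
proof -
  have g: "(\<lambda>x. f x / l) \<in> borel_measurable lebesgue"
    using f by measurable
  show ?thesis
    using tail_bound_maximal_finite[OF \<Phi> g tb H]
  proof eventually_elim
    case (elim x)
    have "(\<integral>\<^sup>+y. ennreal \<bar>frac_integrand \<rho> f x y\<bar> \<partial>lebesgue) < \<infinity>"
      using frac_integral_finite[OF H g tb elim]
      unfolding nn_integral_frac_integrand_scale[OF \<rho> f l] by (simp add: ennreal_mult_less_top)
    then show ?case
      using frac_integrand_measurable[OF \<rho> f] by (simp add: integrable_iff_bounded)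
  qed
qed

text \<open>Apply the normalised estimate to g = f / l with l admissible and between \<nu> and 2
  \<nu>, where \<nu> is the norm. From l \<le> 2 \<nu> comes the factor 2 in front of
  \<open>C1\<close>; from l \<ge> \<nu> comes M g \<le> M f / \<nu>.\<close>

lemma Orlicz_pointwise_norm:
  fixes pX :: "real \<Rightarrow> bool" and f :: "real ^ 'n \<Rightarrow> real"
  assumes H: "H > 0" and C: "C0 > 0" "C1 > 0"
    and key: "\<And>(f :: real ^ 'n \<Rightarrow> real) x u. f \<in> borel_measurable lebesgue \<Longrightarrow> tail_bound \<Phi> H f \<Longrightarrow> u > 0 \<Longrightarrow>
      maximal f x \<le> ennreal C0 * gen_inverse \<Phi> (ennreal u) \<Longrightarrow>
      (\<integral>\<^sup>+y. ennreal \<bar>frac_integrand \<rho> f x y\<bar> \<partial>lebesgue) \<le> ennreal C1 * gen_inverse \<Psi> (ennreal u)"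
    and f: "f \<in> borel_measurable lebesgue" "\<not> (AE x in lebesgue. f x = 0)"
    and tb: "\<And>l. l > 0 \<Longrightarrow> pX l \<Longrightarrow> tail_bound \<Phi> H (\<lambda>x. f x / l)"
    and N: "N = Inf (ennreal ` {l. l > 0 \<and> pX l})" "N < \<infinity>"
  shows "\<Psi> (abs_frac_int \<rho> f x / (ennreal (2 * C1) * N)) \<le> \<Phi> (maximal f x / (ennreal C0 * N))"
proof -
  let ?S = "{l. l > 0 \<and> pX l}"
  obtain \<nu> l where \<nu>: "Inf (ennreal ` ?S) = ennreal \<nu>" "\<nu> > 0" and l': "l \<in> ?S" "\<nu> \<le> l" "l \<le> 2 * \<nu>"
    by (rule Inf_admissible[OF \<Phi> H f, of ?S]) (use tb N in auto)
  note \<nu> = \<nu>[folded N(1)]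
  have l: "l > 0" "pX l" "\<nu> \<le> l" "l \<le> 2 * \<nu>"
    using l' by auto
  define g where "g y = f y / l" for y
  have g: "g \<in> borel_measurable lebesgue" "tail_bound \<Phi> H g"
    using f(1) tb[OF l(1,2)] unfolding g_def by measurable
  let ?T = "\<lambda>f. \<integral>\<^sup>+y. ennreal \<bar>frac_integrand \<rho> f x y\<bar> \<partial>lebesgue"
  have "abs_frac_int \<rho> f x \<le> ennreal l * ?T g"
    using abs_frac_int_le[OF \<rho> f(1), of x] unfolding g_def nn_integral_frac_integrand_scale[OF \<rho> f(1) l(1)] .
  also have "\<dots> \<le> ennreal (2 * \<nu>) * ?T g"
    using l(4) by (intro mult_right_mono ennreal_leI) auto
  also have "\<dots> = ennreal (2 * C1 * \<nu>) * (?T g / ennreal C1)"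
  proof -
    have "ennreal (2 * C1 * \<nu>) = ennreal (2 * \<nu>) * ennreal C1"
      using \<nu>(2) C(2) by (simp add: ennreal_mult[symmetric])
    then show ?thesis
      using C(2) by (simp only: mult.assoc ennreal_mult_divide_cancel)
  qed
  finally have "abs_frac_int \<rho> f x / ennreal (2 * C1 * \<nu>) \<le> ?T g / ennreal C1"
    using \<nu>(2) C(2) by (subst (asm) ennreal_le_mult_iff) auto
  then have "\<Psi> (abs_frac_int \<rho> f x / (ennreal (2 * C1) * N)) \<le> \<Psi> (?T g / ennreal C1)"
    using \<nu> C(2) by (intro Phi_bar_monoD[OF \<Psi>]) (simp add: ennreal_mult[symmetric])
  also have "\<dots> \<le> \<Phi> (maximal g x / ennreal C0)"
    by (rule Orlicz_pointwise[OF \<Phi> \<Psi> C key[OF g]])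
  also have "\<dots> \<le> \<Phi> (maximal f x / (ennreal C0 * N))"
  proof (rule Phi_bar_monoD[OF \<Phi>])
    have Mg: "maximal g x = maximal f x / ennreal l"
      unfolding g_def by (rule maximal_scale[OF f(1) l(1)])
    have "maximal g x / ennreal C0 = maximal f x * ennreal (inverse (l * C0))"
      using l(1) C(1)
      by (simp add: Mg divide_ennreal_def inverse_ennreal mult.assoc ennreal_mult[symmetric])
    also have "\<dots> \<le> maximal f x * ennreal (inverse (C0 * \<nu>))"
      using l(3) \<nu>(2) C(1) by (intro mult_left_mono ennreal_leI le_imp_inverse_le) (auto simp: mult.commute)
    also have "\<dots> = maximal f x / (ennreal C0 * N)"
      using \<nu> C(1) by (simp add: divide_ennreal_def inverse_ennreal ennreal_mult[symmetric])
    finally show "maximal g x / ennreal C0 \<le> maximal f x / (ennreal C0 * N)" .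
  qed
  finally show ?thesis .
qed

text \<open>Any source norm whose admissible constants give tail bounds is allowed, so the strong
  and the weak Orlicz space are treated at once. The choice C0 = 2 E is the one required by
  \<open>frac_integral_weak_type\<close>.\<close>

lemma frac_int_bounded_weak:
  fixes pX :: "(real ^ 'n \<Rightarrow> real) \<Rightarrow> real \<Rightarrow> bool"
  assumes H: "H > 0"
    and X: "X = {f \<in> borel_measurable lebesgue. normX f < \<infinity>}" "\<And>f. normX f = Inf (ennreal ` {l. l > 0 \<and> pX f l})"
    and tb: "\<And>f l. f \<in> borel_measurable lebesgue \<Longrightarrow> l > 0 \<Longrightarrow> pX f l \<Longrightarrow> tail_bound \<Phi> H (\<lambda>x. f x / l)"
  shows "frac_int_bounded \<rho> X normX (weak_orlicz_space \<Psi>) (weak_orlicz_norm \<Psi>)"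
proof -
  define E where "E = 2 * H * (D * 5 ^ CARD('n))"
  have "E > 0"
    using H D by (simp add: E_def scaling_def)
  then obtain C1 where C1: "C1 > 0"
    and key: "\<And>(f :: real ^ 'n \<Rightarrow> real) x u. f \<in> borel_measurable lebesgue \<Longrightarrow> tail_bound \<Phi> H f \<Longrightarrow> u > 0 \<Longrightarrow>
      maximal f x \<le> ennreal (2 * E) * gen_inverse \<Phi> (ennreal u) \<Longrightarrow>
      (\<integral>\<^sup>+y. ennreal \<bar>frac_integrand \<rho> f x y\<bar> \<partial>lebesgue) \<le> ennreal C1 * gen_inverse \<Psi> (ennreal u)"
    using frac_integral_key[OF H, of "2 * E"] by auto
  show ?thesis
  proof (rule frac_int_boundedI[OF \<rho> C1 X weak_orlicz_space_def weak_orlicz_norm_def])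
    fix f :: "real ^ 'n \<Rightarrow> real" and l
    assume f: "f \<in> borel_measurable lebesgue" and l: "l > 0" "pX f l"
    note tbf = tb[OF f l]
    show "AE x in lebesgue. integrable lebesgue (frac_integrand \<rho> f x)"
      by (rule frac_integrand_integrable_AE[OF H f l(1) tbf])
    show "(SUP t\<in>{0<..}. \<Psi> (ennreal t) * distr_fun (\<lambda>x. frac_int \<rho> f x / (C1 * l)) t) \<le> 1"
    proof (rule SUP_least)
      fix t :: real assume t: "t \<in> {0<..}"
      let ?g = "\<lambda>x. f x / l"
      have g: "?g \<in> borel_measurable lebesgue"
        using f by measurable
      have "{x. \<bar>frac_int \<rho> f x / (C1 * l)\<bar> > t} = {x. ennreal (C1 * t) < ennreal \<bar>frac_int \<rho> ?g x\<bar>}"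
        using C1 l(1) t by (auto simp: frac_int_scale ennreal_less_iff abs_mult field_simps)
      then have "\<Psi> (ennreal t) * distr_fun (\<lambda>x. frac_int \<rho> f x / (C1 * l)) t =
          \<Psi> (ennreal t) * emeasure lebesgue {x. ennreal (C1 * t) < ennreal \<bar>frac_int \<rho> ?g x\<bar>}"
        by (simp only: distr_fun_def)
      also have "\<dots> \<le> 1"
        by (rule frac_integral_weak_type[OF \<Phi> D \<Psi> H C1 g tbf E_def])
          (rule order_trans[OF abs_frac_int_real_le key[OF g tbf]])
      finally show "\<Psi> (ennreal t) * distr_fun (\<lambda>x. frac_int \<rho> f x / (C1 * l)) t \<le> 1" .
    qed
  qed
qed

text \<open>With C0 = 2 k E the modular of M g / C0 is at most 1 by
  \<open>maximal_strong_modular\<close>, and the pointwise inequality carries this over to the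
  fractional integral.\<close>

lemma frac_int_bounded_strong:
  assumes k: "nabla2_const \<Phi> k"
  shows "frac_int_bounded \<rho> (orlicz_space \<Phi> :: (real ^ 'n \<Rightarrow> real) set) (orlicz_norm \<Phi>)
    (orlicz_space \<Psi>) (orlicz_norm \<Psi>)"
proof -
  define E where "E = 2 * k * 5 ^ CARD('n) * D"
  have D1: "D > 0" and k1: "k > 1"
    using D k by (auto simp: scaling_def nabla2_const_def)
  then have kE: "2 * k * E > 0"
    by (simp add: E_def)
  obtain C1 where C1: "C1 > 0"
    and key: "\<And>(f :: real ^ 'n \<Rightarrow> real) x u. f \<in> borel_measurable lebesgue \<Longrightarrow> tail_bound \<Phi> D f \<Longrightarrow> u > 0 \<Longrightarrow>
      maximal f x \<le> ennreal (2 * k * E) * gen_inverse \<Phi> (ennreal u) \<Longrightarrow>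
      (\<integral>\<^sup>+y. ennreal \<bar>frac_integrand \<rho> f x y\<bar> \<partial>lebesgue) \<le> ennreal C1 * gen_inverse \<Psi> (ennreal u)"
    using frac_integral_key[OF D1 kE] by auto
  show ?thesis
  proof (rule frac_int_boundedI[OF \<rho> C1 orlicz_space_def orlicz_norm_def orlicz_space_def orlicz_norm_def])
    fix f :: "real ^ 'n \<Rightarrow> real" and l :: real
    assume f: "f \<in> borel_measurable lebesgue" and l: "l > 0"
      and adm: "(\<integral>\<^sup>+x. \<Phi> (ennreal (\<bar>f x\<bar> / l)) \<partial>lebesgue) \<le> 1"
    let ?g = "\<lambda>x. f x / l"
    have g: "?g \<in> borel_measurable lebesgue"
      using f by measurable
    note tb = tail_bound_of_orlicz[OF \<Phi> D f l adm]
    show "AE x in lebesgue. integrable lebesgue (frac_integrand \<rho> f x)"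
      by (rule frac_integrand_integrable_AE[OF D1 f l tb])
    have "(\<integral>\<^sup>+x. \<Psi> (ennreal (\<bar>frac_int \<rho> f x\<bar> / (C1 * l))) \<partial>lebesgue)
        \<le> (\<integral>\<^sup>+x. \<Phi> (maximal ?g x / ennreal (2 * k * E)) \<partial>lebesgue)"
    proof (rule nn_integral_mono)
      fix x
      have "ennreal (\<bar>frac_int \<rho> f x\<bar> / (C1 * l)) = ennreal \<bar>frac_int \<rho> ?g x\<bar> / ennreal C1"
        using C1 l by (simp add: frac_int_scale divide_ennreal mult.commute)
      also have "\<Psi> \<dots> \<le> \<Phi> (maximal ?g x / ennreal (2 * k * E))"
        by (rule Orlicz_pointwise[OF \<Phi> \<Psi> kE C1]) (rule order_trans[OF abs_frac_int_real_le key[OF g tb]])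
      finally show "\<Psi> (ennreal (\<bar>frac_int \<rho> f x\<bar> / (C1 * l))) \<le> \<Phi> (maximal ?g x / ennreal (2 * k * E))" .
    qed
    also have "\<dots> \<le> 1"
      using l adm by (intro maximal_strong_modular[OF \<Phi> D k g _ E_def]) simp
    finally show "(\<integral>\<^sup>+x. \<Psi> (ennreal (\<bar>frac_int \<rho> f x\<bar> / (C1 * l))) \<partial>lebesgue) \<le> 1" .
  qed
qed

lemma Orlicz_pointwise_norms:
  assumes C0: "C0 > 0"
  shows "\<exists>C1::real. C1 > 0 \<and>
    (\<forall>f :: real ^ 'n \<Rightarrow> real. f \<in> orlicz_space \<Phi> \<longrightarrow> \<not> (AE x in lebesgue. f x = 0) \<longrightarrow>
      (\<forall>x. \<Psi> (abs_frac_int \<rho> f x / (ennreal C1 * orlicz_norm \<Phi> f))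
         \<le> \<Phi> (maximal f x / (ennreal C0 * orlicz_norm \<Phi> f)))) \<and>
    (\<Phi> \<in> nabla2_bar \<longrightarrow>
      (\<forall>f :: real ^ 'n \<Rightarrow> real. f \<in> weak_orlicz_space \<Phi> \<longrightarrow> \<not> (AE x in lebesgue. f x = 0) \<longrightarrow>
        (\<forall>x. \<Psi> (abs_frac_int \<rho> f x / (ennreal C1 * weak_orlicz_norm \<Phi> f))
           \<le> \<Phi> (maximal f x / (ennreal C0 * weak_orlicz_norm \<Phi> f)))))"
proof -
  \<comment> \<open>The same \<open>C1\<close> must serve the strong and the weak inequality, so one
    \<open>H\<close> has to dominate both tail constants, \<open>D\<close> and 2 k.\<close>
  obtain H where H: "H > 0" "D \<le> H" "\<Phi> \<in> nabla2_bar \<Longrightarrow> \<exists>k. nabla2_const \<Phi> k \<and> 2 * k \<le> H"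
  proof (cases "\<Phi> \<in> nabla2_bar")
    case True
    then obtain k where "nabla2_const \<Phi> k"
      by (rule nabla2_barE)
    then show ?thesis
      using D by (intro that[of "max D (2 * k)"]) (auto simp: scaling_def)
  next
    case False
    then show ?thesis
      using D by (intro that[of D]) (auto simp: scaling_def)
  qed
  obtain C1 where C1: "C1 > 0"
    and key: "\<And>(f :: real ^ 'n \<Rightarrow> real) x u. f \<in> borel_measurable lebesgue \<Longrightarrow> tail_bound \<Phi> H f \<Longrightarrow> u > 0 \<Longrightarrow>
      maximal f x \<le> ennreal C0 * gen_inverse \<Phi> (ennreal u) \<Longrightarrow>
      (\<integral>\<^sup>+y. ennreal \<bar>frac_integrand \<rho> f x y\<bar> \<partial>lebesgue) \<le> ennreal C1 * gen_inverse \<Psi> (ennreal u)"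
    using frac_integral_key[OF H(1) C0] by auto
  show ?thesis
  proof (intro exI[of _ "2 * C1"] conjI allI impI)
    show "2 * C1 > 0"
      using C1 by simp
  next
    fix f :: "real ^ 'n \<Rightarrow> real" and x
    assume f: "f \<in> orlicz_space \<Phi>" "\<not> (AE x in lebesgue. f x = 0)"
    then have f': "f \<in> borel_measurable lebesgue" "orlicz_norm \<Phi> f < \<infinity>"
      by (auto simp: orlicz_space_def)
    show "\<Psi> (abs_frac_int \<rho> f x / (ennreal (2 * C1) * orlicz_norm \<Phi> f)) \<le> \<Phi> (maximal f x / (ennreal C0 * orlicz_norm \<Phi> f))"
      by (rule Orlicz_pointwise_norm[OF H(1) C0 C1 _ f'(1) f(2) _ orlicz_norm_def f'(2)], erule (3) key)
        (rule tail_bound_mono[OF tail_bound_of_orlicz[OF \<Phi> D f'(1)] H(2)])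
  next
    fix f :: "real ^ 'n \<Rightarrow> real" and x
    assume nabla: "\<Phi> \<in> nabla2_bar" and f: "f \<in> weak_orlicz_space \<Phi>" "\<not> (AE x in lebesgue. f x = 0)"
    then have f': "f \<in> borel_measurable lebesgue" "weak_orlicz_norm \<Phi> f < \<infinity>"
      by (auto simp: weak_orlicz_space_def)
    obtain k where k: "nabla2_const \<Phi> k" "2 * k \<le> H"
      using H(3)[OF nabla] by auto
    show "\<Psi> (abs_frac_int \<rho> f x / (ennreal (2 * C1) * weak_orlicz_norm \<Phi> f)) \<le> \<Phi> (maximal f x / (ennreal C0 * weak_orlicz_norm \<Phi> f))"
      by (rule Orlicz_pointwise_norm[OF H(1) C0 C1 _ f'(1) f(2) _ weak_orlicz_norm_def f'(2)], erule (3) key)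
        (rule tail_bound_mono[OF tail_bound_of_weak_orlicz[OF k(1) f'(1)] k(2)])
  qed
qed

lemma frac_int_bounded_orlicz_weak:
  "frac_int_bounded \<rho> (orlicz_space \<Phi> :: (real ^ 'n \<Rightarrow> real) set) (orlicz_norm \<Phi>)
    (weak_orlicz_space \<Psi>) (weak_orlicz_norm \<Psi>)"
proof -
  have "D > 0"
    using D by (simp add: scaling_def)
  then show ?thesis
    by (rule frac_int_bounded_weak[OF _ orlicz_space_def orlicz_norm_def tail_bound_of_orlicz[OF \<Phi> D]])
qed

lemma frac_int_bounded_weak_weak:
  assumes "nabla2_const \<Phi> k"
  shows "frac_int_bounded \<rho> (weak_orlicz_space \<Phi> :: (real ^ 'n \<Rightarrow> real) set) (weak_orlicz_norm \<Phi>)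
    (weak_orlicz_space \<Psi>) (weak_orlicz_norm \<Psi>)"
proof -
  have "2 * k > 0"
    using assms by (simp add: nabla2_const_def)
  then show ?thesis
    by (rule frac_int_bounded_weak[OF _ weak_orlicz_space_def weak_orlicz_norm_def])
      (rule tail_bound_of_weak_orlicz[OF assms])
qed

end

section \<open>Necessity, tested on indicators of balls\<close>

lemma frac_int_necessary_weak:
  assumes \<Phi>: "\<Phi> \<in> Phi_bar" and D: "scaling \<Phi> D" and \<Psi>: "\<Psi> \<in> Phi_bar" and D': "scaling \<Psi> D'"
    and \<rho>: "\<rho> \<in> borel_measurable (lebesgue_on {0<..})" and \<rho>_pos: "\<And>t. t > 0 \<Longrightarrow> \<rho> t > 0"
    and bdd: "frac_int_bounded \<rho> (orlicz_space \<Phi> :: (real ^ 'n \<Rightarrow> real) set) (orlicz_norm \<Phi>)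
      (weak_orlicz_space \<Psi>) (weak_orlicz_norm \<Psi>)"
  shows "\<exists>A'>0. \<forall>r>0. rho_int \<rho> 0 r * gen_inverse \<Phi> (ennreal (1 / r ^ CARD('n)))
    \<le> ennreal A' * gen_inverse \<Psi> (ennreal (1 / r ^ CARD('n)))"
proof -
  define w where "w = unit_ball_vol CARD('n)"
  have w: "w > 0"
    by (simp add: w_def)
  obtain C where C: "C > 0" and bdd: "\<And>f :: real ^ 'n \<Rightarrow> real. f \<in> orlicz_space \<Phi> \<Longrightarrow>
      (AE x in lebesgue. integrable lebesgue (frac_integrand \<rho> f x)) \<and>
      weak_orlicz_norm \<Psi> (frac_int \<rho> f) \<le> ennreal C * orlicz_norm \<Phi> f"
    using bdd unfolding frac_int_bounded_def by blast
  show ?thesis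
  proof (rule necessity_rescale[OF D D' _ w])
    show "2 * C > 0"
      using C by simp
    fix r :: real assume r: "r > 0"
    let ?f = "indicator (ball 0 (2 * r)) :: real ^ 'n \<Rightarrow> real"
    let ?v = "ennreal (CARD('n) * w) * rho_int \<rho> 0 r"
    obtain q where q: "gen_inverse \<Phi> (ennreal (1 / (w * (2 * r) ^ CARD('n)))) = ennreal q" "q > 0"
      using gen_inverse_real[OF \<Phi>, of "1 / (w * (2 * r) ^ CARD('n))"] r w by auto
    have norm: "orlicz_norm \<Phi> ?f \<le> ennreal (1 / q)"
      using r by (intro orlicz_norm_indicator_ball[OF \<Phi> _ refl q[unfolded w_def]]) simp
    then have f: "?f \<in> orlicz_space \<Phi>"
      by (auto simp: orlicz_space_def intro!: borel_measurable_indicator order_le_less_trans[OF norm])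
    have "weak_orlicz_norm \<Psi> (frac_int \<rho> ?f) \<le> ennreal C * ennreal (1 / q)"
      using bdd[OF f] norm by (meson order_trans mult_left_mono zero_le)
    \<comment> \<open>Doubling the constant produces the strict inequality that
      \<open>weak_norm_lower\<close> asks for.\<close>
    also have "\<dots> < ennreal (2 * C / q)"
      using C q(2) by (simp add: ennreal_mult[symmetric] ennreal_less_iff divide_strict_right_mono)
    finally have "?v \<le> ennreal (2 * C / q) * gen_inverse \<Psi> (ennreal (1 / (w * r ^ CARD('n))))"
      unfolding w_def using bdd[OF f] by (intro weak_norm_lower[OF \<Psi> \<rho> \<rho>_pos r refl]) auto
    then have "?v * ennreal q \<le> ennreal (2 * C / q) * gen_inverse \<Psi> (ennreal (1 / (w * r ^ CARD('n)))) * ennreal q"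
      by (rule mult_right_mono) simp
    also have "\<dots> = (ennreal (2 * C / q) * ennreal q) * gen_inverse \<Psi> (ennreal (1 / (w * r ^ CARD('n))))"
      by (simp only: mult_ac)
    also have "ennreal (2 * C / q) * ennreal q = ennreal (2 * C)"
      using C q(2) by (simp add: ennreal_mult[symmetric])
    finally show "?v * gen_inverse \<Phi> (ennreal (1 / (w * (2 * r) ^ CARD('n)))) \<le>
        ennreal (2 * C) * gen_inverse \<Psi> (ennreal (1 / (w * r ^ CARD('n))))"
      unfolding q(1) .
  qed simp
qed

lemma frac_int_necessary_morrey:
  assumes \<Phi>: "\<Phi> \<in> Phi_bar" and D: "scaling \<Phi> D" and \<Psi>: "\<Psi> \<in> Phi_bar" and D': "scaling \<Psi> D'"
    and \<rho>: "\<rho> \<in> borel_measurable (lebesgue_on {0<..})" and \<rho>_pos: "\<And>t. t > 0 \<Longrightarrow> \<rho> t > 0"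
    and \<psi>_def: "\<psi> = (\<lambda>r. gen_inverse \<Psi> (ennreal (1 / r ^ CARD('n))))"
    and bdd: "frac_int_bounded \<rho> (orlicz_space \<Phi> :: (real ^ 'n \<Rightarrow> real) set) (orlicz_norm \<Phi>)
      (morrey_space \<psi>) (morrey_norm \<psi>)"
  shows "\<exists>A'>0. \<forall>r>0. rho_int \<rho> 0 r * gen_inverse \<Phi> (ennreal (1 / r ^ CARD('n)))
    \<le> ennreal A' * gen_inverse \<Psi> (ennreal (1 / r ^ CARD('n)))"
proof -
  define w where "w = unit_ball_vol CARD('n)"
  have w: "w > 0"
    by (simp add: w_def)
  obtain C where C: "C > 0" and bdd: "\<And>f :: real ^ 'n \<Rightarrow> real. f \<in> orlicz_space \<Phi> \<Longrightarrow>
      (AE x in lebesgue. integrable lebesgue (frac_integrand \<rho> f x)) \<and>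
      morrey_norm \<psi> (frac_int \<rho> f) \<le> ennreal C * orlicz_norm \<Phi> f"
    using bdd unfolding frac_int_bounded_def by blast
  \<comment> \<open>Exchanges \<Psi>^-1(1/r^n), which enters through \<psi>, for the inverse at the
    reciprocal ball volume, the form expected by \<open>necessity_rescale\<close>.\<close>
  define c where "c = max 1 w * D'"
  have c: "c > 0"
    using D' by (simp add: c_def scaling_def)
  show ?thesis
  proof (rule necessity_rescale[OF D D' _ w])
    show "C * c > 0"
      using C c by simp
    fix r :: real assume r: "r > 0"
    let ?f = "indicator (ball 0 (2 * r)) :: real ^ 'n \<Rightarrow> real"
    let ?v = "ennreal (CARD('n) * w) * rho_int \<rho> 0 r"
    obtain q where q: "gen_inverse \<Phi> (ennreal (1 / (w * (2 * r) ^ CARD('n)))) = ennreal q" "q > 0"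
      using gen_inverse_real[OF \<Phi>, of "1 / (w * (2 * r) ^ CARD('n))"] r w by auto
    obtain p where p: "\<psi> r = ennreal p" "p > 0"
      using gen_inverse_real[OF \<Psi>, of "1 / r ^ CARD('n)"] r by (auto simp: \<psi>_def)
    have norm: "orlicz_norm \<Phi> ?f \<le> ennreal (1 / q)"
      using r by (intro orlicz_norm_indicator_ball[OF \<Phi> _ refl q[unfolded w_def]]) simp
    then have f: "?f \<in> orlicz_space \<Phi>"
      by (auto simp: orlicz_space_def intro!: borel_measurable_indicator order_le_less_trans[OF norm])
    have "morrey_norm \<psi> (frac_int \<rho> ?f) \<le> ennreal C * ennreal (1 / q)"
      using bdd[OF f] norm by (meson order_trans mult_left_mono zero_le)
    also have "\<dots> = ennreal (C / q)"
      using C q(2) by (simp add: ennreal_mult[symmetric])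
    finally have "?v \<le> ennreal (C / q) * \<psi> r"
      unfolding w_def using bdd[OF f] C q(2) by (intro morrey_norm_lower[where \<psi> = \<psi> and p = p, OF \<Psi> \<rho> \<rho>_pos r refl]) (auto simp: p)
    also have "\<psi> r \<le> ennreal c * gen_inverse \<Psi> (ennreal (1 / (w * r ^ CARD('n))))"
    proof -
      have eq: "1 / r ^ CARD('n) = w * (1 / (w * r ^ CARD('n)))"
        using w by simp
      show ?thesis
        unfolding \<psi>_def c_def eq using r w by (intro gen_inverse_scale[OF D']) auto
    qed
    finally have "?v \<le> ennreal (C / q) * (ennreal c * gen_inverse \<Psi> (ennreal (1 / (w * r ^ CARD('n)))))"
      by (simp add: mult_left_mono)
    then have "?v * ennreal q \<le> ennreal (C / q) * (ennreal c * gen_inverse \<Psi> (ennreal (1 / (w * r ^ CARD('n))))) * ennreal q"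
      by (rule mult_right_mono) simp
    also have "\<dots> = (ennreal (C / q) * ennreal q) * (ennreal c * gen_inverse \<Psi> (ennreal (1 / (w * r ^ CARD('n)))))"
      by (simp only: mult_ac)
    also have "ennreal (C / q) * ennreal q = ennreal C"
      using C q(2) by (simp add: ennreal_mult[symmetric])
    also have "ennreal C * (ennreal c * gen_inverse \<Psi> (ennreal (1 / (w * r ^ CARD('n))))) =
        ennreal (C * c) * gen_inverse \<Psi> (ennreal (1 / (w * r ^ CARD('n))))"
      using C c by (simp add: ennreal_mult mult.assoc)
    finally show "?v * gen_inverse \<Phi> (ennreal (1 / (w * (2 * r) ^ CARD('n)))) \<le>
        ennreal (C * c) * gen_inverse \<Psi> (ennreal (1 / (w * r ^ CARD('n))))"
      unfolding q(1) .
  qed simp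
qed

lemma add_bounds_ennreal:
  fixes F G P :: "real \<Rightarrow> ennreal"
  assumes "\<exists>A>0. \<forall>r>0. F r \<le> ennreal A * P r" "\<exists>A>0. \<forall>r>0. G r \<le> ennreal A * P r"
  shows "\<exists>A>0. \<forall>r>0. F r + G r \<le> ennreal A * P r"
proof -
  obtain A A' where "A > 0" "\<And>r. r > 0 \<Longrightarrow> F r \<le> ennreal A * P r" "A' > 0" "\<And>r. r > 0 \<Longrightarrow> G r \<le> ennreal A' * P r"
    using assms by blast
  then show ?thesis
    by (intro exI[of _ "A + A'"]) (auto simp: distrib_right intro!: add_mono)
qed

theorem corollary3p8:
  fixes \<Phi> \<Psi> :: "ennreal \<Rightarrow> ennreal" and \<rho> :: "real \<Rightarrow> real"
  assumes Phi: "\<Phi> \<in> Phi_bar_Y" and Psi: "\<Psi> \<in> Phi_bar_Y"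
    and rho_pos: "\<forall>t>0. \<rho> t > 0"
    and rho_meas: "\<rho> \<in> borel_measurable (lebesgue_on {0<..})"
    and rho_int: "rho_int \<rho> 0 1 < \<infinity>"
    and rho_sup: "\<exists>C K1 K2 :: real. C > 0 \<and> 0 < K1 \<and> K1 < K2 \<and>
      (\<forall>r>0. (SUP t\<in>{r..2 * r}. ennreal (\<rho> t)) \<le> ennreal C * rho_int \<rho> (K1 * r) (K2 * r))"
  shows
    \<comment> \<open>(i)\<close>
    "((\<exists>A::real. A > 0 \<and> (\<forall>r>0.
         rho_int \<rho> 0 r * gen_inverse \<Phi> (ennreal (1 / r ^ CARD('n))) + rho_tail CARD('n) \<Phi> \<rho> r
           \<le> ennreal A * gen_inverse \<Psi> (ennreal (1 / r ^ CARD('n)))))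
      \<longrightarrow>
      (\<forall>C0::real. C0 > 0 \<longrightarrow> (\<exists>C1::real. C1 > 0 \<and>
        (\<forall>f :: real ^ 'n \<Rightarrow> real. f \<in> orlicz_space \<Phi> \<longrightarrow> \<not> (AE x in lebesgue. f x = 0) \<longrightarrow>
          (\<forall>x. \<Psi> (abs_frac_int \<rho> f x / (ennreal C1 * orlicz_norm \<Phi> f))
             \<le> \<Phi> (maximal f x / (ennreal C0 * orlicz_norm \<Phi> f)))) \<and>
        (\<Phi> \<in> nabla2_bar \<longrightarrow>
          (\<forall>f :: real ^ 'n \<Rightarrow> real. f \<in> weak_orlicz_space \<Phi> \<longrightarrow> \<not> (AE x in lebesgue. f x = 0) \<longrightarrow>
            (\<forall>x. \<Psi> (abs_frac_int \<rho> f x / (ennreal C1 * weak_orlicz_norm \<Phi> f))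
               \<le> \<Phi> (maximal f x / (ennreal C0 * weak_orlicz_norm \<Phi> f))))))) \<and>
      frac_int_bounded \<rho> (orlicz_space \<Phi> :: (real ^ 'n \<Rightarrow> real) set) (orlicz_norm \<Phi>)
        (weak_orlicz_space \<Psi>) (weak_orlicz_norm \<Psi>) \<and>
      (\<Phi> \<in> nabla2_bar \<longrightarrow>
        frac_int_bounded \<rho> (orlicz_space \<Phi> :: (real ^ 'n \<Rightarrow> real) set) (orlicz_norm \<Phi>)
          (orlicz_space \<Psi>) (orlicz_norm \<Psi>) \<and>
        frac_int_bounded \<rho> (weak_orlicz_space \<Phi> :: (real ^ 'n \<Rightarrow> real) set) (weak_orlicz_norm \<Phi>)
          (weak_orlicz_space \<Psi>) (weak_orlicz_norm \<Psi>)))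
    \<and>
    \<comment> \<open>(ii)\<close>
     (frac_int_bounded \<rho> (orlicz_space \<Phi> :: (real ^ 'n \<Rightarrow> real) set) (orlicz_norm \<Phi>)
        (weak_orlicz_space \<Psi>) (weak_orlicz_norm \<Psi>)
      \<longrightarrow>
      (\<exists>A'::real. A' > 0 \<and> (\<forall>r>0.
         rho_int \<rho> 0 r * gen_inverse \<Phi> (ennreal (1 / r ^ CARD('n)))
           \<le> ennreal A' * gen_inverse \<Psi> (ennreal (1 / r ^ CARD('n))))) \<and>
      ((\<exists>A''::real. A'' > 0 \<and> (\<forall>r>0.
          rho_tail CARD('n) \<Phi> \<rho> r \<le> ennreal A'' * gen_inverse \<Psi> (ennreal (1 / r ^ CARD('n)))))
       \<longrightarrow>
       (\<exists>A::real. A > 0 \<and> (\<forall>r>0.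
         rho_int \<rho> 0 r * gen_inverse \<Phi> (ennreal (1 / r ^ CARD('n))) + rho_tail CARD('n) \<Phi> \<rho> r
           \<le> ennreal A * gen_inverse \<Psi> (ennreal (1 / r ^ CARD('n)))))))
    \<and>
    \<comment> \<open>(iii)\<close>
     (let \<psi> = (\<lambda>r::real. gen_inverse \<Psi> (ennreal (1 / r ^ CARD('n)))) in
      frac_int_bounded \<rho> (orlicz_space \<Phi> :: (real ^ 'n \<Rightarrow> real) set) (orlicz_norm \<Phi>)
        (morrey_space \<psi>) (morrey_norm \<psi>)
      \<longrightarrow>
      (\<exists>A'::real. A' > 0 \<and> (\<forall>r>0.
         rho_int \<rho> 0 r * gen_inverse \<Phi> (ennreal (1 / r ^ CARD('n)))
           \<le> ennreal A' * gen_inverse \<Psi> (ennreal (1 / r ^ CARD('n))))) \<and>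
      ((\<exists>A''::real. A'' > 0 \<and> (\<forall>r>0.
          rho_tail CARD('n) \<Phi> \<rho> r \<le> ennreal A'' * gen_inverse \<Psi> (ennreal (1 / r ^ CARD('n)))))
       \<longrightarrow>
       (\<exists>A::real. A > 0 \<and> (\<forall>r>0.
         rho_int \<rho> 0 r * gen_inverse \<Phi> (ennreal (1 / r ^ CARD('n))) + rho_tail CARD('n) \<Phi> \<rho> r
           \<le> ennreal A * gen_inverse \<Psi> (ennreal (1 / r ^ CARD('n)))))))"
proof -
  have \<Phi>: "\<Phi> \<in> Phi_bar" and \<Psi>: "\<Psi> \<in> Phi_bar"
    using Phi Psi by (auto simp: Phi_bar_Y_def)
  obtain D D' where D: "scaling \<Phi> D" "scaling \<Psi> D'"
    using Phi_bar_Y_scaling[OF Phi] Phi_bar_Y_scaling[OF Psi] by metis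
  have pos: "\<rho> t > 0" if "t > 0" for t
    using rho_pos that by simp
  obtain C K1 K2 where K: "0 < K1" "K1 < K2" "0 < C"
    and sup_le: "\<And>r. r > 0 \<Longrightarrow> (SUP t\<in>{r..2 * r}. ennreal (\<rho> t)) \<le> ennreal C * rho_int \<rho> (K1 * r) (K2 * r)"
    using rho_sup by blast
  \<comment> \<open>Taking r = u and the left end point t = u of the supremum bounds \<rho>(u)
    itself.\<close>
  have sup: "ennreal (\<rho> u) \<le> ennreal C * rho_int \<rho> (K1 * u) (K2 * u)" if "u > 0" for u
    using that by (intro order_trans[OF SUP_upper sup_le]) auto
  show ?thesis
    unfolding Let_def
  \<comment> \<open>Cases 1 to 4 are sufficiency, 5 and 6 necessity from the weak Orlicz bound, 7
    and 8 necessity from the Morrey bound.\<close>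
  proof (intro conjI impI, goal_cases)
    case 1
    then obtain A where A: "A > 0" "\<And>r. r > 0 \<Longrightarrow>
        rho_int \<rho> 0 r * gen_inverse \<Phi> (ennreal (1 / r ^ CARD('n))) + rho_tail CARD('n) \<Phi> \<rho> r
        \<le> ennreal A * gen_inverse \<Psi> (ennreal (1 / r ^ CARD('n)))"
      by blast
    show ?case
      by (intro allI impI) (rule Orlicz_pointwise_norms[OF \<Phi> D(1) \<Psi> rho_meas pos K sup A])
  next
    case 2
    then obtain A where A: "A > 0" "\<And>r. r > 0 \<Longrightarrow>
        rho_int \<rho> 0 r * gen_inverse \<Phi> (ennreal (1 / r ^ CARD('n))) + rho_tail CARD('n) \<Phi> \<rho> r
        \<le> ennreal A * gen_inverse \<Psi> (ennreal (1 / r ^ CARD('n)))"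
      by blast
    show ?case
      by (rule frac_int_bounded_orlicz_weak[OF \<Phi> D(1) \<Psi> rho_meas pos K sup A])
  next
    case 3
    then obtain A where A: "A > 0" "\<And>r. r > 0 \<Longrightarrow>
        rho_int \<rho> 0 r * gen_inverse \<Phi> (ennreal (1 / r ^ CARD('n))) + rho_tail CARD('n) \<Phi> \<rho> r
        \<le> ennreal A * gen_inverse \<Psi> (ennreal (1 / r ^ CARD('n)))"
      by blast
    obtain k where k: "nabla2_const \<Phi> k"
      using 3(2) by (rule nabla2_barE)
    show ?case
      by (rule frac_int_bounded_strong[OF \<Phi> D(1) \<Psi> rho_meas pos K sup A k])
  next
    case 4
    then obtain A where A: "A > 0" "\<And>r. r > 0 \<Longrightarrow>
        rho_int \<rho> 0 r * gen_inverse \<Phi> (ennreal (1 / r ^ CARD('n))) + rho_tail CARD('n) \<Phi> \<rho> r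
        \<le> ennreal A * gen_inverse \<Psi> (ennreal (1 / r ^ CARD('n)))"
      by blast
    obtain k where k: "nabla2_const \<Phi> k"
      using 4(2) by (rule nabla2_barE)
    show ?case
      by (rule frac_int_bounded_weak_weak[OF \<Phi> D(1) \<Psi> rho_meas pos K sup A k])
  next
    case 5
    show ?case
      by (rule frac_int_necessary_weak[OF \<Phi> D(1) \<Psi> D(2) rho_meas pos 5])
  next
    case 6
    show ?case
      by (rule add_bounds_ennreal[OF frac_int_necessary_weak[OF \<Phi> D(1) \<Psi> D(2) rho_meas pos 6(1)] 6(2)])
  next
    case 7
    show ?case
      by (rule frac_int_necessary_morrey[OF \<Phi> D(1) \<Psi> D(2) rho_meas pos refl 7])
  next
    case 8
    show ?case
      by (rule add_bounds_ennreal[OF frac_int_necessary_morrey[OF \<Phi> D(1) \<Psi> D(2) rho_meas pos refl 8(1)] 8(2)])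
  qed
qed

end
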